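(* Let $p$ be a prime number, let $n\geqslant 3$ be a proper divisor of $p-1$, and let $k=(p-1)/n$. Let $a,b\in\mathbb{F}_p$ satisfy $ab\notin\{0,1\}$, let $\mathcal{G}$ be the projective plane curve over $\mathbb{F}_p$ with affine equation $aX^nY^n-X^n-Y^n+b=0$, and let $N_p(\mathcal{G})$ be the number of $\mathbb{F}_p$-rational points on the nonsingular model of $\mathcal{G}$. If $$p-1\leqslant n\left(\frac{(n+3)(n+4)(3n-1)}{12}-3\right),$$ then $$N_p(\mathcal{G})\leqslant n^2\left(3\,(2^{1/2}k)^{2/3}-\frac{103}{19}\,(2^{1/2}k)^{1/3}+\frac{13}{3}\right).$$
   Context: Under the stated hypotheses the curve $\mathcal{G}$ is geometrically irreducible; its nonsingular model is the nonsingular projective curve over $\mathbb{F}_p$ birational to it over $\mathbb{F}_p$. *)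

theory Defs
  imports
    "HOL-Analysis.Analysis"
    "HOL-Algebra.Algebraic_Closure_Type"
    "HOL-Library.Poly_Mapping"
    "HOL-Library.Extended_Nat"
begin

text \<open>
  Varieties are taken in the classical sense: sets of geometric points, that is, points with
  coordinates in the algebraic closure \<open>'k alg_closure\<close> of the base field \<open>'k\<close>.  The base field is
  meant to be perfect, so that a variety is defined over \<open>'k\<close> as soon as it is cut out by
  polynomials with coefficients in \<open>'k\<close>.  Points of projective space of dimension \<open>CARD('n) - 1\<close>
  are the lines through the origin in \<open>'a ^ 'n\<close>.
\<close>

type_synonym ('n, 'a) mpol = "('n \<Rightarrow>\<^sub>0 nat) \<Rightarrow>\<^sub>0 'a"

definition mpol_eval :: "('n::finite, 'a::field) mpol \<Rightarrow> 'a ^ 'n \<Rightarrow> 'a" where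
  "mpol_eval F x =
     (\<Sum>m\<in>Poly_Mapping.keys F. Poly_Mapping.lookup F m * (\<Prod>i\<in>UNIV. (x $ i) ^ Poly_Mapping.lookup m i))"

text \<open>
  The value at \<open>x\<close> of the formal partial derivative with respect to the variable \<open>j\<close>.  Monomials
  not containing \<open>j\<close> drop out because of the factor \<open>of_nat 0\<close>.
\<close>

definition mpol_pderiv_eval :: "'n \<Rightarrow> ('n::finite, 'a::field) mpol \<Rightarrow> 'a ^ 'n \<Rightarrow> 'a" where
  "mpol_pderiv_eval j F x =
     (\<Sum>m\<in>Poly_Mapping.keys F. Poly_Mapping.lookup F m * of_nat (Poly_Mapping.lookup m j) *
        (\<Prod>i\<in>UNIV. (x $ i) ^ (Poly_Mapping.lookup m i - (if i = j then 1 else 0))))"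

definition homogeneous :: "nat \<Rightarrow> ('n::finite, 'a::field) mpol \<Rightarrow> bool" where
  "homogeneous d F \<longleftrightarrow>
     (\<forall>m\<in>Poly_Mapping.keys F. (\<Sum>i\<in>UNIV. Poly_Mapping.lookup m i) = d)"

definition proj_space :: "('a::field ^ 'n) set set" where
  "proj_space = {vec.span {x} | x. x \<noteq> 0}"

definition zero_locus :: "('n::finite, 'a::field) mpol set \<Rightarrow> ('a ^ 'n) set set" where
  "zero_locus S = {L \<in> proj_space. \<forall>F\<in>S. \<forall>x\<in>L. mpol_eval F x = 0}"

definition zariski_closed :: "('a::field ^ 'n) set set \<Rightarrow> bool" where
  "zariski_closed Z \<longleftrightarrow> (\<exists>S. (\<forall>F\<in>S. \<exists>d. homogeneous d F) \<and> Z = zero_locus S)"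

definition zariski_closed_over_base :: "('k::field alg_closure ^ 'n) set set \<Rightarrow> bool" where
  "zariski_closed_over_base Z \<longleftrightarrow>
     (\<exists>S :: ('n, 'k) mpol set.
        (\<forall>F\<in>S. \<exists>d. homogeneous d F) \<and> Z = zero_locus (Poly_Mapping.map to_ac ` S))"

definition irreducible_closed :: "('a::field ^ 'n) set set \<Rightarrow> bool" where
  "irreducible_closed Z \<longleftrightarrow> zariski_closed Z \<and> Z \<noteq> {} \<and>
     (\<forall>A B. zariski_closed A \<longrightarrow> zariski_closed B \<longrightarrow> Z = A \<union> B \<longrightarrow> Z = A \<or> Z = B)"

text \<open>Krull dimension: the supremum of the lengths of chains of irreducible closed subsets.\<close>

definition zariski_dim :: "('a::field ^ 'n) set set \<Rightarrow> enat" where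
  "zariski_dim Z = Sup (enat ` {d. \<exists>W. (\<forall>i\<le>d. irreducible_closed (W i) \<and> W i \<subseteq> Z) \<and>
                                       (\<forall>i<d. W i \<subset> W (Suc i))})"

definition projective_curve :: "('k::field alg_closure ^ 'n) set set \<Rightarrow> bool" where
  "projective_curve C \<longleftrightarrow>
     zariski_closed_over_base C \<and> irreducible_closed C \<and> zariski_dim C = 1"

definition vanishing_ideal :: "('a::field ^ 'n) set set \<Rightarrow> ('n::finite, 'a) mpol set" where
  "vanishing_ideal Z = {F. (\<exists>d. homogeneous d F) \<and> (\<forall>L\<in>Z. \<forall>x\<in>L. mpol_eval F x = 0)}"

text \<open>
  The kernel of the Jacobian of the ideal of \<open>Z\<close> at the point \<open>L\<close>, i.e. the tangent space of the
  affine cone over \<open>Z\<close>.  By Euler's relation it contains the line \<open>L\<close>, and its quotient by \<open>L\<close>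
  is isomorphic to the Zariski tangent space of \<open>Z\<close> at \<open>L\<close>.  Hence the shift by one in the
  Jacobian criterion below.
\<close>

definition cone_tangent_space :: "('a::field ^ 'n) set set \<Rightarrow> ('a ^ 'n) set \<Rightarrow> ('a ^ 'n) set" where
  "cone_tangent_space Z L =
     {v. \<forall>F\<in>vanishing_ideal Z. \<forall>x\<in>L. (\<Sum>j\<in>UNIV. mpol_pderiv_eval j F x * v $ j) = 0}"

definition nonsingular :: "('a::field ^ 'n) set set \<Rightarrow> bool" where
  "nonsingular Z \<longleftrightarrow> (\<forall>L\<in>Z. enat (vec.dim (cone_tangent_space Z L)) = zariski_dim Z + 1)"

text \<open>
  A rational map over \<open>'k\<close> is given by homogeneous polynomials of one common degree with
  coefficients in \<open>'k\<close>; it is defined at the points where these do not all vanish.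
\<close>

definition mpol_map ::
    "('m \<Rightarrow> ('n::finite, 'k::field) mpol) \<Rightarrow> 'k alg_closure ^ 'n \<Rightarrow> 'k alg_closure ^ 'm" where
  "mpol_map F x = (\<chi> i. mpol_eval (Poly_Mapping.map to_ac (F i)) x)"

definition rational_map ::
    "('k::field alg_closure ^ 'n) set set \<Rightarrow> ('k alg_closure ^ 'm) set set \<Rightarrow>
     ('m \<Rightarrow> ('n::finite, 'k) mpol) \<Rightarrow> bool" where
  "rational_map V W F \<longleftrightarrow>
     (\<exists>d. \<forall>i. homogeneous d (F i)) \<and>
     (\<exists>L\<in>V. \<exists>x\<in>L. mpol_map F x \<noteq> 0) \<and>
     (\<forall>L\<in>V. \<forall>x\<in>L. mpol_map F x \<noteq> 0 \<longrightarrow> vec.span {mpol_map F x} \<in> W)"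

text \<open>The composition of \<open>F\<close> followed by \<open>H\<close> is a rational map on \<open>V\<close>, equal to the identity.\<close>

definition rational_left_inverse ::
    "('k::field alg_closure ^ 'n) set set \<Rightarrow> ('m \<Rightarrow> ('n::finite, 'k) mpol) \<Rightarrow>
     ('n \<Rightarrow> ('m::finite, 'k) mpol) \<Rightarrow> bool" where
  "rational_left_inverse V F H \<longleftrightarrow>
     (\<exists>L\<in>V. \<exists>x\<in>L. mpol_map F x \<noteq> 0 \<and> mpol_map H (mpol_map F x) \<noteq> 0) \<and>
     (\<forall>L\<in>V. \<forall>x\<in>L. mpol_map F x \<noteq> 0 \<and> mpol_map H (mpol_map F x) \<noteq> 0 \<longrightarrow>
        vec.span {mpol_map H (mpol_map F x)} = L)"

definition birational_over_base ::
    "('k::field alg_closure ^ 'n) set set \<Rightarrow> ('k alg_closure ^ 'm) set set \<Rightarrow> bool" where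
  "birational_over_base V W \<longleftrightarrow>
     (\<exists>F H. rational_map V W F \<and> rational_map W V H \<and>
            rational_left_inverse V F H \<and> rational_left_inverse W H F)"

text \<open>
  The nonsingular model of \<open>V\<close> is unique up to isomorphism over \<open>'k\<close>; this says that \<open>C\<close> is a
  projective embedding of it.
\<close>

definition is_nonsingular_model ::
    "('k::field alg_closure ^ 'm) set set \<Rightarrow> ('k alg_closure ^ 'n) set set \<Rightarrow> bool" where
  "is_nonsingular_model C V \<longleftrightarrow>
     projective_curve C \<and> nonsingular C \<and> birational_over_base C V"

definition rational_points ::
    "('k::field alg_closure ^ 'n) set set \<Rightarrow> ('k alg_closure ^ 'n) set set" where
  "rational_points C = {L \<in> C. \<exists>y :: 'k ^ 'n. y \<noteq> 0 \<and> L = vec.span {\<chi> i. to_ac (y $ i)}}"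

text \<open>
  The projective plane curve with affine equation \<open>a X\<^sup>n Y\<^sup>n - X\<^sup>n - Y\<^sup>n + b = 0\<close>, for \<open>a \<noteq> 0\<close>;
  the homogeneous coordinates are \<open>X = x $ 1\<close>, \<open>Y = x $ 2\<close>, \<open>Z = x $ 3\<close>.
\<close>

definition curve_G :: "nat \<Rightarrow> 'k::field \<Rightarrow> 'k \<Rightarrow> ('k alg_closure ^ 3) set set" where
  "curve_G n a b =
     {L \<in> proj_space. \<forall>x\<in>L.
        to_ac a * (x $ 1) ^ n * (x $ 2) ^ n - (x $ 1) ^ n * (x $ 3) ^ n
        - (x $ 2) ^ n * (x $ 3) ^ n + to_ac b * (x $ 3) ^ (2 * n) = 0}"

end

theory Submission
  imports Defs "Jordan_Normal_Form.Char_Poly" "HOL-Number_Theory.Residues"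
begin

hide_const (open) Determinants.det Finite_Cartesian_Product.mat Module.smult UnivPoly.coeff
  UnivPoly.monom Coset.order Polynomials.degree Polynomials.var Polynomials.lead_coeff
no_notation vec_index (infixl "$" 100)
no_notation fps_nth (infixl "$" 75)

text \<open>
  Points of the model: let \<open>(x, y)\<close> be a generic point of \<open>\<G>\<close> and \<open>c\<close> its image under the inverse
  birational map. At a rational point \<open>L\<close> of \<open>C\<close> the rational functions in \<open>c\<close> that are defined at
  \<open>L\<close> form a local ring; nonsingularity makes its maximal ideal principal (Taylor expansion, duality
  and Nakayama's lemma), and, any two functions on a curve being algebraically dependent, it is a
  valuation ring. So \<open>x\<close> and \<open>y\<close> have values in \<open>\<F>\<^sub>p \<union> {\<infinity>}\<close> at \<open>L\<close>. The closure of
  \<open>\<G>\<close> in \<open>\<P>\<^sup>1 \<times> \<P>\<^sup>1\<close> is nonsingular, so its local ring at these values is a valuation ring too;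
  being dominated by the local ring at \<open>L\<close>, it coincides with it. Hence the values determine \<open>L\<close>, and
  it suffices to count points of \<open>\<G>\<close> in \<open>\<P>\<^sup>1 \<times> \<P>\<^sup>1\<close>.

  Counting: with \<open>u = X\<^sup>n\<close> these correspond, \<open>n\<^sup>2\<close> to one, to the \<open>u\<close> with
  \<open>u\<^sup>k = ((u - b) / (a u - 1))\<^sup>k = 1\<close>. Such \<open>u\<close> are zeros of high multiplicity of the determinant with
  first row \<open>1, \<dots>, 1\<close> and the further rows \<open>\<theta>\<^sup>r P\<close>, where \<open>\<theta> = u d/du\<close> and \<open>P\<close> runs through
  \<open>u\<^bsup>ki\<^esup> (u - b)\<^bsup>kj\<^esup> (a u - 1)\<^bsup>k(s - 1 - j)\<^esup>\<close> with \<open>i, j < s\<close>; this determinant is nonzero and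
  vanishes to high order at \<open>0\<close>, \<open>b\<close> and \<open>1/a\<close> as well, and the choice of \<open>s\<close> about
  \<open>(\<surd>2 k)\<^bsup>1/3\<^esup>\<close> is optimal.
\<close>

section \<open>Bordered Wronskians\<close>

text \<open>The border of ones makes every admissible \<open>u\<close> count in full. All the
  polynomials \<open>P\<close> take the same value there, so after one column is subtracted from the
  others the determinant is a Wronskian of differences that vanish at \<open>u\<close>, and a common
  factor leaves a Wronskian once per column, with no loss through differentiation. The operator
  \<theta> is preferred to d/du because it acts on powers of \<open>u\<close> by scalars: it loses
  no order at 0, raises no degree, and in characteristic \<open>p\<close> the determinant is nonzero
  once the lowest exponents of a suitable basis are distinct modulo \<open>p\<close>. Each of the
  points 0, \<open>b\<close>, \<open>1/a\<close> and infinity has its own adapted basis. Comparing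
  orders with the degree yields \<open>M \<le> s\<^sup>2 - 2 s + (2 k + 2) / (s + 1)\<close> for the
  number \<open>M\<close> of admissible \<open>u\<close>. As for the model, \<open>C\<close> is only
  a set of geometric points, so its function field is realised inside the algebraic closure of a
  rational function field. The values of \<open>x\<close> and \<open>y\<close> are rational because
  relations on \<open>C\<close>, which is cut out over the prime field, persist when Frobenius is
  applied to their coefficients.\<close>

definition theta :: "'a::field poly \<Rightarrow> 'a poly" where
  "theta f = [:0, 1:] * pderiv f"

lemma theta_add: "theta (f + g) = theta f + theta g"
  by (simp add: theta_def pderiv_add algebra_simps)

lemma theta_diff: "theta (f - g) = theta f - theta g"
  by (simp add: theta_def pderiv_diff algebra_simps)

lemma theta_smult: "theta (smult c f) = smult c (theta f)"
  by (simp add: theta_def pderiv_smult)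

lemma theta_sum: "theta (sum f A) = (\<Sum>x\<in>A. theta (f x))"
  by (induction A rule: infinite_finite_induct) (auto simp: theta_add, auto simp: theta_def)

lemma theta_mult: "theta (f * g) = theta f * g + f * theta g"
  by (simp add: theta_def pderiv_mult algebra_simps)

lemma coeff_theta: "coeff (theta f) m = of_nat m * coeff f m"
  by (cases m) (simp_all add: theta_def coeff_pderiv)

lemma coeff_theta_pow: "coeff ((theta ^^ r) f) m = of_nat m ^ r * coeff f m"
  by (induction r) (simp_all add: coeff_theta)

lemma theta_pow_diff: "(theta ^^ r) (f - g) = (theta ^^ r) f - (theta ^^ r) g"
  by (induction r) (simp_all add: theta_diff)

lemma theta_pow_smult: "(theta ^^ r) (smult c f) = smult c ((theta ^^ r) f)"
  by (induction r) (simp_all add: theta_smult)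

lemma theta_pow_sum: "(theta ^^ r) (sum f A) = (\<Sum>x\<in>A. (theta ^^ r) (f x))"
  by (induction r) (simp_all add: theta_sum)

lemma degree_theta_pow: "degree ((theta ^^ r) f) \<le> degree f"
  by (rule degree_le) (simp add: coeff_theta_pow coeff_eq_0)

lemma power_dvd_theta_pow:
  assumes "[:- c, 1:] ^ m dvd f"
  shows "[:- c, 1:] ^ (m - r) dvd (theta ^^ r) f"
proof (induction r)
  case 0
  then show ?case using assms by simp
next
  case (Suc r)
  have *: "q ^ (e - 1) dvd theta g" if "q ^ e dvd g" for q g :: "'a poly" and e
  proof (cases e)
    case (Suc e')
    obtain h where g: "g = q ^ e * h" using \<open>q ^ e dvd g\<close> by (elim dvdE)
    have "theta g = q ^ e' * (smult (of_nat e) (theta q) * h + q * theta h)"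
      unfolding g theta_mult Suc
      by (simp only: theta_def pderiv_power_Suc) (simp add: algebra_simps)
    then show ?thesis using Suc by simp
  qed simp
  show ?case using *[OF Suc] by simp
qed

lemma X_power_dvd_iff: "[:0, 1:] ^ m dvd f \<longleftrightarrow> (\<forall>i<m. coeff f i = 0)" for f :: "'a::field poly"
proof -
  have "[:0, 1:] ^ m = monom (1::'a) m" by (simp add: monom_altdef)
  then show ?thesis using monom_1_dvd_iff'[of m f] by simp
qed

lemma X_power_dvd_theta_pow: "[:0, 1:] ^ m dvd f \<Longrightarrow> [:0, 1:] ^ m dvd (theta ^^ r) f"
  by (simp add: X_power_dvd_iff coeff_theta_pow)

text \<open>The constant border \<open>l\<close> is arbitrary, although the argument starts from a
  border of ones, because a change of basis of the columns acts on the border as well.\<close>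

definition bwr_mat :: "nat \<Rightarrow> (nat \<Rightarrow> 'a::field) \<Rightarrow> (nat \<Rightarrow> 'a poly) \<Rightarrow> 'a poly mat" where
  "bwr_mat d l f = Matrix.mat d d (\<lambda>(r, c). if r = 0 then [:l c:] else (theta ^^ (r - 1)) (f c))"

definition bwr :: "nat \<Rightarrow> (nat \<Rightarrow> 'a::field) \<Rightarrow> (nat \<Rightarrow> 'a poly) \<Rightarrow> 'a poly" where
  "bwr d l f = Determinant.det (bwr_mat d l f)"

lemma bwr_mat_carrier [simp]: "bwr_mat d l f \<in> carrier_mat d d"
  by (simp add: bwr_mat_def)

text \<open>A constant unitriangular matrix on the right commutes with \<open>theta\<close> and has
  determinant 1; the border is transformed along with the functions. This allows a separate basis of
  columns for every point at which an order is needed.\<close>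

lemma bwr_change_basis:
  assumes diag: "\<And>c. c < d \<Longrightarrow> E c c = 1"
    and upper: "\<And>r c. c < r \<Longrightarrow> r < d \<Longrightarrow> E r c = 0"
    and l': "\<And>c. c < d \<Longrightarrow> l' c = (\<Sum>j<d. E j c * l j)"
    and f': "\<And>c. c < d \<Longrightarrow> f' c = (\<Sum>j<d. smult (E j c) (f j))"
  shows "bwr d l' f' = bwr d l f"
proof -
  define U where "U = Matrix.mat d d (\<lambda>(r, c). [:E r c:])"
  have U: "U \<in> carrier_mat d d" by (simp add: U_def)
  have "bwr_mat d l' f' = bwr_mat d l f * U"
  proof (rule eq_matI)
    fix r c assume "r < dim_row (bwr_mat d l f * U)" "c < dim_col (bwr_mat d l f * U)"
    then have rc: "r < d" "c < d" by (simp_all add: bwr_mat_def U_def)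
    have "(bwr_mat d l f * U) $$ (r, c)
        = (\<Sum>j<d. (if r = 0 then [:l j:] else (theta ^^ (r - 1)) (f j)) * [:E j c:])"
      using rc by (auto simp: bwr_mat_def U_def scalar_prod_def lessThan_atLeast0 intro!: sum.cong)
    also have "\<dots> = bwr_mat d l' f' $$ (r, c)"
    proof (cases "r = 0")
      case True
      have "(\<Sum>j<d. [:l j * E j c:]) = [:\<Sum>j<d. E j c * l j:]"
        by (simp add: mult.commute flip: sum_to_poly)
      then show ?thesis using rc True by (simp add: bwr_mat_def l' mult.commute)
    next
      case False
      then show ?thesis
        using rc by (simp add: bwr_mat_def f' theta_pow_sum theta_pow_smult)
    qed
    finally show "bwr_mat d l' f' $$ (r, c) = (bwr_mat d l f * U) $$ (r, c)" by simp
  qed (simp_all add: bwr_mat_def U_def)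
  moreover have "Determinant.det U = 1"
  proof -
    have "upper_triangular U" unfolding upper_triangular_def using upper by (auto simp: U_def)
    moreover have "diag_mat U = replicate d 1"
      by (rule nth_equalityI) (auto simp: diag_mat_def U_def diag one_pCons)
    ultimately show ?thesis using det_upper_triangular[OF _ U] by simp
  qed
  ultimately show ?thesis
    unfolding bwr_def by (simp add: det_mult[OF bwr_mat_carrier U])
qed

lemma bwr_expand:
  "bwr d l f = (\<Sum>\<sigma> | \<sigma> permutes {0..<d}. signof \<sigma> *
     (\<Prod>i = 0..<d. if i = 0 then [:l (\<sigma> i):] else (theta ^^ (i - 1)) (f (\<sigma> i))))"
proof -
  have "(\<Prod>i = 0..<d. bwr_mat d l f $$ (i, \<sigma> i))
      = (\<Prod>i = 0..<d. if i = 0 then [:l (\<sigma> i):] else (theta ^^ (i - 1)) (f (\<sigma> i)))"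
    if "\<sigma> permutes {0..<d}" for \<sigma>
    using permutes_in_image[OF that] by (intro prod.cong) (auto simp: bwr_mat_def)
  then show ?thesis
    unfolding bwr_def by (subst det_def'[of _ d]) (auto intro!: sum.cong)
qed

text \<open>In each term of the permutation expansion the column \<open>\<sigma> 0\<close> is spent
  on the border, and the remaining columns carry the total weight minus the weight of that
  one.\<close>

lemma sum_permutes_Suc:
  fixes g :: "nat \<Rightarrow> nat"
  assumes "\<sigma> permutes {0..<Suc d}"
  shows "g (\<sigma> 0) + (\<Sum>i<d. g (\<sigma> (Suc i))) = (\<Sum>c<Suc d. g c)"
proof -
  have "(\<Sum>c<Suc d. g c) = (\<Sum>c<Suc d. g (\<sigma> c))"
    using sum.permute[OF assms, of g] by (simp add: lessThan_atLeast0 o_def)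
  also have "\<dots> = g (\<sigma> 0) + (\<Sum>i<d. g (\<sigma> (Suc i)))"
    by (rule sum.lessThan_Suc_shift)
  finally show ?thesis by simp
qed

lemma bwr_expand_Suc:
  "bwr (Suc d) l f = (\<Sum>\<sigma> | \<sigma> permutes {0..<Suc d}. signof \<sigma> *
     ([:l (\<sigma> 0):] * (\<Prod>i<d. (theta ^^ i) (f (\<sigma> (Suc i))))))"
proof -
  have "(\<Prod>i = 0..<Suc d. if i = 0 then [:l (\<sigma> i):] else (theta ^^ (i - 1)) (f (\<sigma> i)))
     = [:l (\<sigma> 0):] * (\<Prod>i<d. (theta ^^ i) (f (\<sigma> (Suc i))))" for \<sigma>
    by (simp only: atLeast0LessThan prod.lessThan_Suc_shift) simp
  then show ?thesis unfolding bwr_expand by simp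
qed

text \<open>Estimated term by term: the column that meets the border contributes no order, which
  costs at most the maximal weight \<open>mx\<close>, and the row with \<open>theta ^^ i\<close>
  loses \<open>loss i\<close>. The loss is a parameter because it is 0 at the origin and
  \<open>i\<close> at other points.\<close>

lemma power_dvd_bwr:
  assumes ord: "\<And>c i. c < Suc d \<Longrightarrow> q ^ (w c - loss i) dvd (theta ^^ i) (f c)"
    and mx: "\<And>c. c < Suc d \<Longrightarrow> w c \<le> mx"
    and e: "e + mx + (\<Sum>i<d. loss i) \<le> (\<Sum>c<Suc d. w c)"
  shows "q ^ e dvd bwr (Suc d) l f"
  unfolding bwr_expand_Suc
proof (intro dvd_sum dvd_mult)
  fix \<sigma> assume "\<sigma> \<in> {\<sigma>. \<sigma> permutes {0..<Suc d}}"
  then have \<sigma>: "\<sigma> permutes {0..<Suc d}" by simp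
  have in_range: "\<sigma> i < Suc d" if "i < Suc d" for i
    using permutes_in_image[OF \<sigma>, of i] that by simp
  have "(\<Sum>i<d. w (\<sigma> (Suc i))) \<le> (\<Sum>i<d. (w (\<sigma> (Suc i)) - loss i) + loss i)"
    by (intro sum_mono) simp
  then have "e \<le> (\<Sum>i<d. w (\<sigma> (Suc i)) - loss i)"
    using e sum_permutes_Suc[OF \<sigma>, of w] mx[OF in_range[of 0]] by (simp add: sum.distrib)
  then have "q ^ e dvd q ^ (\<Sum>i<d. w (\<sigma> (Suc i)) - loss i)" by (rule le_imp_power_dvd)
  also have "\<dots> = (\<Prod>i<d. q ^ (w (\<sigma> (Suc i)) - loss i))" by (simp add: power_sum)
  also have "\<dots> dvd (\<Prod>i<d. (theta ^^ i) (f (\<sigma> (Suc i))))"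
    by (intro prod_dvd_prod ord in_range) auto
  finally show "q ^ e dvd (\<Prod>i<d. (theta ^^ i) (f (\<sigma> (Suc i))))" .
qed

text \<open>The column that meets the border contributes a constant, which saves at least the
  minimal weight \<open>mn\<close>, while \<open>theta\<close> raises no degree.\<close>

lemma degree_bwr:
  assumes deg: "\<And>c. c < Suc d \<Longrightarrow> degree (f c) \<le> \<delta> c"
    and mn: "\<And>c. c < Suc d \<Longrightarrow> mn \<le> \<delta> c"
  shows "degree (bwr (Suc d) l f) + mn \<le> (\<Sum>c<Suc d. \<delta> c)"
proof -
  have "degree (bwr (Suc d) l f) \<le> (\<Sum>c<Suc d. \<delta> c) - mn"
    unfolding bwr_expand_Suc
  proof (rule degree_sum_le)
    show "finite {\<sigma>. \<sigma> permutes {0..<Suc d}}" by (simp add: finite_permutations)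
    fix \<sigma> assume "\<sigma> \<in> {\<sigma>. \<sigma> permutes {0..<Suc d}}"
    then have \<sigma>: "\<sigma> permutes {0..<Suc d}" by simp
    have in_range: "\<sigma> i < Suc d" if "i < Suc d" for i
      using permutes_in_image[OF \<sigma>, of i] that by simp
    have "degree (signof \<sigma> * ([:l (\<sigma> 0):] * (\<Prod>i<d. (theta ^^ i) (f (\<sigma> (Suc i))))))
        \<le> degree (\<Prod>i<d. (theta ^^ i) (f (\<sigma> (Suc i))))"
      by (auto simp: sign_def intro: degree_smult_le)
    also have "\<dots> \<le> (\<Sum>i<d. degree ((theta ^^ i) (f (\<sigma> (Suc i)))))"
      using degree_prod_sum_le[of "{..<d}" "\<lambda>i. (theta ^^ i) (f (\<sigma> (Suc i)))"] by (simp add: o_def)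
    also have "\<dots> \<le> (\<Sum>i<d. \<delta> (\<sigma> (Suc i)))"
      using in_range by (intro sum_mono) (auto intro: order.trans[OF degree_theta_pow deg])
    also have "\<dots> \<le> (\<Sum>c<Suc d. \<delta> c) - mn"
      using sum_permutes_Suc[OF \<sigma>, of \<delta>] mn[OF in_range[of 0]] by simp
    finally show "degree (signof \<sigma> * ([:l (\<sigma> 0):] * (\<Prod>i<d. (theta ^^ i) (f (\<sigma> (Suc i))))))
        \<le> (\<Sum>c<Suc d. \<delta> c) - mn" .
  qed
  moreover have "mn \<le> (\<Sum>c<Suc d. \<delta> c)"
    using mn[of 0] by (simp add: sum.lessThan_Suc_shift del: sum.lessThan_Suc)
  ultimately show ?thesis by simp
qed

text \<open>Coefficients of the product rule for powers of \<open>theta\<close>. As a matrix in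
  \<open>r\<close> and \<open>t\<close> they are lower triangular with \<open>q\<close> on the
  diagonal, which is where the factor \<open>q ^ d\<close> of the Wronskian comes from.\<close>

fun leibniz :: "'a::field poly \<Rightarrow> nat \<Rightarrow> nat \<Rightarrow> 'a poly" where
  "leibniz q 0 t = (if t = 0 then q else 0)"
| "leibniz q (Suc r) t = theta (leibniz q r t) + (if t = 0 then 0 else leibniz q r (t - 1))"

lemma leibniz_above: "r < t \<Longrightarrow> leibniz q r t = 0"
  by (induction r arbitrary: t) (auto simp: theta_def)

lemma leibniz_diag: "leibniz q r r = q"
  by (induction r) (auto simp: leibniz_above theta_def)

lemma theta_pow_mult: "r < d \<Longrightarrow> (theta ^^ r) (q * h) = (\<Sum>t<d. leibniz q r t * (theta ^^ t) h)"
proof (induction r)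
  case 0
  have "(\<Sum>t<d. leibniz q 0 t * (theta ^^ t) h) = (\<Sum>t\<in>{0}. leibniz q 0 t * (theta ^^ t) h)"
    using 0 by (intro sum.mono_neutral_right) auto
  then show ?case by simp
next
  case (Suc r)
  obtain d' where d: "d = Suc d'" using Suc.prems by (cases d) auto
  have "(\<Sum>t<d. leibniz q r t * (theta ^^ Suc t) h) = (\<Sum>t<d'. leibniz q r t * (theta ^^ Suc t) h)"
    using Suc.prems by (simp add: d leibniz_above)
  also have "\<dots> = (\<Sum>t<d. (if t = 0 then 0 else leibniz q r (t - 1)) * (theta ^^ t) h)"
    unfolding d by (subst sum.lessThan_Suc_shift) simp
  finally have shift: "(\<Sum>t<d. leibniz q r t * (theta ^^ Suc t) h)
      = (\<Sum>t<d. (if t = 0 then 0 else leibniz q r (t - 1)) * (theta ^^ t) h)" .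
  have "(theta ^^ Suc r) (q * h) = (\<Sum>t<d. theta (leibniz q r t) * (theta ^^ t) h)
      + (\<Sum>t<d. leibniz q r t * (theta ^^ Suc t) h)"
    using Suc by (simp add: theta_sum theta_mult sum.distrib)
  then show ?case unfolding shift by (simp add: algebra_simps sum.distrib)
qed

text \<open>Subtracting column 0 from the others turns the border into a unit vector and leaves the
  Wronskian of \<open>d\<close> functions divisible by \<open>q\<close>. By the product rule its
  matrix is the triangular matrix \<open>T\<close> times the Wronskian matrix of the
  quotients.\<close>

lemma power_dvd_bwr_common:
  assumes one: "\<And>c. c < Suc d \<Longrightarrow> l c = 1"
    and q: "\<And>c. c < Suc d \<Longrightarrow> q dvd f c - f 0"
  shows "q ^ d dvd bwr (Suc d) l f"
proof -
  define g where "g c = (if c = 0 then f 0 else f c - f 0)" for c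
  define E :: "nat \<Rightarrow> nat \<Rightarrow> 'a" where
    "E j c = (if j = c then 1 else if j = 0 then -1 else 0)" for j c
  have E_sum: "(\<Sum>j<Suc d. smult (E j c) (h j)) = (if c = 0 then h 0 else h c - h 0)"
    if "c < Suc d" for h :: "nat \<Rightarrow> 'a poly" and c
  proof -
    have "(\<Sum>j<Suc d. smult (E j c) (h j)) = (\<Sum>j\<in>{0, c}. smult (E j c) (h j))"
      using that by (intro sum.mono_neutral_right) (auto simp: E_def)
    then show ?thesis by (auto simp: E_def)
  qed
  have E_sum': "(\<Sum>j<Suc d. E j c * l j) = (if c = 0 then 1 else 0)" if "c < Suc d" for c
  proof -
    have "(\<Sum>j<Suc d. E j c * l j) = (\<Sum>j\<in>{0, c}. E j c * l j)"
      using that by (intro sum.mono_neutral_right) (auto simp: E_def)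
    then show ?thesis using that by (auto simp: E_def one)
  qed
  define l' :: "nat \<Rightarrow> 'a" where "l' c = (if c = 0 then 1 else 0)" for c
  have "bwr (Suc d) l' g = bwr (Suc d) l f"
  proof (rule bwr_change_basis[where E = E])
    fix c assume c: "c < Suc d"
    show "l' c = (\<Sum>j<Suc d. E j c * l j)" unfolding E_sum'[OF c] l'_def ..
    show "g c = (\<Sum>j<Suc d. smult (E j c) (f j))" unfolding E_sum[OF c] g_def ..
  qed (auto simp: E_def)
  moreover have "\<exists>h. \<forall>c<Suc d. 0 < c \<longrightarrow> g c = q * h c"
    using q by (intro exI[of _ "\<lambda>c. (f c - f 0) div q"]) (auto simp: g_def)
  then obtain h where h: "\<And>c. c < d \<Longrightarrow> g (Suc c) = q * h (Suc c)" by auto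
  define T where "T = Matrix.mat d d (\<lambda>(r, t). leibniz q r t)"
  define Hm where "Hm = Matrix.mat d d (\<lambda>(t, c). (theta ^^ t) (h (Suc c)))"
  have TH: "T \<in> carrier_mat d d" "Hm \<in> carrier_mat d d" by (simp_all add: T_def Hm_def)
  have del: "mat_delete (bwr_mat (Suc d) l' g) 0 0 = T * Hm"
  proof (rule eq_matI)
    fix r c assume "r < dim_row (T * Hm)" "c < dim_col (T * Hm)"
    then have rc: "r < d" "c < d" by (simp_all add: T_def Hm_def)
    have "(T * Hm) $$ (r, c) = (\<Sum>t<d. leibniz q r t * (theta ^^ t) (h (Suc c)))"
      using rc by (auto simp: T_def Hm_def scalar_prod_def lessThan_atLeast0 intro!: sum.cong)
    then show "mat_delete (bwr_mat (Suc d) l' g) 0 0 $$ (r, c) = (T * Hm) $$ (r, c)"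
      using rc h[OF rc(2)] by (simp add: theta_pow_mult mat_delete_def bwr_mat_def)
  qed (simp_all add: mat_delete_def bwr_mat_def T_def Hm_def)
  have "Determinant.det T = q ^ d"
  proof -
    have "diag_mat T = replicate d q"
      by (rule nth_equalityI) (auto simp: diag_mat_def T_def leibniz_diag)
    then show ?thesis
      by (subst det_lower_triangular[OF _ TH(1)]) (auto simp: T_def leibniz_above)
  qed
  moreover have "bwr (Suc d) l' g = Determinant.det (mat_delete (bwr_mat (Suc d) l' g) 0 0)"
  proof -
    have "bwr (Suc d) l' g
        = (\<Sum>j<Suc d. bwr_mat (Suc d) l' g $$ (0, j) * cofactor (bwr_mat (Suc d) l' g) 0 j)"
      unfolding bwr_def by (rule laplace_expansion_row) auto
    also have "\<dots> = (\<Sum>j\<in>{0}. bwr_mat (Suc d) l' g $$ (0, j) * cofactor (bwr_mat (Suc d) l' g) 0 j)"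
      by (intro sum.mono_neutral_right) (auto simp: bwr_mat_def l'_def)
    finally show ?thesis by (simp add: bwr_mat_def l'_def cofactor_def)
  qed
  ultimately show ?thesis unfolding del by (metis det_mult[OF TH] dvd_triv_left)
qed

lemma smult_sum_right: "smult c (sum f A) = (\<Sum>x\<in>A. smult c (f x))"
  by (induction A rule: infinite_finite_induct) (simp_all add: smult_add_right)

text \<open>A linear relation between the rows is a differential operator of order below \<open>d\<close> in \<open>\<theta>\<close> that
  kills the \<open>d\<close> combinations of the columns in the kernel of \<open>l\<close>. Their lowest terms are
  distinct powers of \<open>X\<close>, and the exponents would all be roots of the indicial polynomial of the operator.\<close>

lemma bwr_nonzero:
  fixes f :: "nat \<Rightarrow> 'a::field poly"
  assumes low: "\<And>c. c < Suc d \<Longrightarrow> coeff (f c) (w c) \<noteq> 0"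
    and below: "\<And>c i. c < Suc d \<Longrightarrow> i < w c \<Longrightarrow> coeff (f c) i = 0"
    and inj: "inj_on (\<lambda>c. of_nat (w c) :: 'a) {..<Suc d}"
    and m': "m' < Suc d" "l m' \<noteq> 0"
  shows "bwr (Suc d) l f \<noteq> 0"
proof
  assume "bwr (Suc d) l f = 0"
  then have "Determinant.det (transpose_mat (bwr_mat (Suc d) l f)) = 0"
    by (simp add: bwr_def det_transpose[of _ "Suc d"])
  then obtain v where v: "v \<in> carrier_vec (Suc d)" "v \<noteq> 0\<^sub>v (Suc d)"
    "transpose_mat (bwr_mat (Suc d) l f) *\<^sub>v v = 0\<^sub>v (Suc d)"
    using det_0_iff_vec_prod_zero[of "transpose_mat (bwr_mat (Suc d) l f)" "Suc d"] by auto
  define v0 where "v0 = vec_index v 0"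
  define q where "q r = vec_index v (Suc r)" for r
  define L where "L g = (\<Sum>r<d. q r * (theta ^^ r) g)" for g
  have rel: "[:l c:] * v0 + L (f c) = 0" if c: "c < Suc d" for c
  proof -
    have "0 = vec_index (transpose_mat (bwr_mat (Suc d) l f) *\<^sub>v v) c"
      using v(3) c by simp
    also have "\<dots> = (\<Sum>r<Suc d. bwr_mat (Suc d) l f $$ (r, c) * vec_index v r)"
      using c v(1) by (auto simp: bwr_mat_def scalar_prod_def lessThan_atLeast0 intro!: sum.cong)
    also have "\<dots> = [:l c:] * v0 + (\<Sum>r<d. (theta ^^ r) (f c) * q r)"
      using c by (simp only: sum.lessThan_Suc_shift) (simp add: bwr_mat_def v0_def q_def)
    finally show ?thesis by (simp add: L_def mult.commute)
  qed
  have ex: "\<exists>\<nu> r. r < d \<and> coeff (q r) \<nu> \<noteq> 0"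
  proof (rule ccontr)
    assume none: "\<not> ?thesis"
    then have q0: "q r = 0" if "r < d" for r
      using that by (auto intro: poly_eqI)
    then have "L (f m') = 0" by (simp add: L_def)
    with rel[OF m'(1)] m'(2) have "v0 = 0" by simp
    have "v = 0\<^sub>v (Suc d)"
    proof (rule eq_vecI)
      fix i assume "i < dim_vec (0\<^sub>v (Suc d) :: 'a poly Matrix.vec)"
      then show "vec_index v i = vec_index (0\<^sub>v (Suc d)) i"
        using q0 \<open>v0 = 0\<close> by (cases i) (auto simp: q_def v0_def)
    qed (use v in simp)
    with v(2) show False by simp
  qed
  \<comment> \<open>\<open>\<nu>\<close> is the lowest power of X in the coefficients of the
    operator \<open>L\<close>; only the coefficients at \<open>\<nu>\<close> act on the lowest term
    of a function, through the polynomial \<open>ind\<close>.\<close>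
  define \<nu> where "\<nu> = (LEAST \<nu>. \<exists>r<d. coeff (q r) \<nu> \<noteq> 0)"
  obtain r0 where r0: "r0 < d" "coeff (q r0) \<nu> \<noteq> 0"
    using LeastI_ex[OF ex] unfolding \<nu>_def by blast
  have \<nu>_least: "coeff (q r) i = 0" if "r < d" "i < \<nu>" for r i
    using not_less_Least[of i "\<lambda>\<nu>. \<exists>r<d. coeff (q r) \<nu> \<noteq> 0"] that unfolding \<nu>_def by blast
  define ind where "ind = (\<Sum>r<d. monom (coeff (q r) \<nu>) r)"
  have coeff_L: "coeff (L g) (e + \<nu>) = poly ind (of_nat e) * coeff g e"
    if g: "\<And>i. i < e \<Longrightarrow> coeff g i = 0" for g e
  proof -
    have "coeff (q r * (theta ^^ r) g) (e + \<nu>) = coeff (q r) \<nu> * of_nat e ^ r * coeff g e"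
      if r: "r < d" for r
    proof -
      have "coeff (q r * (theta ^^ r) g) (e + \<nu>)
          = (\<Sum>i\<le>e + \<nu>. coeff (q r) i * coeff ((theta ^^ r) g) (e + \<nu> - i))"
        by (rule coeff_mult)
      also have "\<dots> = (\<Sum>i\<in>{\<nu>}. coeff (q r) i * coeff ((theta ^^ r) g) (e + \<nu> - i))"
      proof (rule sum.mono_neutral_right)
        show "\<forall>i\<in>{..e + \<nu>} - {\<nu>}. coeff (q r) i * coeff ((theta ^^ r) g) (e + \<nu> - i) = 0"
        proof
          fix i assume i: "i \<in> {..e + \<nu>} - {\<nu>}"
          consider "i < \<nu>" | "e + \<nu> - i < e" using i by fastforce
          then show "coeff (q r) i * coeff ((theta ^^ r) g) (e + \<nu> - i) = 0"
            using \<nu>_least[OF r] g by cases (auto simp: coeff_theta_pow)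
        qed
      qed auto
      finally show ?thesis by (simp add: coeff_theta_pow)
    qed
    then show ?thesis
      by (simp add: L_def ind_def coeff_sum poly_sum poly_monom sum_distrib_right)
  qed
  have inj_w: "inj_on w {..<Suc d}"
    using inj by (auto simp: inj_on_def)
  \<comment> \<open>The border is eliminated with the column \<open>m\<close> whose lowest exponent
    is largest among those with nonzero border entry; subtracting it then leaves the lowest terms of
    the other columns intact.\<close>
  define M where "M = {c. c < Suc d \<and> l c \<noteq> 0}"
  have "finite M" "M \<noteq> {}" using m' by (auto simp: M_def)
  then have "Max (w ` M) \<in> w ` M" by (intro Max_in) auto
  then obtain m where "m \<in> M" "Max (w ` M) = w m" by (rule imageE)
  then have m: "m \<in> M" "\<And>c. c \<in> M \<Longrightarrow> w c \<le> w m"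
    using Max_ge[of "w ` M"] \<open>finite M\<close> by (metis finite_imageI imageI)+
  have root: "poly ind (of_nat (w c)) = 0" if c: "c \<in> {..<Suc d} - {m}" for c
  proof -
    have c': "c < Suc d" "c \<noteq> m" using c by auto
    have m': "m < Suc d" "l m \<noteq> 0" using m(1) by (auto simp: M_def)
    define g where "g = f c - smult (l c / l m) (f m)"
    have "w c < w m" if "l c \<noteq> 0"
    proof -
      have "w c \<le> w m" using m(2)[of c] that c' by (simp add: M_def)
      moreover have "w c \<noteq> w m" using inj_onD[OF inj_w, of c m] c' m' by auto
      ultimately show ?thesis by simp
    qed
    then have low_m: "l c / l m * coeff (f m) i = 0" if "i \<le> w c" for i
      using that below[OF m'(1), of i] by (cases "l c = 0") auto
    have g_below: "coeff g i = 0" if "i < w c" for i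
    proof -
      have "coeff g i = coeff (f c) i - l c / l m * coeff (f m) i" by (simp add: g_def)
      then show ?thesis using that below[OF c'(1) that] low_m[of i] by simp
    qed
    have g_low: "coeff g (w c) \<noteq> 0"
      using low[OF c'(1)] by (simp only: g_def coeff_diff coeff_smult low_m[OF order_refl] diff_zero not_False_eq_True)
    have "L g = L (f c) - smult (l c / l m) (L (f m))"
      by (simp add: L_def g_def theta_pow_diff theta_pow_smult right_diff_distrib
          sum_subtractf smult_sum_right)
    also have "\<dots> = - [:l c:] * v0 + smult (l c / l m) ([:l m:] * v0)"
      by (simp only: minus_unique[OF rel[OF c'(1)], symmetric] minus_unique[OF rel[OF m'(1)], symmetric])
        simp
    also have "\<dots> = 0" using m' by simp
    finally have "L g = 0" .
    with coeff_L[of "w c" g] g_below g_low show ?thesis by simp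
  qed
  have "ind \<noteq> 0"
  proof
    assume "ind = 0"
    then have "0 = coeff ind r0" by simp
    also have "\<dots> = coeff (q r0) \<nu>" using r0 by (simp add: ind_def coeff_sum)
    finally show False using r0 by simp
  qed
  have "degree ind < d"
    unfolding ind_def using r0(1) by (intro degree_sum_less) (auto intro: le_less_trans[OF degree_monom_le])
  moreover have "d \<le> card {x. poly ind x = 0}"
  proof -
    have "card ((\<lambda>c. of_nat (w c) :: 'a) ` ({..<Suc d} - {m})) = card ({..<Suc d} - {m})"
      by (rule card_image) (rule inj_on_subset[OF inj], auto)
    also have "\<dots> = d" using m(1) by (simp add: M_def)
    finally have "d = card ((\<lambda>c. of_nat (w c) :: 'a) ` ({..<Suc d} - {m}))" ..
    also have "\<dots> \<le> card {x. poly ind x = 0}"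
      using root poly_roots_finite[OF \<open>ind \<noteq> 0\<close>] by (intro card_mono) auto
    finally show ?thesis .
  qed
  ultimately show False using card_poly_roots_bound[OF \<open>ind \<noteq> 0\<close>] by simp
qed

section \<open>Orders of zeros, and determinants of grids of products of powers\<close>

lemma sum_order_le_degree:
  fixes q :: "'a::field poly"
  assumes "finite B" "q \<noteq> 0"
  shows "(\<Sum>c\<in>B. order c q) \<le> degree q"
  using assms
proof (induction B arbitrary: q)
  case (insert c B)
  define e where "e = order c q"
  obtain r where r: "q = [:- c, 1:] ^ e * r"
    using order_1[of c q] unfolding e_def by (elim dvdE)
  have "r \<noteq> 0" using r insert.prems by auto
  have "order x q = order x r" if "x \<in> B" for x
  proof -
    have "x \<noteq> c" using that insert.hyps by auto
    then have "order x ([:- c, 1:] ^ e) = 0" by (intro order_0I) simp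
    moreover have "[:- c, 1:] ^ e * r \<noteq> 0" using \<open>r \<noteq> 0\<close> by simp
    ultimately show ?thesis unfolding r by (simp add: Polynomial.order_mult)
  qed
  moreover have "degree q = e + degree r"
    unfolding r using \<open>r \<noteq> 0\<close> by (subst degree_mult_eq) (simp_all add: degree_power_eq)
  ultimately show ?case
    using insert.hyps insert.IH[OF \<open>r \<noteq> 0\<close>] by (simp add: e_def)
qed simp

lemma sum_grid: "(\<Sum>r<s * s'. g r) = (\<Sum>i<s. \<Sum>j<s'. g (i * s' + j))"
  for g :: "nat \<Rightarrow> 'a::comm_monoid_add"
proof -
  have "sum g {c..<c + m} = (\<Sum>j<m. g (c + j))" for c m
    by (induction m) auto
  then show ?thesis by (simp add: sum.nat_group[symmetric])
qed

text \<open>Column \<open>c\<close> stands for the pair \<open>(c div s, c mod s)\<close>. The last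
  two factors form a monomial of degree \<open>s - 1\<close> in \<open>V\<close> and
  \<open>Z\<close>, so that replacing \<open>V\<close> by \<open>V - v Z\<close> is a change of
  basis.\<close>

definition grid :: "nat \<Rightarrow> 'a::field poly \<Rightarrow> 'a poly \<Rightarrow> 'a poly \<Rightarrow> nat \<Rightarrow> 'a poly" where
  "grid s U V Z c = U ^ (c div s) * V ^ (c mod s) * Z ^ (s - 1 - c mod s)"

lemma binomial_sum_smult:
  fixes V Z :: "'a::field poly"
  assumes "e < s"
  shows "(V - smult v Z) ^ e = (\<Sum>j<s. smult (of_nat (e choose j) * (- v) ^ (e - j)) (V ^ j * Z ^ (e - j)))"
proof -
  have "(V - smult v Z) ^ e = (V + smult (- v) Z) ^ e" by simp
  also have "\<dots> = (\<Sum>j\<le>e. of_nat (e choose j) * V ^ j * (smult (- v) Z) ^ (e - j))"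
    by (rule binomial_ring)
  also have "\<dots> = (\<Sum>j\<le>e. smult (of_nat (e choose j) * (- v) ^ (e - j)) (V ^ j * Z ^ (e - j)))"
    by (intro sum.cong refl) (simp only: smult_power, simp add: of_nat_poly algebra_simps)
  also have "\<dots> = (\<Sum>j<s. smult (of_nat (e choose j) * (- v) ^ (e - j)) (V ^ j * Z ^ (e - j)))"
    using assms by (intro sum.mono_neutral_left) (auto simp: binomial_eq_0)
  finally show ?thesis .
qed

text \<open>The binomial expansion of \<open>(V - v Z) ^ e * Z ^ (s - 1 - e)\<close> is
  unitriangular within each block of constant \<open>c div s\<close>. Entry 0 of the new border is
  recorded because \<open>bwr_nonzero\<close> asks for a nonzero border entry.\<close>

lemma bwr_grid_shift_V:
  assumes s: "0 < s"
  obtains l' where "bwr (s * s) l' (grid s U (V - smult v Z) Z) = bwr (s * s) (\<lambda>_. 1) (grid s U V Z)"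
    "l' 0 = 1"
proof -
  define E where "E r c = (if r div s = c div s
      then of_nat ((c mod s) choose (r mod s)) * (- v) ^ (c mod s - r mod s) else 0)" for r c
  define l' where "l' c = (\<Sum>j<s * s. E j c * 1)" for c
  show thesis
  proof (rule that)
    show "bwr (s * s) l' (grid s U (V - smult v Z) Z) = bwr (s * s) (\<lambda>_. 1) (grid s U V Z)"
    proof (rule bwr_change_basis[where E = E])
      fix r c :: nat assume "c < r" "r < s * s"
      show "E r c = 0"
      proof (cases "r div s = c div s")
        case True
        have "c mod s < r mod s"
          using \<open>c < r\<close> True div_mult_mod_eq[of c s] div_mult_mod_eq[of r s]
          by (metis nat_add_left_cancel_less)
        then show ?thesis by (simp add: E_def binomial_eq_0)
      qed (simp add: E_def)
    next
      fix c assume c: "c < s * s"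
      define i e where "i = c div s" and "e = c mod s"
      have ie: "i < s" "e < s" using c s by (auto simp: i_def e_def less_mult_imp_div_less)
      have "(\<Sum>r<s * s. smult (E r c) (grid s U V Z r))
          = (\<Sum>i'<s. \<Sum>j<s. smult (E (i' * s + j) c) (grid s U V Z (i' * s + j)))"
        by (rule sum_grid)
      also have "\<dots> = (\<Sum>i'\<in>{i}. \<Sum>j<s. smult (E (i' * s + j) c) (grid s U V Z (i' * s + j)))"
        using ie by (intro sum.mono_neutral_right) (auto simp: E_def i_def intro!: sum.neutral)
      also have "\<dots> = (\<Sum>j<s. U ^ i * Z ^ (s - 1 - e) *
          smult (of_nat (e choose j) * (- v) ^ (e - j)) (V ^ j * Z ^ (e - j)))"
      proof -
        have "smult (E (i * s + j) c) (grid s U V Z (i * s + j)) = U ^ i * Z ^ (s - 1 - e) *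
          smult (of_nat (e choose j) * (- v) ^ (e - j)) (V ^ j * Z ^ (e - j))" if "j < s" for j
        proof (cases "j \<le> e")
          case True
          then have "Z ^ (s - 1 - j) = Z ^ (s - 1 - e) * Z ^ (e - j)"
            using ie by (simp flip: power_add)
          then show ?thesis using that by (simp add: E_def grid_def i_def e_def algebra_simps)
        next
          case False
          then show ?thesis using that by (simp add: E_def binomial_eq_0 flip: e_def)
        qed
        then show ?thesis by simp
      qed
      also have "\<dots> = grid s U (V - smult v Z) Z c"
        unfolding grid_def sum_distrib_left[symmetric] binomial_sum_smult[OF ie(2), symmetric]
        by (simp add: i_def e_def mult_ac)
      finally show "grid s U (V - smult v Z) Z c = (\<Sum>r<s * s. smult (E r c) (grid s U V Z r))" ..
    qed (simp_all add: E_def l'_def)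
    have "l' 0 = (\<Sum>j\<in>{0}. E j 0 * 1)"
      unfolding l'_def
    proof (rule sum.mono_neutral_right)
      show "\<forall>j\<in>{..<s * s} - {0}. E j 0 * 1 = 0"
      proof
        fix j assume j: "j \<in> {..<s * s} - {0}"
        show "E j 0 * 1 = 0"
        proof (cases "j div s = 0")
          case True
          then have "0 < j mod s" using j s by (metis DiffD2 div_mult_mod_eq gr0I insertI1 mult_0 add_0)
          then show ?thesis by (simp add: E_def binomial_eq_0)
        qed (simp add: E_def)
      qed
    qed (use s in auto)
    then show "l' 0 = 1" by (simp add: E_def)
  qed
qed

text \<open>The same expansion in the exponent \<open>c div s\<close>. It serves lower bounds for
  orders, which hold for every border.\<close>

lemma bwr_grid_shift_X:
  assumes s: "0 < s"
  obtains l' where "bwr (s * s) l' (grid s (U - [:x:]) V Z) = bwr (s * s) (\<lambda>_. 1) (grid s U V Z)"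
proof -
  define E where "E r c = (if r mod s = c mod s
      then of_nat ((c div s) choose (r div s)) * (- x) ^ (c div s - r div s) else 0)" for r c
  define l' where "l' c = (\<Sum>j<s * s. E j c * 1)" for c
  show thesis
  proof (rule that)
    show "bwr (s * s) l' (grid s (U - [:x:]) V Z) = bwr (s * s) (\<lambda>_. 1) (grid s U V Z)"
    proof (rule bwr_change_basis[where E = E])
      fix r c :: nat assume "c < r" "r < s * s"
      show "E r c = 0"
      proof (cases "r mod s = c mod s")
        case True
        have "c div s < r div s"
        proof (rule ccontr)
          assume "\<not> ?thesis"
          then have "r div s * s \<le> c div s * s" by simp
          then show False
            using \<open>c < r\<close> True div_mult_mod_eq[of c s] div_mult_mod_eq[of r s] by linarith
        qed
        then show ?thesis by (simp add: E_def binomial_eq_0)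
      qed (simp add: E_def)
    next
      fix c assume c: "c < s * s"
      define i e where "i = c div s" and "e = c mod s"
      have ie: "i < s" "e < s" using c s by (auto simp: i_def e_def less_mult_imp_div_less)
      have "(\<Sum>r<s * s. smult (E r c) (grid s U V Z r))
          = (\<Sum>i'<s. \<Sum>j<s. smult (E (i' * s + j) c) (grid s U V Z (i' * s + j)))"
        by (rule sum_grid)
      also have "\<dots> = (\<Sum>i'<s. \<Sum>j\<in>{e}. smult (E (i' * s + j) c) (grid s U V Z (i' * s + j)))"
        using ie by (intro sum.cong sum.mono_neutral_right) (auto simp: E_def e_def)
      \<comment> \<open>Writing a factor \<open>1 ^ (i - i')\<close> makes the homogeneous expansion
        \<open>binomial_sum_smult\<close> applicable with 1 in the place of
        \<open>Z\<close>.\<close>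
      also have "\<dots> = (\<Sum>i'<s. V ^ e * Z ^ (s - 1 - e) *
          smult (of_nat (i choose i') * (- x) ^ (i - i')) (U ^ i' * 1 ^ (i - i')))"
        using ie by (simp add: E_def grid_def i_def e_def mult_ac)
      also have "\<dots> = grid s (U - [:x:]) V Z c"
        unfolding grid_def sum_distrib_left[symmetric] binomial_sum_smult[OF ie(1), symmetric]
        by (simp add: i_def e_def mult_ac one_pCons)
      finally show "grid s (U - [:x:]) V Z c = (\<Sum>r<s * s. smult (E r c) (grid s U V Z r))" ..
    qed (simp_all add: E_def l'_def)
  qed
qed

lemma coeff_X_power_mult_unit:
  fixes G :: "'a::field poly"
  assumes "poly G 0 \<noteq> 0"
  shows "coeff ([:0, 1:] ^ m * G) m \<noteq> 0" "i < m \<Longrightarrow> coeff ([:0, 1:] ^ m * G) i = 0"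
proof -
  have "[:0, 1:] ^ m = monom (1::'a) m" by (simp add: monom_altdef)
  then show "coeff ([:0, 1:] ^ m * G) m \<noteq> 0" "i < m \<Longrightarrow> coeff ([:0, 1:] ^ m * G) i = 0"
    using assms by (simp_all add: coeff_monom_mult poly_0_coeff_0)
qed

text \<open>Stated in the integers, since the left-hand side may be negative for small
  multiplicities, and the bound is then vacuous.\<close>

lemma order_ge_bwr:
  assumes ord: "\<And>c. c < Suc d \<Longrightarrow> [:- x, 1:] ^ w c dvd f c"
    and mx: "\<And>c. c < Suc d \<Longrightarrow> w c \<le> mx"
    and nz: "bwr (Suc d) l f \<noteq> 0"
  shows "int (\<Sum>c<Suc d. w c) - int mx - int (\<Sum>i<d. i) \<le> int (order x (bwr (Suc d) l f))"
proof (cases "mx + (\<Sum>i<d. i) \<le> (\<Sum>c<Suc d. w c)")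
  case True
  define e where "e = (\<Sum>c<Suc d. w c) - (mx + (\<Sum>i<d. i))"
  have "[:- x, 1:] ^ e dvd bwr (Suc d) l f"
  proof (rule power_dvd_bwr[where w = w and loss = "\<lambda>i. i" and mx = mx])
    show "[:- x, 1:] ^ (w c - i) dvd (theta ^^ i) (f c)" if "c < Suc d" for c i
      by (rule power_dvd_theta_pow) (rule ord[OF that])
    show "e + mx + (\<Sum>i<d. i) \<le> (\<Sum>c<Suc d. w c)"
      using True unfolding e_def by linarith
  qed (rule mx)
  then have "e \<le> order x (bwr (Suc d) l f)" using nz by (simp add: order_divides)
  then show ?thesis unfolding e_def using True by linarith
next
  case False
  then show ?thesis by linarith
qed

text \<open>The orders of \<open>S\<close> at the points of \<open>A\<close> and at 0,
  \<open>b\<close>, \<open>1 / a\<close> add up to at most its degree. The condition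
  \<open>s \<le> k\<close> makes the lowest exponents \<open>k i + j\<close> distinct, and the bound
  on \<open>CHAR('a)\<close> keeps them distinct in the field.\<close>

theorem card_pairs_in_subgroup:
  fixes a b :: "'a::field"
  assumes A: "finite A"
    "\<And>u. u \<in> A \<Longrightarrow> u \<noteq> 0 \<and> u \<noteq> b \<and> a * u \<noteq> 1 \<and> u ^ k = 1 \<and> (u - b) ^ k = (a * u - 1) ^ k"
    and ab: "a * b \<noteq> 0" "a * b \<noteq> 1"
    and s: "2 \<le> s" "s \<le> k" "(k + 1) * (s - 1) < CHAR('a)"
  shows "int (card A) * (int s ^ 2 - 1) + 2 * int s ^ 2 * (int s - 1)
       \<le> (int s ^ 2 - 1) * (int s ^ 2 - 2) + (int s - 1) * (2 * int k + 4)"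
proof -
  define U V Z where "U = [:0, 1::'a:] ^ k" and "V = [:- b, 1:] ^ k" and "Z = [:- 1, a:] ^ k"
  define d where "d = s * s - 1"
  have d: "Suc d = s * s" using s(1) by (cases s) (auto simp: d_def)
  define S where "S = bwr (s * s) (\<lambda>_. 1) (grid s U V Z)"
  have a0: "a \<noteq> 0" "b \<noteq> 0" using ab(1) by auto
  have s0: "0 < s" "1 \<le> s" using s(1) by auto
  have k0: "0 < k" using s by linarith
  have div_mod: "c div s < s" "c mod s < s" if "c < s * s" for c
    using that s0 by (auto simp: less_mult_imp_div_less)
  have div_mod': "c div s \<le> s - 1" "c mod s \<le> s - 1" if "c < Suc d" for c
    using div_mod[of c] that unfolding d by linarith+
  have of_nat_k: "(of_nat k :: 'a) \<noteq> 0"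
  proof
    assume "(of_nat k :: 'a) = 0"
    then have "CHAR('a) dvd k" by (simp add: of_nat_eq_0_iff_char_dvd)
    then have "CHAR('a) \<le> k" using k0 by (rule dvd_imp_le)
    moreover have "k + 1 \<le> (k + 1) * (s - 1)" using mult_le_mono2[of 1 "s - 1" "k + 1"] s(1) by simp
    ultimately show False using s(3) by linarith
  qed
  define G where "G = (\<Sum>i<s. i)"
  have G2: "2 * G = s * (s - 1)"
    unfolding G_def by (induction s) (auto simp: algebra_simps, (simp add: mult_2 diff_mult_distrib2)?)
  have G_lin: "(\<Sum>i<s. m * i) = m * G" for m
    by (simp add: G_def sum_distrib_left)
  define Ls where "Ls = (\<Sum>i<d. i)"
  have Ls2: "2 * Ls = d * (d - 1)"
    unfolding Ls_def by (induction d) (auto simp: algebra_simps)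
  have sum_w: "(\<Sum>c<Suc d. g (c div s) (c mod s)) = (\<Sum>i<s. \<Sum>j<s. g i j)"
    for g :: "nat \<Rightarrow> nat \<Rightarrow> nat"
    unfolding d sum_grid using s0 by (intro sum.cong refl) auto

  \<comment> \<open>At 0, \<open>V\<close> and \<open>b ^ k * Z\<close> agree, and their difference
    has a simple zero because its derivative there is a nonzero multiple of
    \<open>k (1 - a b)\<close>. In this basis column \<open>c\<close> starts exactly at the exponent
    \<open>w0 c\<close>.\<close>
  define R where "R = V - smult (b ^ k) Z"
  have "poly R 0 = 0"
    by (simp add: R_def V_def Z_def power_minus[of b])
  then obtain R1 where R1: "R = [:0, 1:] * R1"
    by (metis dvdE minus_zero poly_eq_0_iff_dvd)
  have "poly R1 0 = poly (pderiv R) 0"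
    unfolding R1 by (simp add: pderiv_mult pderiv_pCons)
  also have "\<dots> = of_nat k * (-1) ^ (k - 1) * b ^ (k - 1) * (1 - a * b)"
  proof -
    obtain k' where k': "k = Suc k'" using k0 by (cases k) auto
    show ?thesis
      unfolding R_def V_def Z_def k' pderiv_diff pderiv_smult pderiv_power_Suc
      by (simp add: pderiv_pCons power_minus[of b] algebra_simps)
  qed
  also have "\<dots> \<noteq> 0" using of_nat_k a0 ab(2) by simp
  finally have R1_0: "poly R1 0 \<noteq> 0" .
  obtain l0 where l0: "bwr (s * s) l0 (grid s U R Z) = S" "l0 0 = 1"
    using bwr_grid_shift_V[OF s0(1), of U V "b ^ k" Z] unfolding S_def R_def by blast
  define w0 where "w0 c = k * (c div s) + c mod s" for c
  have grid0: "grid s U R Z c = [:0, 1:] ^ w0 c * (R1 ^ (c mod s) * Z ^ (s - 1 - c mod s))" for c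
    unfolding grid_def R1 U_def w0_def power_mult_distrib power_add power_mult by (simp only: mult_ac)
  have unit0: "poly (R1 ^ (c mod s) * Z ^ (s - 1 - c mod s)) 0 \<noteq> 0" for c
    using R1_0 by (simp add: Z_def)
  have w0_le: "w0 c \<le> (k + 1) * (s - 1)" if "c < Suc d" for c
  proof -
    have "k * (c div s) \<le> k * (s - 1)" "c mod s \<le> s - 1"
      using div_mod'[OF that] by (auto intro: mult_le_mono2)
    then show ?thesis unfolding w0_def add_mult_distrib mult_1 by (rule add_mono)
  qed
  have S_nz: "S \<noteq> 0"
    unfolding l0(1)[symmetric] d[symmetric]
  proof (rule bwr_nonzero[where w = w0 and m' = 0])
    show "coeff (grid s U R Z c) (w0 c) \<noteq> 0" for c
      unfolding grid0 by (rule coeff_X_power_mult_unit(1)[OF unit0])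
    show "coeff (grid s U R Z c) i = 0" if "i < w0 c" for c i
      unfolding grid0 by (rule coeff_X_power_mult_unit(2)[OF unit0 that])
    show "inj_on (\<lambda>c. of_nat (w0 c) :: 'a) {..<Suc d}"
    proof (rule inj_onI)
      fix c c' assume c: "c \<in> {..<Suc d}" "c' \<in> {..<Suc d}" "(of_nat (w0 c) :: 'a) = of_nat (w0 c')"
      have lt: "w0 c < CHAR('a)" "w0 c' < CHAR('a)"
        using w0_le[of c] w0_le[of c'] c s(3) by auto
      have "w0 c = w0 c'"
        using c(3) lt by (simp add: of_nat_eq_iff_cong_CHAR cong_def)
      moreover have "c mod s < k" "c' mod s < k" using div_mod c s(2) unfolding d by (auto intro: less_le_trans)
      ultimately have "c div s = c' div s" "c mod s = c' mod s"
        unfolding w0_def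
        by (metis div_mult_self4 div_less add_0_right k0 less_numeral_extra(3),
            metis mod_mult_self4 mod_less)
      then show "c = c'" by (metis div_mult_mod_eq)
    qed
  qed (use l0 in auto)
  have sum_w0: "(\<Sum>c<Suc d. w0 c) = (k + 1) * s * G"
    unfolding w0_def sum_w[of "\<lambda>i j. k * i + j"]
    by (simp add: sum.distrib mult.assoc[symmetric] G_lin flip: G_def) (simp add: algebra_simps)
  have T_ge: "(k + 1) * (s - 1) \<le> (k + 1) * s * G"
  proof -
    have "2 * (s - 1) \<le> (s * s) * (s - 1)"
      using mult_le_mono[OF s(1) s0(2)] by (intro mult_le_mono1) simp
    then have "2 * (s - 1) \<le> s * (2 * G)" unfolding G2 by (simp only: mult.assoc)
    then have "s - 1 \<le> s * G" by linarith
    then show ?thesis by (metis mult.assoc mult_le_mono2)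
  qed
  \<comment> \<open>No loss at 0: \<open>theta\<close> does not lower the order there.\<close>
  have ord0: "(k + 1) * s * G - (k + 1) * (s - 1) \<le> order 0 S"
  proof -
    have "[:0, 1:] ^ ((k + 1) * s * G - (k + 1) * (s - 1)) dvd S"
      unfolding l0(1)[symmetric] d[symmetric]
    proof (rule power_dvd_bwr[where w = w0 and loss = "\<lambda>_. 0" and mx = "(k + 1) * (s - 1)"])
      show "[:0, 1:] ^ (w0 c - 0) dvd (theta ^^ i) (grid s U R Z c)" for c i
        unfolding grid0 by (rule X_power_dvd_theta_pow) simp
      show "(k + 1) * s * G - (k + 1) * (s - 1) + (k + 1) * (s - 1) + (\<Sum>i<d. 0) \<le> (\<Sum>c<Suc d. w0 c)"
        unfolding sum_w0 using T_ge by simp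
    qed (rule w0_le)
    then show ?thesis using S_nz order_divides[of 0 _ S] by simp
  qed

  \<comment> \<open>At infinity \<open>V\<close> and \<open>(1 / a) ^ k * Z\<close> have the same
    leading coefficient, so each factor \<open>R'\<close> in place of \<open>V\<close> lowers the
    degree bound of a column by one.\<close>
  define R' where "R' = V - smult ((1 / a) ^ k) Z"
  have deg_R': "degree R' \<le> k - 1"
  proof (rule degree_le, intro allI impI)
    fix i assume i: "k - 1 < i"
    have degs: "degree V = k" "degree Z = k" using a0 by (simp_all add: V_def Z_def degree_power_eq)
    show "coeff R' i = 0"
    proof (cases "i = k")
      case True
      have "coeff V k = 1" "coeff Z k = a ^ k"
        using lead_coeff_power[of "[:- b, 1:]" k] lead_coeff_power[of "[:- 1, a:]" k] degs a0
        by (simp_all add: V_def Z_def)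
      then show ?thesis using True a0 by (simp add: R'_def power_divide)
    next
      case False
      then show ?thesis using i degs by (simp add: R'_def coeff_eq_0)
    qed
  qed
  obtain l3 where l3: "bwr (s * s) l3 (grid s U R' Z) = S"
    using bwr_grid_shift_V[OF s0(1), of U V "(1 / a) ^ k" Z] unfolding S_def R'_def by blast
  define \<delta> where "\<delta> c = k * (c div s) + ((k - 1) * (c mod s) + k * (s - 1 - c mod s))" for c
  have \<delta>: "\<delta> c + c mod s = k * (c div s) + k * (s - 1)" if "c < Suc d" for c
  proof -
    have "c mod s \<le> s - 1" by (rule div_mod'(2)[OF that])
    then obtain m where m: "s - 1 = c mod s + m"
      using le_Suc_ex by blast
    obtain k' where "k = Suc k'" using k0 by (cases k) auto
    then show ?thesis unfolding \<delta>_def m by (simp add: algebra_simps)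
  qed
  have "degree S + (k - 1) * (s - 1) \<le> (\<Sum>c<Suc d. \<delta> c)"
    unfolding l3[symmetric] d[symmetric]
  proof (rule degree_bwr)
    fix c assume c: "c < Suc d"
    have dp: "degree (q ^ m) \<le> degree q * m" for q :: "'a poly" and m
      by (rule degree_power_le)
    have dU: "degree U = k" "degree Z = k" using a0 by (simp_all add: U_def Z_def degree_power_eq)
    have "degree (grid s U R' Z c) \<le> degree (U ^ (c div s)) + degree (R' ^ (c mod s)) + degree (Z ^ (s - 1 - c mod s))"
      unfolding grid_def using degree_mult_le order.trans[OF degree_mult_le] by (metis add_le_mono1)
    also have "\<dots> \<le> degree U * (c div s) + degree R' * (c mod s) + degree Z * (s - 1 - c mod s)"
      by (intro add_mono dp)
    also have "\<dots> \<le> \<delta> c"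
      unfolding \<delta>_def dU using mult_le_mono1[OF deg_R', of "c mod s"] by simp
    finally show "degree (grid s U R' Z c) \<le> \<delta> c" .
    have "c mod s \<le> s - 1" using div_mod'[OF c] by simp
    moreover have "(k - 1) * (s - 1) + (s - 1) = k * (s - 1)"
      using k0 by (metis Suc_diff_1 add.commute mult_Suc)
    ultimately show "(k - 1) * (s - 1) \<le> \<delta> c" using \<delta>[OF c] by linarith
  qed
  moreover have "(\<Sum>c<Suc d. \<delta> c) + s * G = k * s * G + s * s * (k * (s - 1))"
  proof -
    have "(\<Sum>c<Suc d. \<delta> c) + (\<Sum>c<Suc d. c mod s) = (\<Sum>c<Suc d. \<delta> c + c mod s)"
      by (simp only: sum.distrib)
    also have "\<dots> = (\<Sum>c<Suc d. k * (c div s) + k * (s - 1))"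
      by (intro sum.cong refl \<delta>) simp
    also have "\<dots> = k * s * G + s * s * (k * (s - 1))"
      unfolding sum_w[of "\<lambda>i j. k * i + k * (s - 1)"]
      by (simp only: sum.distrib sum_constant card_lessThan of_nat_id mult.assoc[symmetric] G_lin)
        (simp add: mult_ac)
    also have "(\<Sum>c<Suc d. c mod s) = s * G"
      unfolding sum_w[of "\<lambda>i j. j"] by (simp add: G_def)
    finally show ?thesis .
  qed
  ultimately have deg_S: "degree S + (k - 1) * (s - 1) + s * G \<le> k * s * G + s * s * (k * (s - 1))"
    by linarith

  \<comment> \<open>At \<open>x = b\<close> or \<open>x = 1 / a\<close>, every factor
    \<open>U - x ^ k\<close> contributes order 1 and every factor \<open>V\<close>, respectively
    \<open>Z\<close>, contributes \<open>k\<close>; \<open>g j\<close> is the exponent of the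
    latter, \<open>j\<close> at \<open>b\<close> and \<open>s - 1 - j\<close> at
    \<open>1 / a\<close>.\<close>
  have shift_order: "int ((k + 1) * s * G) - int ((k + 1) * (s - 1)) - int Ls \<le> int (order x S)"
    if w: "\<And>c. c < Suc d \<Longrightarrow> [:- x, 1:] ^ (c div s + k * g (c mod s)) dvd grid s (U - [:x ^ k:]) V Z c"
      and g: "\<And>j. j < s \<Longrightarrow> g j \<le> s - 1" "(\<Sum>j<s. g j) = G" for x g
  proof -
    obtain l1 where l1: "bwr (s * s) l1 (grid s (U - [:x ^ k:]) V Z) = S"
      using bwr_grid_shift_X[OF s0(1), of U "x ^ k" V Z] unfolding S_def by blast
    have "int (\<Sum>c<Suc d. c div s + k * g (c mod s)) - int ((k + 1) * (s - 1)) - int Ls \<le> int (order x S)"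
      unfolding l1[symmetric] d[symmetric] Ls_def
    proof (rule order_ge_bwr[OF w])
      fix c assume c: "c < Suc d"
      have "c div s \<le> s - 1" "k * g (c mod s) \<le> k * (s - 1)"
        using div_mod'[OF c] div_mod[of c] g(1) c unfolding d by (auto intro!: mult_le_mono2)
      then show "c div s + k * g (c mod s) \<le> (k + 1) * (s - 1)"
        unfolding add_mult_distrib mult_1 by linarith
    qed (use S_nz l1 d in auto)
    moreover have sum_eq: "(\<Sum>c<Suc d. c div s + k * g (c mod s)) = (k + 1) * s * G"
      unfolding sum_w[of "\<lambda>i j. i + k * g j"]
      by (simp only: sum.distrib sum_constant card_lessThan of_nat_id sum_distrib_left[symmetric]
          g(2) G_def[symmetric]) (simp add: algebra_simps)
    ultimately show ?thesis by (simp only: sum_eq)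
  qed
  have dvd_U: "[:- x, 1:] dvd U - [:x ^ k:]" for x
    by (simp add: U_def flip: poly_eq_0_iff_dvd)
  have ord_b: "int ((k + 1) * s * G) - int ((k + 1) * (s - 1)) - int Ls \<le> int (order b S)"
  proof (rule shift_order[where g = "\<lambda>j. j"])
    show "[:- b, 1:] ^ (c div s + k * (c mod s)) dvd grid s (U - [:b ^ k:]) V Z c" for c
      unfolding grid_def power_add power_mult
      by (intro dvd_mult2 mult_dvd_mono dvd_power_same[OF dvd_U]) (simp add: V_def)
  qed (auto simp: G_def)
  have ord_a: "int ((k + 1) * s * G) - int ((k + 1) * (s - 1)) - int Ls \<le> int (order (1 / a) S)"
  proof (rule shift_order[where g = "\<lambda>j. s - 1 - j"])
    have "[:- (1 / a), 1:] dvd [:- 1, a:]"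
      using a0 by (simp flip: poly_eq_0_iff_dvd)
    then have Z: "[:- (1 / a), 1:] ^ k dvd Z" unfolding Z_def by (rule dvd_power_same)
    show "[:- (1 / a), 1:] ^ (c div s + k * (s - 1 - c mod s)) dvd grid s (U - [:(1 / a) ^ k:]) V Z c" for c
    proof -
      have "grid s (U - [:(1 / a) ^ k:]) V Z c
          = V ^ (c mod s) * ((U - [:(1 / a) ^ k:]) ^ (c div s) * Z ^ (s - 1 - c mod s))"
        by (simp add: grid_def mult_ac)
      then show ?thesis
        unfolding power_add power_mult
        by (simp only:) (intro dvd_mult mult_dvd_mono dvd_power_same[OF dvd_U] dvd_power_same[OF Z])
    qed
    show "(\<Sum>j<s. s - 1 - j) = G"
      unfolding G_def using sum.nat_diff_reindex[of "\<lambda>j. j" s] by simp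
  qed auto

  \<comment> \<open>At an admissible \<open>u\<close> one has \<open>U = 1\<close> and
    \<open>V = Z\<close>, so all columns take the common value \<open>Z ^ (s - 1)\<close>.\<close>
  have ord_good: "d \<le> order u S" if u: "u \<in> A" for u
  proof -
    have U: "poly U u = 1" "poly V u = poly Z u"
      using A(2)[OF u] by (simp_all add: U_def V_def Z_def algebra_simps)
    have "poly (grid s U V Z c) u = poly Z u ^ (s - 1)" if "c < Suc d" for c
    proof -
      have "poly Z u ^ (c mod s) * poly Z u ^ (s - 1 - c mod s) = poly Z u ^ (s - 1)"
        by (simp only: power_add[symmetric] le_add_diff_inverse[OF div_mod'(2)[OF that]])
      then show ?thesis by (simp add: grid_def U)
    qed
    then have "[:- u, 1:] ^ d dvd S"
      unfolding S_def d[symmetric]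
      by (intro power_dvd_bwr_common) (auto simp flip: poly_eq_0_iff_dvd)
    then show ?thesis using S_nz by (simp add: order_divides)
  qed
  have distinct: "b \<noteq> 0" "1 / a \<noteq> 0" "b \<noteq> 1 / a"
    using a0 ab by (auto simp: field_simps)
  have notin: "0 \<notin> A" "b \<notin> A" "1 / a \<notin> A" using A(2) a0 by fastforce+
  have "(\<Sum>c\<in>A \<union> {0, b, 1 / a}. order c S) \<le> degree S"
    using A(1) S_nz by (intro sum_order_le_degree) auto
  also have "(\<Sum>c\<in>A \<union> {0, b, 1 / a}. order c S)
      = (\<Sum>c\<in>A. order c S) + (\<Sum>c\<in>{0, b, 1 / a}. order c S)"
    using A(1) notin by (intro sum.union_disjoint) auto
  also have "(\<Sum>c\<in>{0, b, 1 / a}. order c S) = order 0 S + (order b S + order (1 / a) S)"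
    using distinct by auto
  finally have "(\<Sum>c\<in>A. order c S) + (order 0 S + (order b S + order (1 / a) S)) \<le> degree S" .
  moreover have "card A * d \<le> (\<Sum>c\<in>A. order c S)"
    using sum_mono[of A "\<lambda>_. d" "\<lambda>c. order c S"] ord_good by simp
  ultimately have main: "card A * d + order 0 S + order b S + order (1 / a) S \<le> degree S" by linarith
  define S' K N where "S' = int s" and "K = int k" and "N = int (card A)"
  have ints: "int d = S' * S' - 1" "int (s - 1) = S' - 1" "int (k - 1) = K - 1"
    using d s0 k0 s(1) unfolding S'_def K_def by (auto simp: d_def of_nat_diff)
  have "4 \<le> s * s" using mult_le_mono[OF s(1) s(1)] by simp
  then have ints4: "int (d - 1) = S' * S' - 2"
    using d unfolding S'_def by (simp flip: of_nat_mult)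
  have prods: "int ((k + 1) * (s - 1)) = (K + 1) * (S' - 1)" "int ((k + 1) * s * G) = (K + 1) * S' * int G"
    by (simp_all only: of_nat_mult of_nat_add of_nat_1 ints(2) S'_def K_def)
  have G2': "2 * int G = S' * (S' - 1)"
    using arg_cong[OF G2, of int] ints by (simp add: S'_def)
  have Ls2': "2 * int Ls = (S' * S' - 1) * (S' * S' - 2)"
    using arg_cong[OF Ls2, of int] ints ints4 by simp
  have m1: "N * (S' * S' - 1) + int (order 0 S) + int (order b S) + int (order (1 / a) S) \<le> int (degree S)"
    using main ints(1) unfolding N_def by (metis of_nat_add of_nat_le_iff of_nat_mult)
  have m2: "int (degree S) + (K - 1) * (S' - 1) + S' * int G
      \<le> K * S' * int G + S' * S' * (K * (S' - 1))"
    using deg_S[folded of_nat_le_iff[where ?'a = int]] ints(2,3) unfolding S'_def K_def by simp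
  have m3: "(K + 1) * S' * int G - (K + 1) * (S' - 1) \<le> int (order 0 S)"
    unfolding prods[symmetric] using ord0 by linarith
  have m4: "(K + 1) * S' * int G - (K + 1) * (S' - 1) - int Ls \<le> int (order b S)"
    unfolding prods[symmetric] by (rule ord_b)
  have m5: "(K + 1) * S' * int G - (K + 1) * (S' - 1) - int Ls \<le> int (order (1 / a) S)"
    unfolding prods[symmetric] by (rule ord_a)
  have "N * (S' * S' - 1) + (K - 1) * (S' - 1) + S' * int G + 3 * ((K + 1) * S' * int G)
      - 3 * ((K + 1) * (S' - 1)) - 2 * int Ls \<le> K * S' * int G + S' * S' * (K * (S' - 1))"
    using m1 m2 m3 m4 m5 by linarith
  \<comment> \<open>The inequality is doubled so that \<open>G\<close> and \<open>Ls\<close>, which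
    are halves of products, can be eliminated.\<close>
  then have "0 \<le> K * S' * (2 * int G) + 2 * (S' * S' * (K * (S' - 1))) - 2 * (N * (S' * S' - 1))
      - 2 * ((K - 1) * (S' - 1)) - S' * (2 * int G) - 3 * ((K + 1) * S' * (2 * int G))
      + 6 * ((K + 1) * (S' - 1)) + 2 * (2 * int Ls)"
    by (simp add: algebra_simps)
  also have "\<dots> = 2 * ((S' ^ 2 - 1) * (S' ^ 2 - 2) + (S' - 1) * (2 * K + 4)
      - (N * (S' ^ 2 - 1) + 2 * S' ^ 2 * (S' - 1)))"
    unfolding G2' Ls2' by (simp add: algebra_simps power2_eq_square)
  finally show ?thesis
    unfolding N_def[symmetric] S'_def[symmetric] K_def[symmetric] by simp
qed

section \<open>Numerical estimates\<close>

text \<open>The bound of the theorem divided by \<open>n ^ 2\<close>, as a function of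
  \<open>x\<close> with \<open>x ^ 3 = sqrt 2 * k\<close>.\<close>

definition target :: "real \<Rightarrow> real" where
  "target x = 3 * x ^ 2 - 103/19 * x + 13/3"

text \<open>The vertex of the parabola lies at 103/114, below 1.\<close>

lemma target_mono: "1 \<le> x \<Longrightarrow> x \<le> y \<Longrightarrow> target x \<le> target y"
proof -
  assume "1 \<le> x" "x \<le> y"
  then have "0 \<le> (y - x) * (3 * (y + x) - 103/19)" by (intro mult_nonneg_nonneg) auto
  also have "\<dots> = target y - target x" by (simp add: target_def power2_eq_square field_simps)
  finally show ?thesis by simp
qed

text \<open>The cubic \<open>A x ^ 3 + B - target x\<close> has second divided difference
  \<open>A (x + u + v) - 3\<close> over \<open>u\<close>, \<open>v\<close>, \<open>x\<close>. Where
  that is nonnegative the cubic stays below its chord, so the end points suffice.\<close>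

lemma target_bound_cubic:
  assumes x: "u \<le> x" "x \<le> v" and "0 \<le> A * u + (A * (u + v) - 3)"
    and A: "0 \<le> A" and ends: "A * u ^ 3 + B \<le> target u" "A * v ^ 3 + B \<le> target v"
  shows "A * x ^ 3 + B \<le> target x"
proof (cases "u = v")
  case True
  then show ?thesis using x ends by simp
next
  case False
  have "A * u \<le> A * x" using x A by (intro mult_left_mono)
  then have "0 \<le> (x - u) * (v - x) * (A * x + (A * (u + v) - 3))"
    using x assms(3) by (intro mult_nonneg_nonneg) linarith+
  then have "(v - u) * (A * x ^ 3 + B - target x)
      \<le> (v - u) * (A * x ^ 3 + B - target x) + (v - u) * ((x - u) * (v - x) * (A * x + (A * (u + v) - 3)))"
    using x by simp
  also have "\<dots> = (v - x) * (A * u ^ 3 + B - target u) + (x - u) * (A * v ^ 3 + B - target v)"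
    by (simp add: target_def power2_eq_square power3_eq_cube field_simps)
  also have "\<dots> \<le> 0"
    using x ends by (intro add_nonpos_nonpos mult_nonneg_nonpos) auto
  finally have "(v - u) * (A * x ^ 3 + B - target x) \<le> 0" .
  then show ?thesis using False x by (simp add: mult_le_0_iff)
qed

text \<open>In the application \<open>M\<close> counts the admissible \<open>u\<close> and
  \<open>e\<close> counts those of \<open>b\<close> and \<open>1 / a\<close> that are
  \<open>k\<close>-th roots of unity. For large \<open>x\<close> there is room because the best
  \<open>s\<close> used gives about \<open>(1 + sqrt 2) x ^ 2\<close>, against
  \<open>3 x ^ 2\<close> in the target.\<close>

lemma count_le_target:
  fixes p n k M e :: nat and x :: real
  assumes p: "Factorial_Ring.prime p" "p = n * k + 1" and n: "3 \<le> n" and k: "2 \<le> k"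
    and k_le: "real k \<le> (real n + 3) * (real n + 4) * (3 * real n - 1) / 12 - 3"
    and Me: "M + e \<le> k" "e \<le> 2"
    and M: "\<And>s. 2 \<le> s \<Longrightarrow> s \<le> k \<Longrightarrow> s \<le> n \<Longrightarrow>
      real M \<le> real s ^ 2 - 2 * real s + (2 * real k + 2) / (real s + 1)"
    and x: "0 < x" "x ^ 3 = sqrt 2 * real k"
  shows "real M + 2 * real e / real n \<le> target x"
proof -
  define c where "c = sqrt 2"
  have c: "c * c = 2" "141421 / 100000 < c" "c < 141422 / 100000"
    unfolding c_def
    by (simp, rule real_less_rsqrt, simp add: power2_eq_square,
        rule real_less_lsqrt, simp_all add: power2_eq_square)
  have T1: "real M + 2 * real e / real n \<le> real M + 2/3 * real e"
  proof -
    have "2 * real e / real n \<le> 2 * real e / 3" using n by (intro divide_left_mono) auto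
    then show ?thesis by simp
  qed
  have x_ge: "y \<le> x" if "y ^ 3 \<le> 1.41421 * real k" for y
  proof -
    have "1.41421 * real k \<le> c * real k" using c by (intro mult_right_mono) auto
    then have "y ^ 3 \<le> x ^ 3" using that x(2) by (simp add: c_def)
    moreover have "x ^ 3 < y ^ 3" if "x < y" using x(1) that by (intro power_strict_mono) auto
    ultimately show ?thesis by (meson not_less)
  qed
  have e_le: "real e \<le> 2" using Me(2) by simp
  have k_x: "real k = c * x ^ 3 / 2"
  proof -
    have "c * x ^ 3 = c * c * real k" unfolding x(2) c_def by (simp only: mult.assoc)
    then show ?thesis unfolding c(1) by simp
  qed
  have M2': "3 * real M \<le> 2 * real k + 2"
    using M[of 2] k n by (simp add: field_simps)
  then have M2: "3 * M \<le> 2 * k + 2" by linarith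
  \<comment> \<open>Use \<open>s = 2\<close> up to \<open>3.1\<close>, \<open>s = 3\<close> up to \<open>5.5\<close> and \<open>s = \<lfloor>x\<rfloor> - 1\<close> beyond, where \<open>s \<le> n\<close> by the
      assumption on \<open>k\<close>.\<close>
  consider "k \<le> 8" | "9 \<le> k" "x \<le> 3.1" | "3.1 \<le> x" "x \<le> 5.5" | "5.5 \<le> x" by linarith
  then show ?thesis
  proof cases
    case 1
    \<comment> \<open>For small \<open>k\<close>, \<open>y\<close> is a decimal below
      \<open>x\<close>, certified by its cube, and \<open>t\<close> an upper bound for the left-hand
      side.\<close>
    have small: ?thesis if "real M + 2/3 * real e \<le> t" "y ^ 3 \<le> 1.41421 * real k" "1 \<le> y" "t \<le> target y" for t y
      using T1 that target_mono[OF that(3) x_ge[OF that(2)]] by linarith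
    have M_nat: "k = 3 \<Longrightarrow> M \<le> 2" "k = 4 \<Longrightarrow> M \<le> 3" "k = 5 \<Longrightarrow> M \<le> 4" "k = 6 \<Longrightarrow> M \<le> 4"
        "k = 7 \<Longrightarrow> M \<le> 5" "k = 8 \<Longrightarrow> M \<le> 6"
      using M2 by linarith+
    from 1 k consider "k = 2" | "k = 3" | "k = 4" | "k = 5" | "k = 6" | "k = 7" | "k = 8" by linarith
    then show ?thesis
    proof cases
      assume k: "k = 2"
      show ?thesis by (rule small[of 2 "1.4"]) (use Me k in \<open>auto simp: target_def power2_eq_square power3_eq_cube\<close>)
    next
      assume k: "k = 3"
      have "3 * M + 2 * e \<le> 8" using Me k M_nat by linarith
      then show ?thesis by (intro small[of "8/3" "1.6"]) (use k in \<open>auto simp: target_def power2_eq_square power3_eq_cube\<close>)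
    next
      assume k: "k = 4"
      have "3 * M + 2 * e \<le> 11" using Me k M_nat by linarith
      then show ?thesis by (intro small[of "11/3" "1.78"]) (use k in \<open>auto simp: target_def power2_eq_square power3_eq_cube\<close>)
    next
      assume k: "k = 5"
      have "3 * M + 2 * e \<le> 14" using Me k M_nat by linarith
      then show ?thesis by (intro small[of "14/3" "1.91"]) (use k in \<open>auto simp: target_def power2_eq_square power3_eq_cube\<close>)
    next
      assume k: "k = 6"
      have "3 * M + 2 * e \<le> 16" using Me k M_nat by linarith
      then show ?thesis by (intro small[of "16/3" "2.03"]) (use k in \<open>auto simp: target_def power2_eq_square power3_eq_cube\<close>)
    next
      assume k: "k = 7"
      have "3 * M + 2 * e \<le> 19" using Me k M_nat by linarith
      then show ?thesis by (intro small[of "19/3" "2.14"]) (use k in \<open>auto simp: target_def power2_eq_square power3_eq_cube\<close>)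
    next
      assume k: "k = 8"
      \<comment> \<open>For \<open>k = 8\<close> and \<open>n = 3\<close> the available bound 6 +
        4/3 exceeds the target, but then \<open>p\<close> would be 25. With \<open>n \<ge> 4\<close>
        the exceptional term is at most 1.\<close>
      have "\<not> Factorial_Ring.prime (25::nat)"
        using prime_product[of 5 "5::nat"] by auto
      then have "n \<noteq> 3" using p k by auto
      then have "4 \<le> n" using n by linarith
      then have "2 * real e / real n \<le> 2 * real e / 4" by (intro divide_left_mono) auto
      moreover have "real M \<le> 6" using M_nat k by simp
      moreover have "target (2.24) \<le> target x"
        by (intro target_mono x_ge) (use k in \<open>auto simp: power3_eq_cube\<close>)
      moreover have "7 \<le> target (2.24)" by (simp add: target_def power2_eq_square)
      ultimately show ?thesis using e_le by linarith
    qed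
  next
    case 2
    have "2.33 \<le> x" by (rule x_ge) (use 2 in \<open>auto simp: power3_eq_cube\<close>)
    have "real M + 2/3 * real e \<le> (2 * real k + 2) / 3 + 4/3" using M2' e_le by argo
    also have "\<dots> = c / 3 * x ^ 3 + 2" by (simp add: k_x field_simps)
    \<comment> \<open>The decimals 0.4714067 here and 0.353555 in the next case are upper bounds for
      \<open>sqrt 2 / 3\<close> and \<open>sqrt 2 / 4\<close>.\<close>
    also have "\<dots> \<le> 0.4714067 * x ^ 3 + 2" using c x(1) by (intro add_right_mono mult_right_mono) auto
    also have "\<dots> \<le> target x"
      by (rule target_bound_cubic[of "2.33" _ "3.1"])
        (use 2 \<open>2.33 \<le> x\<close> in \<open>auto simp: target_def power2_eq_square power3_eq_cube\<close>)
    finally show ?thesis using T1 by linarith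
  next
    case 3
    have "real k \<ge> 1.41421 * 3.1 ^ 3 / 2"
      unfolding k_x using c 3 by (intro divide_right_mono mult_mono power_mono) auto
    then have "3 \<le> k" by (simp add: power3_eq_cube)
    then have "real M + 2/3 * real e \<le> 3 + (2 * real k + 2) / 4 + 4/3" using M[of 3] n e_le by simp
    also have "\<dots> = c / 4 * x ^ 3 + 29/6" by (simp add: k_x field_simps)
    also have "\<dots> \<le> 0.353555 * x ^ 3 + 29/6" using c x(1) by (intro add_right_mono mult_right_mono) auto
    also have "\<dots> \<le> target x"
      by (rule target_bound_cubic[of "3.1" _ "5.5"])
        (use 3 in \<open>auto simp: target_def power2_eq_square power3_eq_cube\<close>)
    finally show ?thesis using T1 by linarith
  next
    case 4
    \<comment> \<open>The choice \<open>s = w - 1\<close> turns the denominator \<open>s + 1\<close>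
      into \<open>w\<close>; clearing it leaves a polynomial inequality in \<open>w\<close> and the
      fractional part of \<open>x\<close>.\<close>
    define w where "w = nat \<lfloor>x\<rfloor>"
    have w: "real w \<le> x" "x < real w + 1" "5 \<le> w"
      unfolding w_def using 4 by (simp_all add: of_nat_nat, linarith+)
    have "w \<le> k"
    proof -
      have "1.41421 * real w / 2 * (5.5 * 5.5) \<le> c * x / 2 * (x * x)"
        using 4 w c by (intro mult_mono divide_right_mono) auto
      also have "\<dots> = real k" unfolding k_x by (simp add: power3_eq_cube)
      finally show ?thesis by simp
    qed
    \<comment> \<open>Otherwise \<open>k\<close> would be at least about 0.7 (n + 2)^3, whereas it
      is bounded by a cubic in \<open>n\<close> with leading coefficient 1/4; this is where the
      assumed upper bound on \<open>p\<close> enters.\<close>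
    have "w \<le> n + 1"
    proof (rule ccontr)
      assume "\<not> w \<le> n + 1"
      then have "real n + 2 \<le> x" using w by linarith
      then have "1.41421 * (real n + 2) ^ 3 / 2 \<le> real k"
        unfolding k_x using c by (intro divide_right_mono mult_mono power_mono) auto
      then have "1.41421 * (real n + 2) ^ 3 / 2 \<le> (real n + 3) * (real n + 4) * (3 * real n - 1) / 12 - 3"
        using k_le by linarith
      moreover have "(real n + 2) ^ 3 = real n ^ 3 + 6 * real n ^ 2 + 12 * real n + 8"
        "(real n + 3) * (real n + 4) * (3 * real n - 1) = 3 * real n ^ 3 + 20 * real n ^ 2 + 29 * real n - 12"
        by (simp_all add: power2_eq_square power3_eq_cube algebra_simps)
      moreover have "0 \<le> real n ^ 3" "0 \<le> real n ^ 2" "0 \<le> real n" by simp_all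
      ultimately show False by (simp add: field_simps)
    qed
    define f where "f = x - real w"
    have f: "0 \<le> f" "f \<le> 1" "x = real w + f" using w by (auto simp: f_def)
    define W where "W = real w"
    have W: "5 \<le> W" using w by (simp add: W_def)
    have s: "real (w - 1) = W - 1" using w by (simp add: W_def of_nat_diff)
    have "real M \<le> (W - 1) ^ 2 - 2 * (W - 1) + (2 * real k + 2) / W"
      using M[of "w - 1"] \<open>w \<le> k\<close> \<open>w \<le> n + 1\<close> w unfolding s by simp
    also have "\<dots> = (W * ((W - 1) ^ 2 - 2 * (W - 1)) + c * x ^ 3 + 2) / W"
      unfolding k_x using W by (simp add: field_simps)
    also have "\<dots> \<le> target x - 4/3"
    proof -
      \<comment> \<open>After substituting \<open>x = W + f\<close> the main term is
        \<open>W ^ 2 * ((2 - c) * W - 27/19)\<close>: the 2 is 3 - 1, and 27/19 is 103/19 - 4. The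
        other terms are controlled by \<open>W \<ge> 5\<close> and
        \<open>0 \<le> f \<le> 1\<close>.\<close>
      have "0 \<le> (2 - c) * W - 27/19" using mult_left_mono[OF W, of "2 - c"] c by simp
      then have "25 * ((2 - c) * W - 27/19) \<le> W ^ 2 * ((2 - c) * W - 27/19)"
        using power_mono[OF W, of 2] by (intro mult_right_mono) auto
      moreover have "(2 - c) * 5 \<le> (2 - c) * W" using W c by (intro mult_left_mono) auto
      moreover have "25 * (P - 27/19) \<le> R" if "25 * (Q - 27/19) \<le> R" "P \<le> Q" for P Q R :: real
        using that by argo
      ultimately have h1: "25 * ((2 - c) * 5 - 27/19) \<le> W ^ 2 * ((2 - c) * W - 27/19)"
        by blast
      have hf: "0 \<le> W * f * ((6 - 3 * c) * W - (3 * c - 3) * f - 103/19)"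
      proof (intro mult_nonneg_nonneg)
        have "(6 - 3 * c) * 5 \<le> (6 - 3 * c) * W" using W c by (intro mult_left_mono) auto
        moreover have "(3 * c - 3) * f \<le> (3 * c - 3) * 1" using f c by (intro mult_left_mono) auto
        moreover have "0 \<le> P - Q - 103/19" if "(6 - 3 * c) * 5 \<le> P" "Q \<le> (3 * c - 3) * 1" for P Q
          using that c(2,3) by argo
        ultimately show "0 \<le> (6 - 3 * c) * W - (3 * c - 3) * f - 103/19" by blast
      qed (use W f in auto)
      have hc: "c * f ^ 3 \<le> c * 1" using f c by (intro mult_left_mono power_le_one) auto
      have "0 \<le> W ^ 2 * ((2 - c) * W - 27/19) + W * f * ((6 - 3 * c) * W - (3 * c - 3) * f - 103/19) - c * f ^ 3 - 2"
      proof -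
        have "0 \<le> R + Q - P - 2" if "0 \<le> Q" "P \<le> c * 1" "25 * ((2 - c) * 5 - 27/19) \<le> R" for P Q R
          using that c(2,3) by argo
        then show ?thesis using hf hc h1 by blast
      qed
      also have "\<dots> = W * (target x - 4/3) - (W * ((W - 1) ^ 2 - 2 * (W - 1)) + c * x ^ 3 + 2)"
        unfolding f(3) W_def[symmetric] target_def
        by (simp add: power2_eq_square power3_eq_cube field_simps)
      finally show ?thesis using W by (simp add: field_simps)
    qed
    finally show ?thesis using T1 e_le by linarith
  qed
qed

section \<open>Evaluation of polynomials in several variables\<close>

abbreviation lkp where "lkp \<equiv> Poly_Mapping.lookup"

definition monomial_eval :: "'b::comm_ring_1 ^ 'n \<Rightarrow> ('n::finite \<Rightarrow>\<^sub>0 nat) \<Rightarrow> 'b" where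
  "monomial_eval x m = (\<Prod>i\<in>UNIV. (x $ i) ^ lkp m i)"

text \<open>The map \<open>h\<close> on coefficients is a parameter, so that one set of rules serves
  evaluation at points, at generic points over a larger field, with coefficients twisted by
  Frobenius, and substitution.\<close>

definition eval_along :: "('a \<Rightarrow> 'b::comm_ring_1) \<Rightarrow> (('n::finite \<Rightarrow>\<^sub>0 nat) \<Rightarrow>\<^sub>0 'a::zero) \<Rightarrow> 'b ^ 'n \<Rightarrow> 'b" where
  "eval_along h A x = (\<Sum>m\<in>Poly_Mapping.keys A. h (lkp A m) * monomial_eval x m)"

lemma mpol_eval_eq: "mpol_eval A x = eval_along (\<lambda>c. c) A x"
  by (simp add: mpol_eval_def eval_along_def monomial_eval_def)

lemma monomial_eval_0 [simp]: "monomial_eval x 0 = 1"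
  by (simp add: monomial_eval_def)

lemma monomial_eval_add: "monomial_eval x (m + m') = monomial_eval x m * monomial_eval x m'"
  by (simp add: monomial_eval_def lookup_add power_add prod.distrib)

lemma monomial_eval_single: "monomial_eval x (Poly_Mapping.single i e) = (x $ i) ^ e"
proof -
  have "monomial_eval x (Poly_Mapping.single i e) = (\<Prod>j\<in>UNIV. if j = i then (x $ i) ^ e else 1)"
    unfolding monomial_eval_def by (intro prod.cong) (auto simp: lookup_single when_def)
  then show ?thesis by simp
qed

lemma eval_along_superset:
  assumes "h 0 = 0" "finite S" "Poly_Mapping.keys A \<subseteq> S"
  shows "eval_along h A x = (\<Sum>m\<in>S. h (lkp A m) * monomial_eval x m)"
  unfolding eval_along_def
  using assms by (intro sum.mono_neutral_left) (auto simp: in_keys_iff)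

lemma eval_along_single: "h 0 = 0 \<Longrightarrow> eval_along h (Poly_Mapping.single m c) x = h c * monomial_eval x m"
  by (subst eval_along_superset[of h "{m}"]) auto

lemma poly_mapping_eq_sum: "A = (\<Sum>m\<in>Poly_Mapping.keys A. Poly_Mapping.single m (lkp A m))"
proof (rule poly_mapping_eqI)
  fix k
  have "(\<Sum>m\<in>Poly_Mapping.keys A. lkp A m when m = k)
      = (\<Sum>m\<in>{k} \<inter> Poly_Mapping.keys A. lkp A m)"
    by (intro sum.mono_neutral_cong_right) (auto simp: when_def)
  also have "\<dots> = lkp A k" by (cases "k \<in> Poly_Mapping.keys A") (auto simp: in_keys_iff)
  finally show "lkp A k = lkp (\<Sum>m\<in>Poly_Mapping.keys A. Poly_Mapping.single m (lkp A m)) k"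
    by (simp add: lookup_sum lookup_single)
qed

lemma eval_along_map:
  assumes "f 0 = 0" "h 0 = 0"
  shows "eval_along h (Poly_Mapping.map f A) x = eval_along (\<lambda>c. h (f c)) A x"
proof -
  have "Poly_Mapping.keys (Poly_Mapping.map f A) \<subseteq> Poly_Mapping.keys A"
    using assms by (auto simp: in_keys_iff Poly_Mapping.map.rep_eq when_def)
  then have "eval_along h (Poly_Mapping.map f A) x
      = (\<Sum>m\<in>Poly_Mapping.keys A. h (lkp (Poly_Mapping.map f A) m) * monomial_eval x m)"
    by (intro eval_along_superset) (use assms in auto)
  also have "\<dots> = eval_along (\<lambda>c. h (f c)) A x"
    unfolding eval_along_def
    by (intro sum.cong) (auto simp: Poly_Mapping.map.rep_eq in_keys_iff when_def)
  finally show ?thesis .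
qed

context comm_ring_hom
begin

lemma eval_along_add: "eval_along hom (A + B) x = eval_along hom A x + eval_along hom B x"
proof -
  let ?S = "Poly_Mapping.keys A \<union> Poly_Mapping.keys B"
  have "eval_along hom (A + B) x = (\<Sum>m\<in>?S. hom (lkp (A + B) m) * monomial_eval x m)"
    by (rule eval_along_superset) (use Poly_Mapping.keys_add[of A B] in auto)
  also have "\<dots> = (\<Sum>m\<in>?S. hom (lkp A m) * monomial_eval x m) + (\<Sum>m\<in>?S. hom (lkp B m) * monomial_eval x m)"
    by (simp add: lookup_add hom_add distrib_right sum.distrib)
  also have "\<dots> = eval_along hom A x + eval_along hom B x"
    by (simp add: eval_along_superset[of hom ?S A] eval_along_superset[of hom ?S B])
  finally show ?thesis .
qed

lemma eval_along_sum: "eval_along hom (sum f S) x = (\<Sum>s\<in>S. eval_along hom (f s) x)"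
  by (induction S rule: infinite_finite_induct)
    (simp_all add: eval_along_add, simp_all add: eval_along_def)

lemma eval_along_mult: "eval_along hom (A * B) x = eval_along hom A x * eval_along hom B x"
proof -
  have "A * B = (\<Sum>m\<in>Poly_Mapping.keys A. \<Sum>m'\<in>Poly_Mapping.keys B.
      Poly_Mapping.single (m + m') (lkp A m * lkp B m'))"
    by (subst (1 2) poly_mapping_eq_sum) (simp add: sum_product mult_single)
  also have "eval_along hom \<dots> x = (\<Sum>m\<in>Poly_Mapping.keys A. \<Sum>m'\<in>Poly_Mapping.keys B.
      (hom (lkp A m) * monomial_eval x m) * (hom (lkp B m') * monomial_eval x m'))"
    by (simp add: eval_along_sum eval_along_single hom_mult monomial_eval_add mult_ac)
  also have "\<dots> = eval_along hom A x * eval_along hom B x"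
    by (simp add: eval_along_def sum_product)
  finally show ?thesis .
qed

lemma eval_along_comm_ring_hom: "comm_ring_hom (\<lambda>A. eval_along hom A x)"
proof
  show "eval_along hom 1 x = 1"
    using eval_along_single[of hom 0 1 x] by simp
  show "eval_along hom 0 x = 0" by (simp add: eval_along_def)
qed (rule eval_along_add eval_along_mult)+

lemma hom_eval_along: "hom (eval_along h A x) = eval_along (\<lambda>c. hom (h c)) A (\<chi> i. hom (x $ i))"
  by (simp add: eval_along_def monomial_eval_def hom_sum hom_mult hom_prod hom_power)

end

lemma homogeneous_single: "(\<Sum>i\<in>UNIV. lkp m i) = d \<Longrightarrow> homogeneous d (Poly_Mapping.single m c)"
  by (auto simp: homogeneous_def split: if_splits)

lemma homogeneous_0 [simp]: "homogeneous d 0"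
  by (simp add: homogeneous_def)

lemma homogeneous_add: "homogeneous d A \<Longrightarrow> homogeneous d B \<Longrightarrow> homogeneous d (A + B)"
  using Poly_Mapping.keys_add[of A B] by (auto simp: homogeneous_def)

lemma homogeneous_sum: "(\<And>s. s \<in> S \<Longrightarrow> homogeneous d (f s)) \<Longrightarrow> homogeneous d (sum f S)"
  by (induction S rule: infinite_finite_induct) (auto intro: homogeneous_add)

lemma homogeneous_mult: "homogeneous d A \<Longrightarrow> homogeneous e B \<Longrightarrow> homogeneous (d + e) (A * B)"
  using Poly_Mapping.keys_mult[of A B]
  by (fastforce simp: homogeneous_def lookup_add sum.distrib)

lemma homogeneous_1: "homogeneous 0 1"
  using homogeneous_single[of 0 0 1] by simp

lemma homogeneous_power: "homogeneous d A \<Longrightarrow> homogeneous (e * d) (A ^ e)"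
  by (induction e) (auto intro: homogeneous_1 homogeneous_mult)

lemma homogeneous_prod: "(\<And>s. s \<in> S \<Longrightarrow> homogeneous (d s) (f s)) \<Longrightarrow> homogeneous (sum d S) (prod f S)"
  by (induction S rule: infinite_finite_induct) (auto intro: homogeneous_1 homogeneous_mult)

lemma homogeneous_map: "f 0 = 0 \<Longrightarrow> homogeneous d A \<Longrightarrow> homogeneous d (Poly_Mapping.map f A)"
  by (auto simp: homogeneous_def in_keys_iff Poly_Mapping.map.rep_eq when_def split: if_splits)

lemma monomial_eval_scale: "monomial_eval (\<chi> i. t * x $ i) m = t ^ (\<Sum>i\<in>UNIV. lkp m i) * monomial_eval x m"
  by (simp add: monomial_eval_def power_mult_distrib prod.distrib power_sum)

lemma eval_along_scale:
  "homogeneous d A \<Longrightarrow> eval_along h A (\<chi> i. t * x $ i) = t ^ d * eval_along h A x"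
  unfolding eval_along_def sum_distrib_left
  by (intro sum.cong) (auto simp: homogeneous_def monomial_eval_scale)

text \<open>Substitution is evaluation with values in the polynomial ring itself, so that it
  inherits the rules for \<open>eval_along\<close>.\<close>

definition mpol_comp :: "(('m::finite \<Rightarrow>\<^sub>0 nat) \<Rightarrow>\<^sub>0 'a::comm_ring_1) \<Rightarrow> ('m \<Rightarrow> (('n \<Rightarrow>\<^sub>0 nat) \<Rightarrow>\<^sub>0 'a)) \<Rightarrow> (('n \<Rightarrow>\<^sub>0 nat) \<Rightarrow>\<^sub>0 'a)" where
  "mpol_comp A H = eval_along (Poly_Mapping.single 0) A (\<chi> i. H i)"

lemma (in comm_ring_hom) eval_along_comp:
  "eval_along hom (mpol_comp A H) x = eval_along hom A (\<chi> i. eval_along hom (H i) x)"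
  unfolding mpol_comp_def
  by (subst comm_ring_hom.hom_eval_along[OF eval_along_comm_ring_hom])
    (simp add: eval_along_single)

lemma homogeneous_comp:
  assumes "homogeneous d A" "\<And>i. homogeneous e (H i)"
  shows "homogeneous (d * e) (mpol_comp A H)"
  unfolding mpol_comp_def eval_along_def
proof (rule homogeneous_sum)
  fix m assume m: "m \<in> Poly_Mapping.keys A"
  have "homogeneous (0 + (\<Sum>i\<in>UNIV. lkp m i * e)) (Poly_Mapping.single 0 (lkp A m) * monomial_eval (\<chi> i. H i) m)"
    unfolding monomial_eval_def
    by (intro homogeneous_mult homogeneous_single homogeneous_prod) (auto intro: homogeneous_power assms)
  then show "homogeneous (d * e) (Poly_Mapping.single 0 (lkp A m) * monomial_eval (\<chi> i. H i) m)"
    using assms(1) m by (simp add: homogeneous_def flip: sum_distrib_right)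
qed

text \<open>The homogenizing variable \<open>i\<close> may already occur in \<open>P\<close>; the
  result still agrees with \<open>P\<close> wherever coordinate \<open>i\<close> is 1. For
  \<open>P = 0\<close> the \<open>Max\<close> is unspecified, but the result is 0, which is
  homogeneous of every degree.\<close>

definition homogenize :: "'n \<Rightarrow> (('n::finite \<Rightarrow>\<^sub>0 nat) \<Rightarrow>\<^sub>0 'a::comm_ring_1) \<Rightarrow> (('n \<Rightarrow>\<^sub>0 nat) \<Rightarrow>\<^sub>0 'a)" where
  "homogenize i P = (\<Sum>m\<in>Poly_Mapping.keys P. Poly_Mapping.single
     (m + Poly_Mapping.single i (Max ((\<lambda>m. \<Sum>j\<in>UNIV. lkp m j) ` Poly_Mapping.keys P) - (\<Sum>j\<in>UNIV. lkp m j))) (lkp P m))"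

lemma homogeneous_homogenize:
  "homogeneous (Max ((\<lambda>m. \<Sum>j\<in>UNIV. lkp m j) ` Poly_Mapping.keys P)) (homogenize i P)"
  unfolding homogenize_def
proof (intro homogeneous_sum homogeneous_single)
  fix m assume m: "m \<in> Poly_Mapping.keys P"
  let ?d = "Max ((\<lambda>m. \<Sum>j\<in>UNIV. lkp m j) ` Poly_Mapping.keys P)"
  have le: "(\<Sum>j\<in>UNIV. lkp m j) \<le> ?d" using m by (intro Max_ge) auto
  have "(\<Sum>j\<in>UNIV. lkp (Poly_Mapping.single i (?d - (\<Sum>j\<in>UNIV. lkp m j))) j)
      = (\<Sum>j\<in>UNIV. if j = i then ?d - (\<Sum>j\<in>UNIV. lkp m j) else 0)"
    by (intro sum.cong) (auto simp: lookup_single when_def)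
  then show "(\<Sum>j\<in>UNIV. lkp (m + Poly_Mapping.single i (?d - (\<Sum>j\<in>UNIV. lkp m j))) j) = ?d"
    using le by (simp add: lookup_add sum.distrib)
qed

lemma (in comm_ring_hom) eval_along_homogenize:
  "w $ i = 1 \<Longrightarrow> eval_along hom (homogenize i P) w = eval_along hom P w"
  unfolding homogenize_def
  by (simp add: eval_along_sum eval_along_single monomial_eval_add monomial_eval_single)
    (simp add: eval_along_def)

section \<open>Polynomials in Y over polynomials in X, and n-th roots\<close>

definition eval2 :: "('a \<Rightarrow> 'b::comm_ring_1) \<Rightarrow> 'b \<Rightarrow> 'a::comm_ring_1 poly \<Rightarrow> 'b" where
  "eval2 h y R = poly (map_poly h R) y"

context comm_ring_hom
begin

lemma eval2_comm_ring_hom: "comm_ring_hom (eval2 hom y)"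
proof -
  interpret mp: map_poly_comm_ring_hom hom ..
  show ?thesis
    unfolding eval2_def by unfold_locales (simp_all add: mp.hom_add mp.hom_mult)
qed

lemma eval2_const: "eval2 hom y [:c:] = hom c"
proof -
  have "map_poly hom [:c:] = [:hom c:]"
    by (rule poly_eqI) (simp add: coeff_map_poly coeff_pCons split: nat.split)
  then show ?thesis by (simp add: eval2_def)
qed

lemma eval2_monom: "eval2 hom y (monom c m) = hom c * y ^ m"
  by (simp add: eval2_def map_poly_monom poly_monom)

lemma eval2_smult: "eval2 hom y (smult c R) = hom c * eval2 hom y R"
proof -
  interpret ev: comm_ring_hom "eval2 hom y" by (rule eval2_comm_ring_hom)
  have "smult c R = [:c:] * R" by simp
  then show ?thesis by (simp only: ev.hom_mult eval2_const)
qed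

lemma eval2_diff: "eval2 hom y (P - Q) = eval2 hom y P - eval2 hom y Q"
proof -
  interpret ev: comm_ring_hom "eval2 hom y" by (rule eval2_comm_ring_hom)
  show ?thesis by (rule ev.hom_minus)
qed

end

text \<open>A double root \<open>y\<close> would satisfy \<open>n y ^ (n - 1) = 0\<close>, hence be
  0, against \<open>c \<noteq> 0\<close>; so the linear factors are distinct.\<close>

lemma card_roots_of_power:
  fixes c :: "'a::alg_closed_field"
  assumes "c \<noteq> 0" "of_nat n \<noteq> (0::'a)"
  shows "card {y. y ^ n = c} = n" "finite {y. y ^ n = c}"
proof -
  have n: "n > 0" using assms(2) by (cases n) auto
  define q where "q = monom 1 n - [:c:]"
  have cq: "coeff q n = 1" using n by (simp add: q_def coeff_pCons split: nat.split)
  have deg: "degree q = n"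
  proof (rule antisym)
    show "degree q \<le> n" unfolding q_def by (intro degree_diff_le) (auto simp: degree_monom_le)
    show "n \<le> degree q" by (rule le_degree) (simp add: cq)
  qed
  have q0: "q \<noteq> 0" using cq by auto
  have lc: "lead_coeff q = 1" using cq deg by simp
  obtain A where A: "size A = degree q" "q = smult (lead_coeff q) (\<Prod>x\<in>#A. [:- x, 1:])"
    using alg_closed_imp_factorization[OF q0] by blast
  have poly_q: "poly q y = y ^ n - c" for y by (simp add: q_def poly_monom)
  have roots: "set_mset A = {y. y ^ n = c}"
  proof -
    have "poly q y = 0 \<longleftrightarrow> y \<in># A" for y
      by (subst A(2)) (auto simp: lc poly_prod_mset prod_mset_zero_iff)
    then show ?thesis by (auto simp: poly_q)
  qed
  have "count A y \<le> 1" for y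
  proof (rule ccontr)
    assume "\<not> count A y \<le> 1"
    then have "2 \<le> count A y" by simp
    then have "{#y, y#} \<subseteq># A" by (simp add: subseteq_mset_def)
    then obtain B where "A = {#y, y#} + B" by (metis mset_subset_eq_exists_conv)
    then have "q = [:- y, 1:] * ([:- y, 1:] * (\<Prod>x\<in>#B. [:- x, 1:]))"
      using A(2) unfolding lc by (simp only: smult_1_left) simp
    then obtain L S where LS: "q = L * (L * S)" "poly L y = 0"
      by (rule that[of "[:- y, 1:]"]) simp
    then have "poly (pderiv q) y = 0" "poly q y = 0"
      by (simp_all add: pderiv_mult)
    then have "of_nat n * y ^ (n - 1) = 0" "y ^ n = c"
      by (simp_all add: q_def pderiv_diff pderiv_monom poly_monom pderiv_pCons)
    then show False using assms n by (cases n) auto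
  qed
  then have "A = mset_set (set_mset A)"
    by (intro multiset_eqI) (metis count_mset_set(1,3) count_eq_zero_iff finite_set_mset le_antisym Suc_leI One_nat_def neq0_conv)
  then have "size A = card (set_mset A)" by (metis size_mset_set)
  then show "card {y. y ^ n = c} = n" using A(1) deg roots by simp
  show "finite {y. y ^ n = c}" unfolding roots[symmetric] by simp
qed

lemma pseudo_remainder:
  fixes A B :: "'a::field poly" and R :: "'a poly poly"
  assumes "A \<noteq> 0" "0 < n"
  obtains e q r where "smult (A ^ e) R = (monom A n - [:B:]) * q + r" "r = 0 \<or> degree r < n"
proof -
  define g where "g = monom A n - [:B:]"
  have cg: "coeff g n = A" using assms by (simp add: g_def coeff_pCons split: nat.split)
  have deg: "degree g = n"
  proof (rule antisym)
    show "degree g \<le> n" unfolding g_def by (intro degree_diff_le) (auto simp: degree_monom_le)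
    show "n \<le> degree g" by (rule le_degree) (simp add: cg assms)
  qed
  have "g \<noteq> 0" using cg assms by auto
  obtain q r where qr: "pseudo_divmod R g = (q, r)" by fastforce
  from pseudo_divmod[OF \<open>g \<noteq> 0\<close> qr] show thesis
    using that unfolding deg cg g_def[symmetric] by blast
qed

section \<open>Generic points of superelliptic curves\<close>

definition gen :: "'a::field poly \<Rightarrow> 'a poly fract alg_closure" where
  "gen f = to_ac (to_fract f)"

lemma gen_hom: "comm_ring_hom gen"
  by unfold_locales (simp_all add: gen_def)

lemma gen_eq_0_iff [simp]: "gen f = 0 \<longleftrightarrow> f = 0"
  by (simp add: gen_def)

lemma ex_nth_root_gen: "0 < n \<Longrightarrow> \<exists>y. y ^ n = (z :: 'a::field poly fract alg_closure)"
  using nth_root_exists by blast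

text \<open>The superelliptic curve \<open>A(X) Y\<^sup>n = B(X)\<close>, with generic point \<open>(X, y)\<close> in the algebraic closure
  of the rational function field.\<close>

locale superelliptic =
  fixes A B :: "'a::alg_closed_field poly" and n :: nat and y :: "'a poly fract alg_closure"
  assumes A0: "A \<noteq> 0" and B0: "B \<noteq> 0" and n: "of_nat n \<noteq> (0::'a)"
    and y: "gen A * y ^ n = gen B"
begin

lemma n_pos: "0 < n" using n by (cases n) auto

lemma inf_UNIV: "infinite (UNIV :: 'a set)"
proof
  assume fin: "finite (UNIV :: 'a set)"
  define f :: "'a poly" where "f = (\<Prod>x\<in>UNIV. [:- x, 1:]) + 1"
  have "degree (\<Prod>x\<in>(UNIV::'a set). [:- x, 1:]) = (\<Sum>x\<in>(UNIV::'a set). 1)"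
    by (subst degree_prod_eq_sum_degree) auto
  also have "\<dots> > 0" using fin by (simp add: card_gt_0_iff)
  finally have "degree f > 0" unfolding f_def by (subst degree_add_eq_left) auto
  then obtain z where "poly f z = 0" using alg_closed_imp_poly_has_root by blast
  moreover have "(\<Prod>x\<in>UNIV. z - x) = 0" by (rule prod_zero[OF fin]) (auto intro: bexI[of _ z])
  ultimately show False by (simp add: f_def poly_prod)
qed

lemma eval_gen_pseudo:
  assumes "smult (A ^ e) R = (monom A n - [:B:]) * q + r"
  shows "gen A ^ e * eval2 gen y R = eval2 gen y r"
proof -
  interpret gen: comm_ring_hom gen by (rule gen_hom)
  interpret ev: comm_ring_hom "eval2 gen y" by (rule gen.eval2_comm_ring_hom)
  have "eval2 gen y (monom A n - [:B:]) = 0"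
    using y by (simp add: gen.eval2_diff gen.eval2_monom gen.eval2_const)
  then have "eval2 gen y (smult (A ^ e) R) = eval2 gen y r"
    unfolding assms by (simp add: ev.hom_add ev.hom_mult)
  then show ?thesis by (simp add: gen.eval2_smult gen.hom_power)
qed

lemma eval_point_pseudo:
  assumes "smult (A ^ e) R = (monom A n - [:B:]) * q + r" "poly A x0 * y0 ^ n = poly B x0"
  shows "poly A x0 ^ e * eval2 (\<lambda>f. poly f x0) y0 R = eval2 (\<lambda>f. poly f x0) y0 r"
proof -
  have px: "comm_ring_hom (\<lambda>f. poly f x0)" by unfold_locales simp_all
  interpret ev: comm_ring_hom "eval2 (\<lambda>f. poly f x0) y0" by (rule comm_ring_hom.eval2_comm_ring_hom[OF px])
  have "eval2 (\<lambda>f. poly f x0) y0 (monom A n - [:B:]) = 0"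
    using assms(2) by (simp add: comm_ring_hom.eval2_diff[OF px] comm_ring_hom.eval2_monom[OF px]
        comm_ring_hom.eval2_const[OF px])
  then have "eval2 (\<lambda>f. poly f x0) y0 (smult (A ^ e) R) = eval2 (\<lambda>f. poly f x0) y0 r"
    unfolding assms(1) by (simp add: ev.hom_add ev.hom_mult)
  then show ?thesis by (simp add: comm_ring_hom.eval2_smult[OF px])
qed

text \<open>Over each \<open>x0\<close> outside a finite set the equation has \<open>n\<close>
  solutions \<open>y0\<close>, too many for a nonzero polynomial of degree below \<open>n\<close> in
  Y; so each coefficient of \<open>r\<close> vanishes at infinitely many \<open>x0\<close>.\<close>

lemma remainder_zero_of_points:
  assumes r: "r = 0 \<or> degree r < n" and F: "finite F"
    and van: "\<And>x0 y0. x0 \<notin> F \<Longrightarrow> poly A x0 * y0 ^ n = poly B x0 \<Longrightarrow> eval2 (\<lambda>f. poly f x0) y0 r = 0"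
  shows "r = 0"
proof -
  define F' where "F' = F \<union> {x. poly A x = 0} \<union> {x. poly B x = 0}"
  have F': "finite F'" using F A0 B0 by (simp add: F'_def poly_roots_finite)
  have zero: "poly (coeff r j) x0 = 0" if x0: "x0 \<notin> F'" for x0 j
  proof -
    define c where "c = poly B x0 / poly A x0"
    have AB: "poly A x0 \<noteq> 0" "poly B x0 \<noteq> 0" "x0 \<notin> F" using x0 by (auto simp: F'_def)
    define s where "s = map_poly (\<lambda>f. poly f x0) r"
    have "s = 0"
    proof (rule ccontr)
      assume "s \<noteq> 0"
      then have "r \<noteq> 0" by (auto simp: s_def)
      have "degree s < n"
      proof -
        have "degree s \<le> degree r"
          unfolding s_def by (rule degree_le) (simp add: coeff_map_poly coeff_eq_0)
        then show ?thesis using r \<open>r \<noteq> 0\<close> by simp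
      qed
      moreover have "n \<le> card {z. poly s z = 0}"
      proof -
        have "c \<noteq> 0" using AB by (simp add: c_def)
        have "poly s z = 0" if "z ^ n = c" for z
          using van[of x0 z] AB that by (simp add: c_def s_def eval2_def)
        then have "card {z. z ^ n = c} \<le> card {z. poly s z = 0}"
          using poly_roots_finite[OF \<open>s \<noteq> 0\<close>] by (intro card_mono) auto
        then show ?thesis using card_roots_of_power(1)[OF \<open>c \<noteq> 0\<close> n] by simp
      qed
      ultimately show False using card_poly_roots_bound[OF \<open>s \<noteq> 0\<close>] by simp
    qed
    then have "coeff s j = 0" by simp
    then show ?thesis by (simp add: s_def coeff_map_poly)
  qed
  have "coeff r j = 0" for j
  proof (rule ccontr)
    assume "coeff r j \<noteq> 0"
    then have "finite {x. poly (coeff r j) x = 0}" by (rule poly_roots_finite)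
    moreover have "- F' \<subseteq> {x. poly (coeff r j) x = 0}" using zero by auto
    ultimately have "finite (- F')" by (rule rev_finite_subset)
    then have "finite (F' \<union> - F')" using F' by blast
    then show False using inf_UNIV by (simp add: Un_commute)
  qed
  then show ?thesis by (intro poly_eqI) simp
qed

text \<open>Pseudo-division by \<open>A Y^n - B\<close> leaves a remainder that vanishes on the same
  fibres, hence is 0. So a power of \<open>A\<close> times \<open>R\<close> is a multiple of the
  equation, and \<open>R\<close> vanishes wherever the equation holds and \<open>A\<close> does not
  vanish, the generic point included.\<close>

lemma vanish_extends:
  assumes F: "finite F"
    and van: "\<And>x0 y0. x0 \<notin> F \<Longrightarrow> poly A x0 * y0 ^ n = poly B x0 \<Longrightarrow> eval2 (\<lambda>f. poly f x0) y0 R = 0"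
  shows "eval2 gen y R = 0"
    and "poly A x0 * y0 ^ n = poly B x0 \<Longrightarrow> poly A x0 \<noteq> 0 \<Longrightarrow> eval2 (\<lambda>f. poly f x0) y0 R = 0"
proof -
  obtain e q r where qr: "smult (A ^ e) R = (monom A n - [:B:]) * q + r" "r = 0 \<or> degree r < n"
    using pseudo_remainder[OF A0 n_pos] by blast
  have "r = 0"
  proof (rule remainder_zero_of_points[OF qr(2) F])
    fix x0 y0 assume "x0 \<notin> F" "poly A x0 * y0 ^ n = poly B x0"
    then show "eval2 (\<lambda>f. poly f x0) y0 r = 0"
      using van eval_point_pseudo[OF qr(1)] by (metis mult_zero_right)
  qed
  then show "eval2 gen y R = 0"
    using eval_gen_pseudo[OF qr(1)] A0 by (simp add: eval2_def)
  show "eval2 (\<lambda>f. poly f x0) y0 R = 0" if "poly A x0 * y0 ^ n = poly B x0" "poly A x0 \<noteq> 0"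
    using eval_point_pseudo[OF qr(1) that(1)] \<open>r = 0\<close> that(2) by (simp add: eval2_def)
qed

text \<open>If \<open>B\<close> has a simple zero at \<open>\<beta>\<close> where \<open>A\<close> does not vanish, then \<open>B/A\<close> has valuation 1 at \<open>\<beta>\<close>,
  so \<open>y\<close> has degree \<open>n\<close> over the rational function field: the constant coefficient of its minimal
  polynomial has an \<open>n\<close>-th power of valuation equal to the degree.\<close>

lemma remainder_zero_of_generic:
  assumes r: "r = 0 \<or> degree r < n" and ev: "eval2 gen y r = 0"
    and \<beta>: "B = [:- \<beta>, 1:] * B1" "poly B1 \<beta> \<noteq> 0" "poly A \<beta> \<noteq> 0"
  shows "r = 0"
proof (rule ccontr)
  assume "r \<noteq> 0"
  interpret fr: inj_comm_ring_hom "to_fract :: 'a poly \<Rightarrow> 'a poly fract" by unfold_locales simp_all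
  interpret ac: inj_comm_ring_hom "to_ac :: 'a poly fract \<Rightarrow> 'a poly fract alg_closure"
    by unfold_locales simp_all
  define P where "P d \<longleftrightarrow> (\<exists>D. D \<noteq> 0 \<and> degree D = d \<and> eval2 to_ac y D = 0)" for d
  have P_r: "P (degree r)"
    unfolding P_def
  proof (intro exI conjI)
    have "map_poly to_ac (map_poly to_fract r) = map_poly gen r"
      by (subst map_poly_map_poly) (simp_all add: gen_def[abs_def] o_def)
    then show "eval2 to_ac y (map_poly to_fract r) = 0"
      using ev by (simp add: eval2_def)
    show "degree (map_poly to_fract r) = degree r" by (rule degree_map_poly) simp
    show "map_poly to_fract r \<noteq> 0" using \<open>r \<noteq> 0\<close> by (subst map_poly_eq_0_iff) auto
  qed
  define d where "d = (LEAST d. P d)"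
  have "P d" unfolding d_def using P_r by (rule LeastI)
  have "d < n" using Least_le[of P, OF P_r] r \<open>r \<noteq> 0\<close> by (simp add: d_def)
  obtain D where D: "D \<noteq> 0" "degree D = d" "eval2 to_ac y D = 0"
    using \<open>P d\<close> by (auto simp: P_def)
  have minimal: "D' = 0" if "degree D' < d" "eval2 to_ac y D' = 0" for D'
    using not_less_Least[of "degree D'" P] that by (auto simp: P_def d_def)
  have "0 < d"
  proof (rule ccontr)
    assume "\<not> 0 < d"
    then obtain c where c: "D = [:c:]" using D(2) by (metis degree_eq_zeroE neq0_conv)
    then show False using D by (simp add: ac.eval2_const)
  qed
  define v where "v = to_fract B / to_fract A"
  have v0: "v \<noteq> 0" using A0 B0 by (simp add: v_def)
  have yv: "y ^ n = to_ac v"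
    using y A0 by (simp add: v_def gen_def field_simps)
  define E where "E = monom 1 n - [:v:]"
  have poly_E: "eval2 to_ac z E = z ^ n - to_ac v" for z
    by (simp add: E_def ac.eval2_diff ac.eval2_monom ac.eval2_const)
  have ev_mult: "eval2 to_ac z (P * Q) = eval2 to_ac z P * eval2 to_ac z Q" for z and P Q :: "'a poly fract poly"
  proof -
    interpret ev: comm_ring_hom "eval2 to_ac z" by (rule ac.eval2_comm_ring_hom)
    show ?thesis by (rule ev.hom_mult)
  qed
  \<comment> \<open>\<open>D\<close> is a minimal polynomial of \<open>y\<close>, so it divides
    \<open>Y^n - v\<close>, and all its roots are \<open>n\<close>-th roots of
    \<open>v\<close>.\<close>
  have "E mod D = 0"
  proof (rule minimal)
    show "degree (E mod D) < d" using degree_mod_less[OF D(1), of E] D(2) \<open>0 < d\<close> by auto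
    have "E mod D = E - E div D * D" by (simp add: minus_div_mult_eq_mod)
    then show "eval2 to_ac y (E mod D) = 0"
      using D(3) poly_E[of y] yv by (simp only: ac.eval2_diff ev_mult) simp
  qed
  then obtain Q where Q: "E = D * Q" by (metis dvd_def mod_0_imp_dvd)
  define Dw where "Dw = map_poly to_ac D"
  have degDw: "degree Dw = d" unfolding Dw_def D(2)[symmetric] by (rule degree_map_poly) simp
  have Dw: "Dw \<noteq> 0" "lead_coeff Dw = to_ac (lead_coeff D)"
    using D degDw by (auto simp: Dw_def map_poly_eq_0_iff coeff_map_poly)
  obtain M where M: "size M = degree Dw" "Dw = smult (lead_coeff Dw) (\<Prod>x\<in>#M. [:- x, 1:])"
    using alg_closed_imp_factorization[OF Dw(1)] by blast
  have roots: "\<rho> ^ n = to_ac v" if "\<rho> \<in># M" for \<rho>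
  proof -
    have "poly Dw \<rho> = 0"
      using that by (subst M(2)) (auto simp: poly_prod_mset prod_mset_zero_iff)
    then have "eval2 to_ac \<rho> E = 0" unfolding Q ev_mult by (simp add: Dw_def eval2_def)
    then show ?thesis by (simp add: poly_E)
  qed
  have "(\<Prod>x\<in>#M'. - x) ^ n = ((-1) ^ n * to_ac v) ^ size M'" if "M' \<subseteq># M" for M'
    using that
  proof (induction M')
    case (add x M')
    have "(- x) ^ n = (-1) ^ n * to_ac v"
      using roots[of x] add.prems by (subst power_minus) (auto dest: mset_subset_eqD)
    moreover have "(\<Prod>x\<in>#M'. - x) ^ n = ((-1) ^ n * to_ac v) ^ size M'"
      using add by (metis mset_subset_eq_insertD subset_mset.less_imp_le)
    ultimately show ?case
      by (simp only: image_mset_add_mset prod_mset.add_mset power_mult_distrib[of "- x"] size_add_mset power_Suc)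
  qed simp
  from this[of M] have prodM: "(\<Prod>x\<in>#M. - x) ^ n = ((-1) ^ n * to_ac v) ^ d"
    using M(1) degDw by simp
  have "to_ac (coeff D 0) = poly Dw 0"
    by (simp add: Dw_def poly_0_coeff_0 coeff_map_poly)
  also have "\<dots> = to_ac (lead_coeff D) * (\<Prod>x\<in>#M. - x)"
    by (subst M(2)) (simp add: Dw(2) poly_prod_mset multiset.map_comp o_def)
  finally have "to_ac (coeff D 0 ^ n) = to_ac (lead_coeff D ^ n * ((-1) ^ n * v) ^ d)"
    by (simp add: power_mult_distrib[of _ _ n] prodM)
  then have "coeff D 0 ^ n = lead_coeff D ^ n * ((-1) ^ n * v) ^ d" by (simp only: to_ac_eq_iff)
  then have w: "(coeff D 0 / lead_coeff D) ^ n = ((-1) ^ n * v) ^ d"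
    using D(1) by (simp add: power_divide)
  obtain f1 f2 where f: "coeff D 0 / lead_coeff D = to_fract f1 / to_fract f2" "f2 \<noteq> 0"
    by (cases "coeff D 0 / lead_coeff D") (auto simp: Fract_conv_to_fract)
  have fA: "to_fract A \<noteq> 0" "to_fract f2 \<noteq> 0" using A0 f(2) by simp_all
  have "(to_fract f1) ^ n / (to_fract f2) ^ n = ((-1) ^ n) ^ d * ((to_fract B) ^ d / (to_fract A) ^ d)"
    using w unfolding f(1) v_def by (simp only: power_divide power_mult_distrib)
  then have "(to_fract f1) ^ n * (to_fract A) ^ d = ((-1) ^ n) ^ d * (to_fract f2) ^ n * (to_fract B) ^ d"
    using fA by (simp add: frac_eq_eq mult_ac)
  then have "to_fract (f1 ^ n * A ^ d) = to_fract (((-1) ^ n) ^ d * f2 ^ n * B ^ d)"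
    by (simp only: fr.hom_mult fr.hom_power fr.hom_uminus fr.hom_one)
  then have eq: "f1 ^ n * A ^ d = ((-1) ^ n) ^ d * f2 ^ n * B ^ d" by (simp only: to_fract_eq_iff)
  have "((-1) ^ n) ^ d * f2 ^ n * B ^ d \<noteq> 0" using f(2) B0 by simp
  then have "f1 \<noteq> 0" using eq n_pos by (auto simp: zero_power)
  have ordA: "Polynomial.order \<beta> A = 0" using \<beta>(3) by (rule order_0I)
  have "B1 \<noteq> 0" using B0 \<beta>(1) by auto
  have ordB: "Polynomial.order \<beta> B = 1"
  proof -
    have "Polynomial.order \<beta> B = Polynomial.order \<beta> [:- \<beta>, 1:] + Polynomial.order \<beta> B1"
      using B0 unfolding \<beta>(1) by (rule Polynomial.order_mult)
    then show ?thesis using order_0I[OF \<beta>(2)] order_power_n_n[of \<beta> 1] by simp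
  qed
  have ord_pow: "Polynomial.order \<beta> (f ^ m) = m * Polynomial.order \<beta> f" if "f \<noteq> 0" for f :: "'a poly" and m
    using that by (induction m) (simp_all add: Polynomial.order_mult)
  have "Polynomial.order \<beta> (f1 ^ n * A ^ d) = n * Polynomial.order \<beta> f1"
    using \<open>f1 \<noteq> 0\<close> A0 by (simp add: Polynomial.order_mult ord_pow ordA)
  moreover have "Polynomial.order \<beta> (((-1) ^ n) ^ d * f2 ^ n * B ^ d) = n * Polynomial.order \<beta> f2 + d"
    using f(2) B0 by (simp add: Polynomial.order_mult ord_pow ordB)
  ultimately have "n * Polynomial.order \<beta> f1 = n * Polynomial.order \<beta> f2 + d" using eq by simp
  then have "n dvd d" by (metis dvd_add_right_iff dvd_triv_left)
  then show False using \<open>0 < d\<close> \<open>d < n\<close> by (auto dest: dvd_imp_le)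
qed

text \<open>The transfer converse to \<open>vanish_extends\<close>. It rests on the fact that no
  nonzero polynomial of degree below \<open>n\<close> annihilates \<open>y\<close>, which amounts to
  irreducibility of the curve.\<close>

lemma generic_imp_points:
  assumes "eval2 gen y R = 0"
    and "B = [:- \<beta>, 1:] * B1" "poly B1 \<beta> \<noteq> 0" "poly A \<beta> \<noteq> 0"
    and "poly A x0 * y0 ^ n = poly B x0" "poly A x0 \<noteq> 0"
  shows "eval2 (\<lambda>f. poly f x0) y0 R = 0"
proof -
  obtain e q r where qr: "smult (A ^ e) R = (monom A n - [:B:]) * q + r" "r = 0 \<or> degree r < n"
    using pseudo_remainder[OF A0 n_pos] by blast
  have "r = 0"
    using remainder_zero_of_generic[OF qr(2) _ assms(2-4)] eval_gen_pseudo[OF qr(1)] assms(1) by simp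
  then show ?thesis
    using eval_point_pseudo[OF qr(1) assms(5)] assms(6) by (simp add: eval2_def)
qed

end

section \<open>Algebraic dependence of two functions on the curve\<close>

lemma underdetermined_system:
  fixes M :: "'i \<Rightarrow> 't \<Rightarrow> 'a::field"
  assumes "finite T" "finite I" "card T < card I"
  shows "\<exists>\<psi>. (\<exists>i\<in>I. \<psi> i \<noteq> 0) \<and> (\<forall>t\<in>T. (\<Sum>i\<in>I. \<psi> i * M i t) = 0)"
  using assms
proof (induction T arbitrary: I M rule: finite_induct)
  case empty
  then have "I \<noteq> {}" by auto
  then show ?case by (intro exI[of _ "\<lambda>_. 1"]) auto
next
  case (insert t T)
  show ?case
  proof (cases "\<forall>i\<in>I. M i t = 0")
    case True
    obtain \<psi> where "\<exists>i\<in>I. \<psi> i \<noteq> 0" "\<forall>t\<in>T. (\<Sum>i\<in>I. \<psi> i * M i t) = 0"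
      using insert.IH[of I M] insert.prems insert.hyps by auto
    then show ?thesis using True by (intro exI[of _ \<psi>]) auto
  next
    case False
    then obtain i0 where i0: "i0 \<in> I" "M i0 t \<noteq> 0" by blast
    define M' where "M' i s = M i s - M i t / M i0 t * M i0 s" for i s
    have "card T < card (I - {i0})" using insert i0 by auto
    then obtain \<psi> where \<psi>: "\<exists>i\<in>I - {i0}. \<psi> i \<noteq> 0" "\<forall>s\<in>T. (\<Sum>i\<in>I - {i0}. \<psi> i * M' i s) = 0"
      using insert.IH[of "I - {i0}" M'] insert.prems by auto
    define c where "c = - (\<Sum>i\<in>I - {i0}. \<psi> i * M i t) / M i0 t"
    define \<psi>' where "\<psi>' i = (if i = i0 then c else \<psi> i)" for i
    have sum_\<psi>': "(\<Sum>i\<in>I. \<psi>' i * M i s) = c * M i0 s + (\<Sum>i\<in>I - {i0}. \<psi> i * M i s)" for s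
      using insert.prems i0 by (subst sum.remove[of _ i0]) (auto simp: \<psi>'_def intro!: sum.cong)
    have "(\<Sum>i\<in>I. \<psi>' i * M i s) = 0" if s: "s \<in> insert t T" for s
    proof (cases "s = t")
      case True
      then show ?thesis unfolding sum_\<psi>' using i0 by (simp add: c_def)
    next
      case False
      then have "0 = (\<Sum>i\<in>I - {i0}. \<psi> i * M' i s)" using s \<psi>(2) by simp
      also have "\<dots> = (\<Sum>i\<in>I - {i0}. \<psi> i * M i s - \<psi> i * M i t * (M i0 s / M i0 t))"
        by (intro sum.cong) (simp_all add: M'_def right_diff_distrib)
      also have "\<dots> = (\<Sum>i\<in>I - {i0}. \<psi> i * M i s) + c * M i0 s"
        by (simp only: sum_subtractf sum_distrib_right[symmetric]) (simp add: c_def)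
      finally show ?thesis unfolding sum_\<psi>' by (simp add: add.commute)
    qed
    moreover have "\<exists>i\<in>I. \<psi>' i \<noteq> 0" using \<psi>(1) by (auto simp: \<psi>'_def)
    ultimately show ?thesis by blast
  qed
qed

lemma con_hom: "comm_ring_hom (\<lambda>c. gen [:c:])"
proof -
  interpret gen: comm_ring_hom gen by (rule gen_hom)
  show ?thesis
  proof
    show "gen [:c * d:] = gen [:c:] * gen [:d:]" for c d :: 'a
    proof -
      have "[:c * d:] = [:c:] * [:d:]" by (simp add: mult.commute)
      then show ?thesis by (simp only: gen.hom_mult)
    qed
  qed (simp_all flip: gen.hom_add one_pCons)
qed

context superelliptic
begin

abbreviation (input) con :: "'a \<Rightarrow> 'a poly fract alg_closure" where "con c \<equiv> gen [:c:]"

definition bipoly :: "nat \<Rightarrow> 'a poly fract alg_closure set" where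
  "bipoly e = {eval2 gen y R | R. degree R \<le> e \<and> (\<forall>j. degree (coeff R j) \<le> e)}"

lemma bipoly_mult:
  assumes "u \<in> bipoly e" "w \<in> bipoly e'"
  shows "u * w \<in> bipoly (e + e')"
proof -
  obtain R R' where R: "u = eval2 gen y R" "degree R \<le> e" "\<And>j. degree (coeff R j) \<le> e"
    and R': "w = eval2 gen y R'" "degree R' \<le> e'" "\<And>j. degree (coeff R' j) \<le> e'"
    using assms by (auto simp: bipoly_def)
  interpret gen: comm_ring_hom gen by (rule gen_hom)
  interpret con: comm_ring_hom con by (rule con_hom)
  interpret ev: comm_ring_hom "eval2 gen y" by (rule gen.eval2_comm_ring_hom)
  have "degree (coeff (R * R') j) \<le> e + e'" for j
    unfolding coeff_mult
    by (intro degree_sum_le) (auto intro!: order.trans[OF degree_mult_le] add_mono R R')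
  moreover have "degree (R * R') \<le> e + e'"
    using order.trans[OF degree_mult_le] R(2) R'(2) by (metis add_mono)
  ultimately show ?thesis unfolding R R' bipoly_def by (auto simp: ev.hom_mult intro!: exI[of _ "R * R'"])
qed

lemma bipoly_1: "1 \<in> bipoly 0"
proof -
  interpret gen: comm_ring_hom gen by (rule gen_hom)
  interpret con: comm_ring_hom con by (rule con_hom)
  interpret ev: comm_ring_hom "eval2 gen y" by (rule gen.eval2_comm_ring_hom)
  show ?thesis unfolding bipoly_def
    by (auto intro!: exI[of _ 1] simp: ev.hom_one coeff_1)
qed

lemma bipoly_power: "u \<in> bipoly e \<Longrightarrow> u ^ m \<in> bipoly (m * e)"
  by (induction m) (use bipoly_1 in \<open>auto intro: bipoly_mult\<close>)

lemma bipoly_mono: "e \<le> e' \<Longrightarrow> bipoly e \<subseteq> bipoly e'"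
  unfolding bipoly_def by (blast intro: order.trans)

text \<open>The relation \<open>A y^n = B\<close> brings powers of \<open>y\<close> below
  \<open>n\<close> at the price of a factor \<open>A ^ e\<close> and a larger degree in X. Thus
  \<open>bipoly e\<close> lands in a space spanned by a number of monomials that is linear in
  \<open>e\<close>.\<close>

lemma bipoly_reduce:
  assumes "u \<in> bipoly e" "degree A \<le> m" "degree B \<le> m"
  obtains M where "gen A ^ e * u = (\<Sum>(r, t)\<in>{..<n} \<times> {..e + e * m}. con (M r t) * (gen [:0, 1:] ^ t * y ^ r))"
proof -
  interpret gen: comm_ring_hom gen by (rule gen_hom)
  interpret con: comm_ring_hom con by (rule con_hom)
  obtain R where R: "u = eval2 gen y R" "degree R \<le> e" "\<And>j. degree (coeff R j) \<le> e"
    using assms by (auto simp: bipoly_def)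
  define p where "p j = coeff R j * (A ^ (e - j div n) * B ^ (j div n))" for j
  have degp: "degree (p j) \<le> e + e * m" if "j \<le> e" for j
  proof -
    have q: "j div n \<le> e" using that by (metis div_le_dividend le_trans)
    have "degree (p j) \<le> degree (coeff R j) + (degree (A ^ (e - j div n)) + degree (B ^ (j div n)))"
      unfolding p_def by (intro order.trans[OF degree_mult_le] add_left_mono degree_mult_le)
    also have "\<dots> \<le> e + (degree A * (e - j div n) + degree B * (j div n))"
      by (intro add_mono R degree_power_le)
    also have "\<dots> \<le> e + (m * (e - j div n) + m * (j div n))"
      using assms by (intro add_mono mult_le_mono) auto
    also have "\<dots> = e + e * m" using q by (simp add: mult.commute flip: add_mult_distrib2)
    finally show ?thesis .
  qed
  have red: "gen A ^ e * (gen (coeff R j) * y ^ j) = gen (p j) * y ^ (j mod n)" if "j \<le> e" for j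
  proof -
    define q where "q = j div n"
    have q: "q \<le> e" unfolding q_def using that by (metis div_le_dividend le_trans)
    have "y ^ j = (y ^ n) ^ q * y ^ (j mod n)"
      unfolding q_def by (metis div_mult_mod_eq mult.commute power_add power_mult)
    moreover have "gen A ^ e = gen A ^ (e - q) * gen A ^ q"
      using q by (simp flip: power_add)
    ultimately have "gen A ^ e * (gen (coeff R j) * y ^ j)
        = gen (coeff R j) * (gen A ^ (e - q) * (gen A * y ^ n) ^ q) * y ^ (j mod n)"
      by (simp add: power_mult_distrib mult_ac)
    also have "\<dots> = gen (p j) * y ^ (j mod n)"
      unfolding y p_def q_def by (simp add: gen.hom_mult gen.hom_power)
    finally show ?thesis .
  qed
  define M where "M r t = (\<Sum>j\<in>{j. j \<le> e \<and> j mod n = r}. coeff (p j) t)" for r t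
  have gen_exp: "gen f = (\<Sum>t\<le>N. con (coeff f t) * gen [:0, 1:] ^ t)" if "degree f \<le> N" for f N
  proof -
    have "f = (\<Sum>t\<le>N. [:coeff f t:] * [:0, 1:] ^ t)"
      using poly_as_sum_of_monoms'[OF that] by (simp add: monom_altdef)
    then have "gen f = gen (\<Sum>t\<le>N. [:coeff f t:] * [:0, 1:] ^ t)" by simp
    then show ?thesis by (simp only: gen.hom_sum gen.hom_mult gen.hom_power)
  qed
  have "u = (\<Sum>j\<le>e. gen (coeff R j) * y ^ j)"
  proof -
    have "degree (map_poly gen R) \<le> e"
      by (rule degree_le) (use R(2) in \<open>simp add: coeff_map_poly coeff_eq_0\<close>)
    then have "eval2 gen y R = (\<Sum>j\<le>e. coeff (map_poly gen R) j * y ^ j)"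
      unfolding eval2_def poly_altdef by (intro sum.mono_neutral_left) (auto intro!: le_degree simp: coeff_map_poly)
    then show ?thesis by (simp add: R(1) coeff_map_poly)
  qed
  then have "gen A ^ e * u = (\<Sum>j\<le>e. gen (p j) * y ^ (j mod n))"
    by (simp add: sum_distrib_left red)
  also have "\<dots> = (\<Sum>r<n. \<Sum>j\<in>{j\<in>{..e}. j mod n = r}. gen (p j) * y ^ (j mod n))"
    using n_pos by (intro sum.group[symmetric]) auto
  also have "\<dots> = (\<Sum>r<n. \<Sum>t\<le>e + e * m. con (M r t) * (gen [:0, 1:] ^ t * y ^ r))"
  proof (rule sum.cong[OF refl])
    fix r
    have "(\<Sum>j\<in>{j\<in>{..e}. j mod n = r}. gen (p j) * y ^ (j mod n))
        = (\<Sum>j\<in>{j. j \<le> e \<and> j mod n = r}. \<Sum>t\<le>e + e * m. con (coeff (p j) t) * (gen [:0, 1:] ^ t * y ^ r))"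
      by (intro sum.cong) (auto simp: gen_exp[OF degp] sum_distrib_right mult.assoc)
    also have "\<dots> = (\<Sum>t\<le>e + e * m. \<Sum>j\<in>{j. j \<le> e \<and> j mod n = r}. con (coeff (p j) t) * (gen [:0, 1:] ^ t * y ^ r))"
      by (rule sum.swap)
    also have "\<dots> = (\<Sum>t\<le>e + e * m. con (M r t) * (gen [:0, 1:] ^ t * y ^ r))"
    proof -
      have "con (M r t) = (\<Sum>j\<in>{j. j \<le> e \<and> j mod n = r}. con (coeff (p j) t))" for t
        unfolding M_def by (rule con.hom_sum)
      then show ?thesis by (simp add: sum_distrib_right)
    qed
    finally show "(\<Sum>j\<in>{j\<in>{..e}. j mod n = r}. gen (p j) * y ^ (j mod n))
        = (\<Sum>t\<le>e + e * m. con (M r t) * (gen [:0, 1:] ^ t * y ^ r))" .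
  qed
  finally show thesis using that by (simp add: sum.cartesian_product)
qed

text \<open>A dimension count: with denominators cleared, the \<open>(D + 1)^2\<close> products of
  powers lie in a space whose dimension is linear in their degree.\<close>

lemma algebraically_dependent:
  assumes uw: "u1 \<in> bipoly d" "u2 \<in> bipoly d" "w1 \<in> bipoly d" "w2 \<in> bipoly d" "u2 \<noteq> 0" "w2 \<noteq> 0"
  obtains D \<psi> where "\<exists>i\<le>D. \<exists>j\<le>D. \<psi> i j \<noteq> 0"
    "(\<Sum>i\<le>D. \<Sum>j\<le>D. con (\<psi> i j) * ((u1 / u2) ^ i * (w1 / w2) ^ j)) = 0"
proof -
  interpret gen: comm_ring_hom gen by (rule gen_hom)
  interpret con: comm_ring_hom con by (rule con_hom)
  define m where "m = max (degree A) (degree B)"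
  \<comment> \<open>This \<open>D\<close> makes the dimension \<open>n (2 d D (1 + m) + 1)\<close>
    at most \<open>D * D\<close>.\<close>
  define D where "D = n * (2 * d * (1 + m) + 1)"
  define e where "e = D * d + D * d"
  define T where "T = {..<n} \<times> {..e + e * m}"
  define F where "F i j = u1 ^ i * u2 ^ (D - i) * (w1 ^ j * w2 ^ (D - j))" for i j
  have "F i j \<in> bipoly e" if "i \<le> D" "j \<le> D" for i j
  proof -
    have pow2: "f ^ i * g ^ (D - i) \<in> bipoly (D * d)" if "f \<in> bipoly d" "g \<in> bipoly d" "i \<le> D" for f g i
    proof -
      have "f ^ i * g ^ (D - i) \<in> bipoly (i * d + (D - i) * d)"
        using that by (intro bipoly_mult bipoly_power)
      then show ?thesis using that(3) by (simp flip: add_mult_distrib)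
    qed
    show ?thesis unfolding F_def e_def using that uw by (intro bipoly_mult pow2)
  qed
  then have "\<exists>M. gen A ^ e * F i j = (\<Sum>(r, t)\<in>T. con (M r t) * (gen [:0, 1:] ^ t * y ^ r))"
    if "i \<le> D" "j \<le> D" for i j
    using bipoly_reduce[of "F i j" e m] that unfolding T_def by (metis m_def max.cobounded1 max.cobounded2)
  note ex_M = this
  define M where "M i j = (SOME M. gen A ^ e * F i j = (\<Sum>(r, t)\<in>T. con (M r t) * (gen [:0, 1:] ^ t * y ^ r)))" for i j
  have M: "gen A ^ e * F i j = (\<Sum>(r, t)\<in>T. con (M i j r t) * (gen [:0, 1:] ^ t * y ^ r))"
    if "i \<le> D" "j \<le> D" for i j
    unfolding M_def by (rule someI_ex[OF ex_M[OF that]])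
  define I where "I = {..D} \<times> {..D}"
  have "0 < D" using n_pos by (simp add: D_def)
  have "card T = n * (e + e * m + 1)" by (simp add: T_def)
  also have "e + e * m + 1 = D * (2 * d * (1 + m)) + 1" by (simp add: e_def algebra_simps)
  also have "\<dots> \<le> D * (2 * d * (1 + m) + 1)" using \<open>0 < D\<close> by (simp add: add_mult_distrib2)
  finally have "card T \<le> n * (D * (2 * d * (1 + m) + 1))" by simp
  also have "\<dots> = D * (n * (2 * d * (1 + m) + 1))" by (simp only: mult_ac)
  also have "\<dots> = D * D" by (simp only: D_def)
  also have "\<dots> < card I" by (simp add: I_def)
  finally have "card T < card I" .
  then obtain \<psi> where \<psi>: "\<exists>i\<in>I. \<psi> i \<noteq> 0"
    "\<forall>t\<in>T. (\<Sum>i\<in>I. \<psi> i * (case i of (i, j) \<Rightarrow> \<lambda>(r, t). M i j r t) t) = 0"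
    using underdetermined_system[of T I "\<lambda>(i, j) (r, t). M i j r t"] by (auto simp: T_def I_def)
  define S where "S = (\<Sum>i\<le>D. \<Sum>j\<le>D. con (\<psi> (i, j)) * ((u1 / u2) ^ i * (w1 / w2) ^ j))"
  have F_eq: "F i j = (u2 * w2) ^ D * ((u1 / u2) ^ i * (w1 / w2) ^ j)" if "i \<le> D" "j \<le> D" for i j
  proof -
    have "u2 ^ D = u2 ^ (D - i) * u2 ^ i" "w2 ^ D = w2 ^ (D - j) * w2 ^ j"
      using that by (simp_all flip: power_add)
    then show ?thesis
      using uw(5,6) by (simp add: F_def power_mult_distrib power_divide)
  qed
  have "gen A ^ e * (u2 * w2) ^ D * S = (\<Sum>i\<le>D. \<Sum>j\<le>D. con (\<psi> (i, j)) * (gen A ^ e * F i j))"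
    unfolding S_def sum_distrib_left by (intro sum.cong refl) (simp add: F_eq mult_ac)
  also have "\<dots> = (\<Sum>(i, j)\<in>I. con (\<psi> (i, j)) * (\<Sum>(r, t)\<in>T. con (M i j r t) * (gen [:0, 1:] ^ t * y ^ r)))"
    unfolding I_def sum.cartesian_product[symmetric] by (intro sum.cong refl) (simp add: M)
  also have "\<dots> = (\<Sum>(i, j)\<in>I. \<Sum>(r, t)\<in>T. con (\<psi> (i, j) * M i j r t) * (gen [:0, 1:] ^ t * y ^ r))"
    by (intro sum.cong refl)
      (auto simp: sum_distrib_left mult.assoc con.hom_mult intro!: sum.cong)
  also have "\<dots> = (\<Sum>(r, t)\<in>T. \<Sum>(i, j)\<in>I. con (\<psi> (i, j) * M i j r t) * (gen [:0, 1:] ^ t * y ^ r))"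
    unfolding split_def by (rule sum.swap)
  also have "\<dots> = (\<Sum>(r, t)\<in>T. con (\<Sum>(i, j)\<in>I. \<psi> (i, j) * M i j r t) * (gen [:0, 1:] ^ t * y ^ r))"
  proof -
    have "con (sum f I) = (\<Sum>i\<in>I. con (f i))" for f
      by (rule con.hom_sum)
    then show ?thesis by (simp add: split_def sum_distrib_right)
  qed
  also have "\<dots> = 0"
    using \<psi>(2) by (intro sum.neutral) (auto simp: split_def)
  finally have "S = 0" using uw(5,6) A0 by simp
  moreover have "\<exists>i\<le>D. \<exists>j\<le>D. \<psi> (i, j) \<noteq> 0" using \<psi>(1) by (auto simp: I_def)
  ultimately show thesis using that[of D "\<lambda>i j. \<psi> (i, j)"] by (simp add: S_def)
qed

end

section \<open>The curve, its generic point and its points at infinity\<close>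

definition form_G :: "nat \<Rightarrow> 'a::comm_ring_1 \<Rightarrow> 'a \<Rightarrow> 'a ^ 3 \<Rightarrow> 'a" where
  "form_G n a b v = a * (v $ 1) ^ n * (v $ 2) ^ n - (v $ 1) ^ n * (v $ 3) ^ n
     - (v $ 2) ^ n * (v $ 3) ^ n + b * (v $ 3) ^ (2 * n)"

lemma (in comm_ring_hom) eval2_eval_along:
  fixes P :: "('n::finite \<Rightarrow>\<^sub>0 nat) \<Rightarrow>\<^sub>0 'c::comm_ring_1"
  shows "eval2 hom z (eval_along h P v) = eval_along (\<lambda>c. eval2 hom z (h c)) P (\<chi> i. eval2 hom z (v $ i))"
  by (rule comm_ring_hom.hom_eval_along[OF eval2_comm_ring_hom])

lemma vector_3_map: "(\<chi> i. f ((vector [u, v, w] :: 'a::zero ^ 3) $ i)) = (vector [f u, f v, f w] :: 'b::zero ^ 3)"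
  by (simp add: Finite_Cartesian_Product.vec_eq_iff forall_3 vector_3)

lemma poly_hom_at: "comm_ring_hom (\<lambda>f. poly f (x0 :: 'a::comm_ring_1))"
  by unfold_locales simp_all

text \<open>Solved for the \<open>n\<close>-th power of \<open>Y\<close>, the equation of the curve
  is superelliptic, with numerator \<open>X^n - b\<close> and denominator
  \<open>a X^n - 1\<close>.\<close>

locale curve_chart =
  fixes n :: nat and a b :: "'a::alg_closed_field" and y :: "'a poly fract alg_closure"
  assumes n: "of_nat n \<noteq> (0::'a)" and ab0: "a * b \<noteq> 0" and ab1: "a * b \<noteq> 1"
    and y: "gen (monom a n - 1) * y ^ n = gen (monom 1 n - [:b:])"
begin

lemma ab_nonzero: "a \<noteq> 0" "b \<noteq> 0" using ab0 by auto

lemma n_pos: "0 < n" using n by (cases n) auto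

lemma coeff_n: "coeff (monom a n - 1) n = a" "coeff (monom 1 n - [:b:]) n = 1"
  using n_pos by (auto simp: coeff_pCons coeff_1 split: nat.split)

sublocale superelliptic "monom a n - 1" "monom 1 n - [:b:]" n y
proof
  show "monom a n - 1 \<noteq> 0" "monom 1 n - [:b:] \<noteq> 0"
    using coeff_n ab_nonzero by (metis coeff_0, metis coeff_0 zero_neq_one)
qed (use n y in auto)

abbreviation x where "x \<equiv> gen ([:0, 1:] :: 'a poly)"

lemma x_power: "gen (monom c n) = con c * x ^ n" for c
proof -
  interpret gen: comm_ring_hom "gen :: 'a poly \<Rightarrow> _" by (rule gen_hom)
  have "monom c n = [:c:] * [:0, 1:] ^ n" by (simp add: monom_altdef)
  then show ?thesis by (simp only: gen.hom_mult gen.hom_power)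
qed

lemma generic_point_on_curve: "con a * x ^ n * y ^ n - x ^ n - y ^ n + con b = 0"
proof -
  interpret gen: comm_ring_hom "gen :: 'a poly \<Rightarrow> _" by (rule gen_hom)
  show ?thesis
    using y by (simp add: gen.hom_minus x_power one_pCons[symmetric] algebra_simps)
qed

lemma affine_iff:
  "poly (monom a n - 1) x0 * y0 ^ n = poly (monom 1 n - [:b:]) x0 \<longleftrightarrow> form_G n a b (vector [x0, y0, 1]) = 0"
  by (auto simp: form_G_def vector_3 poly_monom algebra_simps)

lemma affine_denominator:
  assumes "form_G n a b (vector [x0, y0, 1]) = 0"
  shows "poly (monom a n - 1) x0 \<noteq> 0"
proof
  assume 0: "poly (monom a n - 1) x0 = 0"
  then have "poly (monom 1 n - [:b:]) x0 = 0" using assms by (simp flip: affine_iff)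
  then have "a * b = 1" using 0 by (simp add: poly_monom)
  then show False using ab1 by simp
qed

definition affine_lift :: "((3 \<Rightarrow>\<^sub>0 nat) \<Rightarrow>\<^sub>0 'a) \<Rightarrow> 'a poly poly" where
  "affine_lift P = eval_along (\<lambda>c. [:[:c:]:]) P (vector [[:[:0, 1:]:], [:0, 1:], 1])"

lemma eval_affine_lift:
  "eval2 (\<lambda>f. poly f x0) y0 (affine_lift P) = eval_along (\<lambda>c. c) P (vector [x0, y0, 1])"
  "eval2 gen y (affine_lift P) = eval_along con P (vector [x, y, 1])"
proof -
  have *: "eval2 h z (affine_lift P) = eval_along (\<lambda>c. h [:c:]) P (vector [h [:0, 1:], z, 1])"
    if h: "comm_ring_hom h" for h :: "'a poly \<Rightarrow> 'c::comm_ring_1" and z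
  proof -
    interpret h: comm_ring_hom h by (rule h)
    interpret ev: comm_ring_hom "eval2 h z" by (rule h.eval2_comm_ring_hom)
    have "eval2 h z [:0, 1:] = z"
      using h.eval2_monom[of z 1 1] by (simp add: monom_altdef h.hom_one)
    then show ?thesis
      unfolding affine_lift_def h.eval2_eval_along h.eval2_const vector_3_map by (simp add: ev.hom_one)
  qed
  show "eval2 (\<lambda>f. poly f x0) y0 (affine_lift P) = eval_along (\<lambda>c. c) P (vector [x0, y0, 1])"
    by (subst *[OF poly_hom_at]) simp
  show "eval2 gen y (affine_lift P) = eval_along con P (vector [x, y, 1])"
    by (rule *[OF gen_hom])
qed

lemma generic_vanishI:
  fixes P :: "(3 \<Rightarrow>\<^sub>0 nat) \<Rightarrow>\<^sub>0 'a"
  assumes "\<And>v. form_G n a b v = 0 \<Longrightarrow> eval_along (\<lambda>c. c) P v = 0"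
  shows "eval_along con P (vector [x, y, 1]) = 0"
proof -
  have "eval2 gen y (affine_lift P) = 0"
  proof (rule vanish_extends(1)[of "{}"])
    fix x0 y0 assume "poly (monom a n - 1) x0 * y0 ^ n = poly (monom 1 n - [:b:]) x0"
    then show "eval2 (\<lambda>f. poly f x0) y0 (affine_lift P) = 0"
      unfolding affine_iff eval_affine_lift by (rule assms)
  qed simp
  then show ?thesis unfolding eval_affine_lift .
qed

text \<open>A root \<open>\<beta>\<close> of \<open>X^n = b\<close> is a simple zero of the
  numerator since \<open>n\<close> and \<open>b\<close> are nonzero in the field, and the
  denominator there is \<open>a b - 1\<close>, which is not 0. So the valuation criterion of
  \<open>generic_imp_points\<close> applies.\<close>

lemma generic_vanish_affine:
  fixes P :: "(3 \<Rightarrow>\<^sub>0 nat) \<Rightarrow>\<^sub>0 'a"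
  assumes P: "eval_along con P (vector [x, y, 1]) = 0" and v: "form_G n a b (vector [x0, y0, 1]) = 0"
  shows "eval_along (\<lambda>c. c) P (vector [x0, y0, 1]) = 0"
proof -
  obtain \<beta> where \<beta>: "\<beta> ^ n = b" using nth_root_exists[of n b] n_pos by blast
  have "poly (monom 1 n - [:b:]) \<beta> = 0" using \<beta> by (simp add: poly_monom)
  then obtain B1 where B1: "monom 1 n - [:b:] = [:- \<beta>, 1:] * B1"
    by (meson dvdE poly_eq_0_iff_dvd)
  have "\<beta> \<noteq> 0" using \<beta> ab_nonzero n_pos by (auto simp: zero_power)
  have "poly (pderiv (L * S)) \<beta> = poly (pderiv L) \<beta> * poly S \<beta>" if "poly L \<beta> = 0" for L S :: "'a poly"
    using that by (simp add: pderiv_mult)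
  from this[of "[:- \<beta>, 1:]" B1] have "poly (pderiv (monom 1 n - [:b:])) \<beta> = poly B1 \<beta>"
    unfolding B1 by (simp add: pderiv_pCons)
  then have "poly B1 \<beta> = of_nat n * \<beta> ^ (n - 1)"
    by (simp add: pderiv_diff pderiv_monom pderiv_pCons poly_monom)
  then have "poly B1 \<beta> \<noteq> 0" using n \<open>\<beta> \<noteq> 0\<close> by simp
  moreover have "poly (monom a n - 1) \<beta> \<noteq> 0" using ab1 by (simp add: poly_monom \<beta>)
  moreover have "eval2 gen y (affine_lift P) = 0" unfolding eval_affine_lift by (rule P)
  moreover have "poly (monom a n - 1) x0 * y0 ^ n = poly (monom 1 n - [:b:]) x0"
    unfolding affine_iff by (rule v)
  ultimately have "eval2 (\<lambda>f. poly f x0) y0 (affine_lift P) = 0"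
    using generic_imp_points[OF _ B1] affine_denominator[OF v] by blast
  then show ?thesis unfolding eval_affine_lift .
qed

text \<open>In the chart \<open>X = 1 / s\<close> the curve is again superelliptic,
  \<open>(a - s^n) z^n = 1 - b s^n\<close>, and vanishing for \<open>s \<noteq> 0\<close> extends to
  \<open>s = 0\<close>. The second alternative for \<open>w\<close> exchanges the coordinates, in
  which the equation is symmetric.\<close>

lemma vanish_at_infinity:
  fixes P :: "(3 \<Rightarrow>\<^sub>0 nat) \<Rightarrow>\<^sub>0 'a"
  assumes scale: "\<And>t v. eval_along (\<lambda>c. c) P (\<chi> i. t * v $ i) = t ^ e * eval_along (\<lambda>c. c) P v"
    and aff: "\<And>x0 y0. form_G n a b (vector [x0, y0, 1]) = 0 \<Longrightarrow> eval_along (\<lambda>c. c) P (vector [x0, y0, 1]) = 0"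
    and w: "(w = (\<lambda>s z. vector [1, s * z, s])) \<or> (w = (\<lambda>s z. vector [s * z, 1, s]))"
  shows "eval_along (\<lambda>c. c) P (w 0 z) = 0"
proof -
  define A2 B2 where "A2 = [:a:] - monom 1 n" and "B2 = 1 - monom b n"
  have co: "coeff A2 n = -1" "coeff B2 n = - b"
    using n_pos by (auto simp: A2_def B2_def coeff_pCons coeff_1 split: nat.split)
  have nz: "A2 \<noteq> 0" "B2 \<noteq> 0"
    using co ab_nonzero by (metis coeff_0 neg_equal_0_iff_equal one_neq_zero, metis coeff_0 neg_equal_0_iff_equal)
  obtain y2 where "y2 ^ n = gen B2 / gen A2" using ex_nth_root_gen[OF n_pos] by blast
  then have y2: "gen A2 * y2 ^ n = gen B2" using nz by simp
  interpret inf: superelliptic A2 B2 n y2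
    by unfold_locales (use nz n y2 in auto)
  define W :: "'a poly poly ^ 3" where
    "W = (if w = (\<lambda>s z. vector [1, s * z, s]) then vector [1, [:0, [:0, 1:]:], [:[:0, 1:]:]]
          else vector [[:0, [:0, 1:]:], 1, [:[:0, 1:]:]])"
  define R where "R = eval_along (\<lambda>c. [:[:c:]:]) P W"
  have ev_R: "eval2 (\<lambda>f. poly f s) z R = eval_along (\<lambda>c. c) P (w s z)" for s z
  proof -
    interpret ev: comm_ring_hom "eval2 (\<lambda>f. poly f s) z"
      by (rule comm_ring_hom.eval2_comm_ring_hom[OF poly_hom_at])
    have "eval2 (\<lambda>f. poly f s) z [:0, [:0, 1:]:] = s * z"
      using comm_ring_hom.eval2_monom[OF poly_hom_at, of s z "[:0, 1:]" 1] by (simp add: monom_altdef)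
    then show ?thesis
      using w unfolding R_def W_def comm_ring_hom.eval2_eval_along[OF poly_hom_at]
      by (auto simp: comm_ring_hom.eval2_const[OF poly_hom_at] vector_3_map ev.hom_one)
  qed
  \<comment> \<open>At \<open>s = 0\<close> the vector \<open>w 0 z\<close> does not depend on
    \<open>z\<close>, so one solution \<open>z0\<close> over \<open>s = 0\<close> is enough.\<close>
  obtain z0 where z0: "z0 ^ n = 1 / a" using nth_root_exists[of n "1 / a"] n_pos by blast
  have "eval2 (\<lambda>f. poly f 0) z0 R = 0"
  proof (rule inf.vanish_extends(2)[of "{0}"])
    fix s z' assume s: "s \<notin> {0}" "poly A2 s * z' ^ n = poly B2 s"
    have eq: "(a - s ^ n) * z' ^ n = 1 - b * s ^ n" using s(2) by (simp add: A2_def B2_def poly_monom)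
    have aff1: "form_G n a b (vector [1 / s, z', 1]) = 0" "form_G n a b (vector [z', 1 / s, 1]) = 0"
    proof -
      have "s ^ n * (a * (1 / s) ^ n * z' ^ n - (1 / s) ^ n - z' ^ n + b) = (a - s ^ n) * z' ^ n - (1 - b * s ^ n)"
        using s by (simp add: power_one_over algebra_simps)
      then have "a * (1 / s) ^ n * z' ^ n - (1 / s) ^ n - z' ^ n + b = 0"
        using s eq by (metis insertI1 mult_eq_0_iff power_not_zero right_minus_eq singletonI)
      then show "form_G n a b (vector [1 / s, z', 1]) = 0" "form_G n a b (vector [z', 1 / s, 1]) = 0"
        by (simp_all add: form_G_def vector_3 algebra_simps)
    qed
    have "w s z' = (\<chi> i. s * vector [1 / s, z', 1] $ i) \<or> w s z' = (\<chi> i. s * vector [z', 1 / s, 1] $ i)"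
      using w s(1) by (auto simp: Finite_Cartesian_Product.vec_eq_iff forall_3 vector_3)
    then show "eval2 (\<lambda>f. poly f s) z' R = 0"
      unfolding ev_R using aff[OF aff1(1)] aff[OF aff1(2)] by (auto simp: scale)
  qed (use z0 ab_nonzero n_pos in \<open>auto simp: A2_def B2_def poly_monom zero_power\<close>)
  then have "eval_along (\<lambda>c. c) P (w 0 z0) = 0" unfolding ev_R .
  moreover have "w 0 z0 = w 0 z" using w by auto
  ultimately show ?thesis by simp
qed

text \<open>With third coordinate 0 the equation reads \<open>a X^n Y^n = 0\<close>, so besides
  affine points only (1:0:0) and (0:1:0) occur.\<close>

lemma generic_vanishD:
  fixes P :: "(3 \<Rightarrow>\<^sub>0 nat) \<Rightarrow>\<^sub>0 'a"
  assumes scale: "\<And>t v. eval_along (\<lambda>c. c) P (\<chi> i. t * v $ i) = t ^ e * eval_along (\<lambda>c. c) P v"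
    and P: "eval_along con P (vector [x, y, 1]) = 0" and v: "form_G n a b v = 0"
  shows "eval_along (\<lambda>c. c) P v = 0"
proof -
  note aff = generic_vanish_affine[OF P]
  show ?thesis
  proof (cases "v $ 3 = 0")
    case False
    define v' :: "'a ^ 3" where "v' = vector [v $ 1 / v $ 3, v $ 2 / v $ 3, 1]"
    have vv': "v = (\<chi> i. v $ 3 * v' $ i)"
      using False by (simp add: Finite_Cartesian_Product.vec_eq_iff forall_3 vector_3 v'_def)
    have "form_G n a b v = (v $ 3) ^ (2 * n) * form_G n a b v'"
      using False by (simp add: form_G_def v'_def vector_3 power_divide power_mult power2_eq_square field_simps)
    then have "form_G n a b v' = 0" using v False by simp
    then have "eval_along (\<lambda>c. c) P v' = 0" unfolding v'_def by (rule aff)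
    then show ?thesis by (subst vv') (simp only: scale mult_zero_right)
  next
    case True
    have "a * ((v $ 1) ^ n * (v $ 2) ^ n) = 0"
      using v True n_pos by (simp add: form_G_def zero_power mult.assoc)
    then have "v $ 1 = 0 \<or> v $ 2 = 0" using ab_nonzero by auto
    then have "v = (\<chi> i. v $ 2 * vector [0 * 0, 1, 0] $ i) \<or> v = (\<chi> i. v $ 1 * vector [1, 0 * 0, 0] $ i)"
      using True by (auto simp: Finite_Cartesian_Product.vec_eq_iff forall_3 vector_3)
    moreover have "eval_along (\<lambda>c. c) P (vector [1, 0 * 0, 0]) = 0" "eval_along (\<lambda>c. c) P (vector [0 * 0, 1, 0]) = 0"
      using vanish_at_infinity[OF scale aff, of "\<lambda>s z. vector [1, s * z, s]" 0]
        vanish_at_infinity[OF scale aff, of "\<lambda>s z. vector [s * z, 1, s]" 0] by simp_all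
    ultimately show ?thesis by (metis scale mult_zero_right)
  qed
qed

end

section \<open>Rings of functions with a value at a point\<close>

text \<open>A local ring \<open>R\<close> in a field, with the constants as residue field:
  \<open>ev\<close> is the residue map on \<open>R\<close>, its kernel is the maximal ideal by
  \<open>inverse_in\<close>, and outside \<open>R\<close> its values are arbitrary.\<close>

locale local_alg =
  fixes R :: "'w::field set" and ev :: "'w \<Rightarrow> 'c::field" and \<iota> :: "'c \<Rightarrow> 'w"
  assumes \<iota>_hom: "comm_ring_hom \<iota>"
    and \<iota>_in [simp]: "\<iota> c \<in> R" and ev_\<iota> [simp]: "ev (\<iota> c) = c"
    and add_in: "f \<in> R \<Longrightarrow> g \<in> R \<Longrightarrow> f + g \<in> R"
    and ev_add: "f \<in> R \<Longrightarrow> g \<in> R \<Longrightarrow> ev (f + g) = ev f + ev g"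
    and mult_in: "f \<in> R \<Longrightarrow> g \<in> R \<Longrightarrow> f * g \<in> R"
    and ev_mult: "f \<in> R \<Longrightarrow> g \<in> R \<Longrightarrow> ev (f * g) = ev f * ev g"
    and inverse_in: "f \<in> R \<Longrightarrow> ev f \<noteq> 0 \<Longrightarrow> inverse f \<in> R"
begin

sublocale con: comm_ring_hom \<iota> by (rule \<iota>_hom)

lemma zero_in [simp]: "0 \<in> R" and ev_0 [simp]: "ev 0 = 0"
  using \<iota>_in[of 0] ev_\<iota>[of 0] by simp_all

lemma one_in [simp]: "1 \<in> R" and ev_1 [simp]: "ev 1 = 1"
  using \<iota>_in[of 1] ev_\<iota>[of 1] by simp_all

lemma minus_in: "f \<in> R \<Longrightarrow> - f \<in> R" and ev_minus: "f \<in> R \<Longrightarrow> ev (- f) = - ev f"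
proof -
  have *: "- f = \<iota> (- 1) * f" by (simp add: con.hom_uminus)
  show "f \<in> R \<Longrightarrow> - f \<in> R" unfolding * by (intro mult_in \<iota>_in)
  show "f \<in> R \<Longrightarrow> ev (- f) = - ev f" unfolding * by (simp only: ev_mult \<iota>_in ev_\<iota>) simp
qed

lemma diff_in: "f \<in> R \<Longrightarrow> g \<in> R \<Longrightarrow> f - g \<in> R"
  and ev_diff: "f \<in> R \<Longrightarrow> g \<in> R \<Longrightarrow> ev (f - g) = ev f - ev g"
  using add_in[of f "- g"] ev_add[of f "- g"] minus_in[of g] ev_minus[of g] by simp_all

lemma sum_in: "(\<And>s. s \<in> S \<Longrightarrow> f s \<in> R) \<Longrightarrow> sum f S \<in> R"
  by (induction S rule: infinite_finite_induct) (auto intro: add_in)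

lemma ev_sum: "(\<And>s. s \<in> S \<Longrightarrow> f s \<in> R) \<Longrightarrow> ev (sum f S) = (\<Sum>s\<in>S. ev (f s))"
  by (induction S rule: infinite_finite_induct) (auto simp: ev_add sum_in)

lemma prod_in: "(\<And>s. s \<in> S \<Longrightarrow> f s \<in> R) \<Longrightarrow> prod f S \<in> R"
  by (induction S rule: infinite_finite_induct) (auto intro: mult_in)

lemma ev_prod: "(\<And>s. s \<in> S \<Longrightarrow> f s \<in> R) \<Longrightarrow> ev (prod f S) = (\<Prod>s\<in>S. ev (f s))"
  by (induction S rule: infinite_finite_induct) (auto simp: ev_mult prod_in)

lemma power_in: "f \<in> R \<Longrightarrow> f ^ m \<in> R"
  by (induction m) (auto intro: mult_in)

lemma ev_power: "f \<in> R \<Longrightarrow> ev (f ^ m) = ev f ^ m"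
  by (induction m) (auto simp: ev_mult power_in)

lemma ev_inverse: "f \<in> R \<Longrightarrow> ev f \<noteq> 0 \<Longrightarrow> ev (inverse f) = inverse (ev f)"
proof -
  assume f: "f \<in> R" "ev f \<noteq> 0"
  then have "f \<noteq> 0" by auto
  then have "ev f * ev (inverse f) = 1" using ev_mult[OF f(1) inverse_in[OF f]] by simp
  then show ?thesis by (metis inverse_unique)
qed

lemma divide_in: "f \<in> R \<Longrightarrow> g \<in> R \<Longrightarrow> ev g \<noteq> 0 \<Longrightarrow> f / g \<in> R"
  by (simp add: divide_inverse mult_in inverse_in)

lemma ev_divide: "f \<in> R \<Longrightarrow> g \<in> R \<Longrightarrow> ev g \<noteq> 0 \<Longrightarrow> ev (f / g) = ev f / ev g"
  by (simp add: divide_inverse ev_mult inverse_in ev_inverse)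

text \<open>A relation between \<open>f\<close> and \<open>g\<close> survives cancelling powers of \<open>f\<close> and of \<open>g\<close>;
  after that, evaluation contradicts high divisibility of \<open>f\<close> by \<open>g\<close>.\<close>

lemma not_infinitely_divisible:
  assumes f: "f \<in> R" "f \<noteq> 0" and g: "g \<in> R" "ev g = 0"
    and nz: "\<exists>i\<le>D. \<exists>j\<le>D. \<psi> i j \<noteq> 0"
    and rel: "(\<Sum>i\<le>D. \<Sum>j\<le>D. \<iota> (\<psi> i j) * (f ^ i * g ^ j)) = 0"
  shows "\<exists>e. \<forall>h\<in>R. f \<noteq> g ^ e * h"
proof (rule ccontr)
  assume "\<not> ?thesis"
  then have div: "\<exists>h\<in>R. f = g ^ e * h" for e by blast
  \<comment> \<open>\<open>i1\<close> is the lowest power of \<open>f\<close> in the relation and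
    \<open>c\<close> the lowest power of \<open>g\<close> in its coefficient. As
    \<open>g ^ Suc c\<close> divides \<open>f\<close>, after division by
    \<open>f ^ i1 * g ^ c\<close> every term but the constant \<open>\<psi> i1 c\<close> lies in the
    maximal ideal.\<close>
  define i1 where "i1 = (LEAST i. \<exists>j\<le>D. i \<le> D \<and> \<psi> i j \<noteq> 0)"
  have "\<exists>j\<le>D. i1 \<le> D \<and> \<psi> i1 j \<noteq> 0"
    unfolding i1_def by (rule LeastI_ex) (use nz in blast)
  then have i1: "i1 \<le> D" "\<exists>j. j \<le> D \<and> \<psi> i1 j \<noteq> 0" by auto
  have i1_least: "\<psi> i j = 0" if "i < i1" "j \<le> D" for i j
    using not_less_Least[of i "\<lambda>i. \<exists>j\<le>D. i \<le> D \<and> \<psi> i j \<noteq> 0"] that i1(1) unfolding i1_def[symmetric] by auto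
  define c where "c = (LEAST j. j \<le> D \<and> \<psi> i1 j \<noteq> 0)"
  have c: "c \<le> D" "\<psi> i1 c \<noteq> 0" using LeastI_ex[OF i1(2)] by (simp_all add: c_def)
  have c_least: "\<psi> i1 j = 0" if "j < c" for j
    using not_less_Least[of j "\<lambda>j. j \<le> D \<and> \<psi> i1 j \<noteq> 0"] that c(1) unfolding c_def[symmetric] by auto
  define Y where "Y i = (\<Sum>j\<le>D. \<iota> (\<psi> i j) * g ^ j)" for i
  have Y: "Y i \<in> R" for i unfolding Y_def by (intro sum_in mult_in power_in g) simp
  obtain h where h: "h \<in> R" "f = g ^ Suc c * h" using div by blast
  have "g \<noteq> 0" using h f by auto
  have "0 = (\<Sum>i\<le>D. f ^ i * Y i)"
    using rel unfolding Y_def sum_distrib_left by (simp add: mult_ac)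
  also have "\<dots> = (\<Sum>i\<in>{i1..D}. f ^ i * Y i)"
    by (intro sum.mono_neutral_right) (auto simp: Y_def i1_least not_le)
  also have "\<dots> = f ^ i1 * (\<Sum>i\<in>{i1..D}. f ^ (i - i1) * Y i)"
    unfolding sum_distrib_left by (intro sum.cong refl) (auto simp: mult.assoc[symmetric] simp flip: power_add)
  finally have "(\<Sum>i\<in>{i1..D}. f ^ (i - i1) * Y i) = 0" using f by simp
  then have "Y i1 + (\<Sum>i\<in>{i1<..D}. f ^ (i - i1) * Y i) = 0"
    using i1(1) by (simp add: sum.head)
  also have "(\<Sum>i\<in>{i1<..D}. f ^ (i - i1) * Y i) = f * (\<Sum>i\<in>{i1<..D}. f ^ (i - i1 - 1) * Y i)"
  proof -
    have "f ^ (i - i1) = f * f ^ (i - i1 - 1)" if "i1 < i" for i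
      using less_imp_Suc_add[OF that] by auto
    then show ?thesis unfolding sum_distrib_left by (intro sum.cong refl) (simp add: mult.assoc)
  qed
  also have "Y i1 = (\<Sum>j\<in>{c..D}. \<iota> (\<psi> i1 j) * g ^ j)"
    unfolding Y_def by (intro sum.mono_neutral_right) (auto simp: c_least not_le)
  also have "\<dots> = g ^ c * \<iota> (\<psi> i1 c) + (\<Sum>j\<in>{c<..D}. \<iota> (\<psi> i1 j) * g ^ j)"
    using c(1) by (simp add: sum.head mult.commute)
  also have "(\<Sum>j\<in>{c<..D}. \<iota> (\<psi> i1 j) * g ^ j) = g ^ c * (g * (\<Sum>j\<in>{c<..D}. \<iota> (\<psi> i1 j) * g ^ (j - Suc c)))"
  proof -
    have "g ^ j = g ^ c * (g * g ^ (j - Suc c))" if "c < j" for j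
      using that by (simp flip: power_add power_Suc)
    then show ?thesis unfolding sum_distrib_left by (intro sum.cong refl) (simp add: mult_ac)
  qed
  finally have "g ^ c * (\<iota> (\<psi> i1 c) + g * ((\<Sum>j\<in>{c<..D}. \<iota> (\<psi> i1 j) * g ^ (j - Suc c))
      + h * (\<Sum>i\<in>{i1<..D}. f ^ (i - i1 - 1) * Y i))) = 0"
    by (subst (asm) h(2)) (simp add: algebra_simps)
  then have "\<iota> (\<psi> i1 c) + g * ((\<Sum>j\<in>{c<..D}. \<iota> (\<psi> i1 j) * g ^ (j - Suc c))
      + h * (\<Sum>i\<in>{i1<..D}. f ^ (i - i1 - 1) * Y i)) = 0"
    using \<open>g \<noteq> 0\<close> by simp
  moreover have Z: "(\<Sum>j\<in>{c<..D}. \<iota> (\<psi> i1 j) * g ^ (j - Suc c))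
      + h * (\<Sum>i\<in>{i1<..D}. f ^ (i - i1 - 1) * Y i) \<in> R"
    by (intro add_in mult_in sum_in power_in f g h Y) simp
  ultimately have "\<exists>Z\<in>R. \<iota> (\<psi> i1 c) + g * Z = 0" by blast
  then obtain Z where Z': "Z \<in> R" "\<iota> (\<psi> i1 c) + g * Z = 0" by blast
  have "\<psi> i1 c = ev (\<iota> (\<psi> i1 c) + g * Z)"
    using ev_add[OF \<iota>_in mult_in[OF g(1) Z'(1)]] ev_mult[OF g(1) Z'(1)] g(2) by simp
  also have "\<dots> = 0" unfolding Z'(2) by simp
  finally have "\<psi> i1 c = 0" .
  then show False using c(2) by simp
qed

text \<open>Dividing by \<open>\<tau>\<close> as long as possible must stop, so every nonzero
  element is a power of \<open>\<tau>\<close> times a unit, and quotients are decided by comparing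
  exponents.\<close>

lemma valuation_ring:
  assumes \<tau>: "\<tau> \<in> R" "ev \<tau> = 0" "\<And>f. f \<in> R \<Longrightarrow> ev f = 0 \<Longrightarrow> \<exists>h\<in>R. f = \<tau> * h"
    and arch: "\<And>f. f \<in> R \<Longrightarrow> f \<noteq> 0 \<Longrightarrow> \<exists>e. \<forall>h\<in>R. f \<noteq> \<tau> ^ e * h"
    and fg: "f \<in> R" "g \<in> R" "f \<noteq> 0" "g \<noteq> 0"
  shows "f / g \<in> R \<or> g / f \<in> R"
proof -
  have unit: "\<exists>e u. u \<in> R \<and> ev u \<noteq> 0 \<and> q = \<tau> ^ e * u" if q: "q \<in> R" "q \<noteq> 0" for q
  proof (rule ccontr)
    assume no: "\<not> ?thesis"
    have "\<exists>h\<in>R. q = \<tau> ^ e * h" for e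
    proof (induction e)
      case 0
      then show ?case using q by (intro bexI[of _ q]) auto
    next
      case (Suc e)
      then obtain h where h: "h \<in> R" "q = \<tau> ^ e * h" by blast
      then have "ev h = 0" using no by blast
      then obtain h' where "h' \<in> R" "h = \<tau> * h'" using \<tau>(3) h by blast
      then show ?case using h by (intro bexI[of _ h']) (auto simp: mult_ac)
    qed
    then show False using arch[OF q] by blast
  qed
  obtain e u where u: "u \<in> R" "ev u \<noteq> 0" "f = \<tau> ^ e * u" using unit[of f] fg by blast
  obtain e' u' where u': "u' \<in> R" "ev u' \<noteq> 0" "g = \<tau> ^ e' * u'" using unit[of g] fg by blast
  have *: "(\<tau> ^ i * s) / (\<tau> ^ j * s') \<in> R"
    if "j \<le> i" "s \<in> R" "s' \<in> R" "ev s' \<noteq> 0" "\<tau> ^ j * s' \<noteq> 0" for i j s s'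
  proof -
    have "\<tau> ^ i = \<tau> ^ (i - j) * \<tau> ^ j" using that(1) by (simp flip: power_add)
    then have "(\<tau> ^ i * s) / (\<tau> ^ j * s') = \<tau> ^ (i - j) * (s / s')"
    proof -
      have "(p * q * s) / (q * s') = p * (s / s')" if "q \<noteq> 0" for p q using that by simp
      moreover have "\<tau> ^ j \<noteq> 0" using that(5) by (metis mult_zero_left)
      ultimately show ?thesis unfolding \<open>\<tau> ^ i = _\<close> by blast
    qed
    then show ?thesis using that \<tau> by (auto intro!: mult_in power_in divide_in)
  qed
  show ?thesis
    using *[of e' e u u'] *[of e e' u' u] u u' fg by (cases "e' \<le> e") auto
qed

definition fractions :: "'w set" where
  "fractions = {f / g | f g. f \<in> R \<and> g \<in> R \<and> g \<noteq> 0}"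

lemma fractionsI: "f \<in> R \<Longrightarrow> f \<in> fractions"
  unfolding fractions_def by (intro CollectI exI[of _ f] exI[of _ 1]) auto

lemma fractions_add: "f \<in> fractions \<Longrightarrow> g \<in> fractions \<Longrightarrow> f + g \<in> fractions"
proof -
  assume "f \<in> fractions" "g \<in> fractions"
  then obtain u v u' v' where "f = u / v" "g = u' / v'" "u \<in> R" "v \<in> R" "v \<noteq> 0" "u' \<in> R" "v' \<in> R" "v' \<noteq> 0"
    by (auto simp: fractions_def)
  then show ?thesis unfolding fractions_def
    by (intro CollectI exI[of _ "u * v' + u' * v"] exI[of _ "v * v'"])
      (auto simp: add_frac_eq intro!: add_in mult_in)
qed

lemma fractions_mult: "f \<in> fractions \<Longrightarrow> g \<in> fractions \<Longrightarrow> f * g \<in> fractions"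
proof -
  assume "f \<in> fractions" "g \<in> fractions"
  then obtain u v u' v' where "f = u / v" "g = u' / v'" "u \<in> R" "v \<in> R" "v \<noteq> 0" "u' \<in> R" "v' \<in> R" "v' \<noteq> 0"
    by (auto simp: fractions_def)
  then show ?thesis unfolding fractions_def
    by (intro CollectI exI[of _ "u * u'"] exI[of _ "v * v'"]) (auto intro!: mult_in)
qed

lemma fractions_inverse: "f \<in> fractions \<Longrightarrow> inverse f \<in> fractions"
proof -
  assume "f \<in> fractions"
  then obtain u v where uv: "f = u / v" "u \<in> R" "v \<in> R" "v \<noteq> 0" by (auto simp: fractions_def)
  then show ?thesis
    using fractionsI[OF zero_in] by (cases "u = 0") (auto simp: fractions_def)
qed

lemma fractions_sum: "(\<And>s. s \<in> S \<Longrightarrow> f s \<in> fractions) \<Longrightarrow> sum f S \<in> fractions"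
  by (induction S rule: infinite_finite_induct) (auto intro: fractions_add fractionsI)

lemma fractions_prod: "(\<And>s. s \<in> S \<Longrightarrow> f s \<in> fractions) \<Longrightarrow> prod f S \<in> fractions"
  by (induction S rule: infinite_finite_induct) (auto intro: fractions_mult fractionsI)

lemma fractions_power: "f \<in> fractions \<Longrightarrow> f ^ m \<in> fractions"
  by (induction m) (auto intro: fractions_mult fractionsI)

lemma fractions_eval_along:
  "(\<And>i. v $ i \<in> fractions) \<Longrightarrow> eval_along \<iota> P v \<in> fractions"
  unfolding eval_along_def monomial_eval_def
  by (intro fractions_sum fractions_mult fractions_prod fractions_power) (auto intro: fractionsI)

lemma eval_along_in: "(\<And>i. v $ i \<in> R) \<Longrightarrow> eval_along \<iota> P v \<in> R"
  unfolding eval_along_def monomial_eval_def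
  by (intro sum_in mult_in prod_in power_in) auto

lemma ev_eval_along: "(\<And>i. v $ i \<in> R) \<Longrightarrow> ev (eval_along \<iota> P v) = eval_along (\<lambda>c. c) P (\<chi> i. ev (v $ i))"
  unfolding eval_along_def monomial_eval_def
  by (simp add: ev_sum ev_mult ev_prod ev_power sum_in mult_in prod_in power_in)

lemma det_in:
  fixes A :: "'w ^ 'n ^ 'n"
  assumes "\<And>i j. A $ i $ j \<in> R"
  shows "Determinants.det A \<in> R" "ev (Determinants.det A) = Determinants.det (\<chi> i j. ev (A $ i $ j))"
proof -
  have sgn: "of_int (sign \<sigma>) \<in> R" "ev (of_int (sign \<sigma>)) = of_int (sign \<sigma>)" for \<sigma> :: "'n \<Rightarrow> 'n"
    by (auto simp: sign_def minus_in ev_minus)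
  show "Determinants.det A \<in> R"
    unfolding Determinants.det_def by (intro sum_in mult_in prod_in sgn assms)
  have "ev (Determinants.det A) = (\<Sum>\<sigma> | \<sigma> permutes (UNIV :: 'n set). ev (of_int (sign \<sigma>) * (\<Prod>i\<in>UNIV. A $ i $ \<sigma> i)))"
    unfolding Determinants.det_def by (intro ev_sum mult_in prod_in sgn assms)
  also have "\<dots> = (\<Sum>\<sigma> | \<sigma> permutes (UNIV :: 'n set). of_int (sign \<sigma>) * (\<Prod>i\<in>UNIV. ev (A $ i $ \<sigma> i)))"
    by (intro sum.cong refl) (simp add: ev_mult ev_prod sgn prod_in assms)
  finally show "ev (Determinants.det A) = Determinants.det (\<chi> i j. ev (A $ i $ j))"
    unfolding Determinants.det_def by simp
qed

text \<open>The relations say \<open>(1 - A) z = \<tau> t\<close> with the entries of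
  \<open>A\<close> in the maximal ideal. The determinant of \<open>1 - A\<close> has value 1, so it
  is a unit, and Cramer's rule solves for \<open>z / \<tau>\<close> in \<open>R\<close>.\<close>

lemma nakayama:
  fixes z t :: "'w ^ 'n"
  assumes z: "\<And>i. z $ i \<in> R" and t: "\<And>i. t $ i \<in> R"
    and rel: "\<And>i. \<exists>A. (\<forall>j. A j \<in> R \<and> ev (A j) = 0) \<and> z $ i - t $ i * \<tau> = (\<Sum>j\<in>UNIV. A j * z $ j)"
  shows "\<exists>h\<in>R. z $ i = \<tau> * h"
proof -
  obtain A where A: "\<And>i j. A i j \<in> R" "\<And>i j. ev (A i j) = 0"
    "\<And>i. z $ i - t $ i * \<tau> = (\<Sum>j\<in>UNIV. A i j * z $ j)"
    using rel by metis
  define B :: "'w ^ 'n ^ 'n" where "B = (\<chi> i j. (if i = j then 1 else 0) - A i j)"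
  have B: "B $ i $ j \<in> R" for i j by (auto simp: B_def intro!: diff_in minus_in A)
  have "(\<chi> i j. ev (B $ i $ j)) = Finite_Cartesian_Product.mat 1"
    by (simp add: Finite_Cartesian_Product.vec_eq_iff B_def Finite_Cartesian_Product.mat_def ev_diff A)
  then have evB: "ev (Determinants.det B) = 1" using det_in(2)[of B] B by simp
  then have detB: "Determinants.det B \<noteq> 0" by auto
  have Bz: "B *v z = (\<chi> i. t $ i * \<tau>)"
  proof -
    have "(\<Sum>j\<in>UNIV. B $ i $ j * z $ j) = t $ i * \<tau>" for i
    proof -
      have "(\<Sum>j\<in>UNIV. B $ i $ j * z $ j) = (\<Sum>j\<in>UNIV. (if i = j then z $ j else 0) - A i j * z $ j)"
        by (intro sum.cong refl) (simp add: B_def left_diff_distrib)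
      also have "\<dots> = z $ i - (\<Sum>j\<in>UNIV. A i j * z $ j)" by (simp add: sum_subtractf)
      finally show ?thesis unfolding A(3)[symmetric] by simp
    qed
    then show ?thesis by (simp add: matrix_vector_mult_def Finite_Cartesian_Product.vec_eq_iff)
  qed
  show ?thesis
  \<comment> \<open>Cramer's rule is applied to \<open>z / \<tau>\<close>; for
    \<open>\<tau> = 0\<close> invertibility alone gives \<open>z = 0\<close>.\<close>
  proof (cases "\<tau> = 0")
    case True
    then have "B *v z = 0" using Bz by (simp add: Finite_Cartesian_Product.vec_eq_iff)
    moreover have "invertible B" using detB by (simp add: invertible_det_nz)
    ultimately have "z = 0"
      by (metis invertible_def matrix_left_invertible_ker)
    then show ?thesis by (intro bexI[of _ 0]) auto
  next
    case False
    define z' where "z' = (\<chi> i. z $ i / \<tau>)"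
    have "B *v z' = t"
    proof -
      have "(\<Sum>j\<in>UNIV. B $ i $ j * (z $ j / \<tau>)) = (\<Sum>j\<in>UNIV. B $ i $ j * z $ j) / \<tau>" for i
        by (simp add: sum_divide_distrib)
      moreover have "(\<Sum>j\<in>UNIV. B $ i $ j * z $ j) = t $ i * \<tau>" for i
        using arg_cong[OF Bz, of "\<lambda>v. v $ i"] by (simp add: matrix_vector_mult_def)
      ultimately show ?thesis
        using False by (simp add: matrix_vector_mult_def Finite_Cartesian_Product.vec_eq_iff z'_def)
    qed
    then have "z' = (\<chi> k. Determinants.det (\<chi> i j. if j = k then t $ i else B $ i $ j) / Determinants.det B)"
      using cramer[OF detB] by blast
    then have "z' $ i = Determinants.det (\<chi> i' j. if j = i then t $ i' else B $ i' $ j) / Determinants.det B"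
      by simp
    also have "\<dots> \<in> R"
      using evB by (intro divide_in det_in) (auto simp: t B)
    finally have "z' $ i \<in> R" .
    moreover have "z $ i = \<tau> * z' $ i" using False by (simp add: z'_def)
    ultimately show ?thesis by blast
  qed
qed

end

text \<open>Valuation rings are maximal for domination: if \<open>q\<close> is not in
  \<open>R2\<close>, its inverse is a nonunit of \<open>R2\<close>, hence has value 0 in
  \<open>R1\<close> too, and cannot have the inverse \<open>q\<close> there.\<close>

lemma local_alg_eq_dominated:
  assumes "local_alg R1 ev1 \<iota>" "local_alg R2 ev2 \<iota>"
    and sub: "R2 \<subseteq> R1" and ev: "\<And>f. f \<in> R2 \<Longrightarrow> ev2 f = ev1 f"
    and val: "\<And>q. q \<in> R1 \<Longrightarrow> q \<noteq> 0 \<Longrightarrow> q \<in> R2 \<or> inverse q \<in> R2"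
  shows "R1 = R2"
proof -
  interpret R1: local_alg R1 ev1 \<iota> by fact
  interpret R2: local_alg R2 ev2 \<iota> by fact
  have "q \<in> R2" if q: "q \<in> R1" for q
  proof (rule ccontr)
    assume "q \<notin> R2"
    then have "q \<noteq> 0" by auto
    then have inv: "inverse q \<in> R2" using val[OF q] \<open>q \<notin> R2\<close> by blast
    then have "ev2 (inverse q) = 0" using R2.inverse_in[OF inv] \<open>q \<notin> R2\<close> by auto
    then have "ev1 (inverse q) = 0" using ev[OF inv] by simp
    moreover have "ev1 q * ev1 (inverse q) = 1"
      using R1.ev_mult[of q "inverse q"] q inv sub \<open>q \<noteq> 0\<close> by auto
    ultimately show False by simp
  qed
  with sub show ?thesis by blast
qed

section \<open>The generic point of the model\<close>

lemma id_hom: "comm_ring_hom (\<lambda>c. c :: 'a::comm_ring_1)"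
  by unfold_locales simp_all

abbreviation evl where "evl \<equiv> eval_along (\<lambda>c. c)"

lemma span_line: "vec.span {v} = {t *s v | t. True}"
  for v :: "'a::field ^ 'n"
  by (auto simp: vec.span_singleton)

lemma proj_space_line:
  assumes "L \<in> proj_space" "v \<in> L" "v \<noteq> 0"
  shows "L = vec.span {v}"
proof -
  obtain u where u: "L = vec.span {u}" "u \<noteq> 0" using assms(1) by (auto simp: proj_space_def)
  obtain t where t: "v = t *s u" using assms(2) by (auto simp: u span_line)
  then have "t \<noteq> 0" using assms(3) by auto
  then have "u = inverse t *s v" by (simp add: t)
  then have "u \<in> vec.span {v}" by (auto simp: span_line)
  moreover have "v \<in> vec.span {u}" using t by (auto simp: span_line)
  ultimately show ?thesis unfolding u(1) by (intro equalityI vec.span_minimal vec.subspace_span) auto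
qed

lemma scale_chi: "t *s v = (\<chi> i. t * v $ i)" for v :: "'a::field ^ 'n"
  by (simp add: Finite_Cartesian_Product.vec_eq_iff)

lemma zero_in_line: "L \<in> proj_space \<Longrightarrow> 0 \<in> L"
  by (auto simp: proj_space_def intro: vec.span_zero)

definition vanishes_on :: "('a::field ^ 'n) set set \<Rightarrow> (('n::finite \<Rightarrow>\<^sub>0 nat) \<Rightarrow>\<^sub>0 'a) \<Rightarrow> bool" where
  "vanishes_on Z A \<longleftrightarrow> (\<forall>L\<in>Z. \<forall>v\<in>L. eval_along (\<lambda>c. c) A v = 0)"

lemma zariski_closed_Int_locus:
  assumes Z: "zariski_closed Z" and T: "\<And>A. A \<in> T \<Longrightarrow> \<exists>d. homogeneous d A"
  shows "zariski_closed {L \<in> Z. \<forall>A\<in>T. \<forall>v\<in>L. eval_along (\<lambda>c. c) A v = 0}"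
proof -
  obtain S where S: "\<forall>A\<in>S. \<exists>d. homogeneous d A" "Z = zero_locus S"
    using Z unfolding zariski_closed_def by blast
  have "{L \<in> Z. \<forall>A\<in>T. \<forall>v\<in>L. eval_along (\<lambda>c. c) A v = 0} = zero_locus (S \<union> T)"
    unfolding S(2) zero_locus_def mpol_eval_eq by blast
  then show ?thesis unfolding zariski_closed_def using S(1) T by (intro exI[of _ "S \<union> T"]) auto
qed

text \<open>One side of the cover is a family \<open>T\<close>, because the locus where a
  composition of rational maps is undefined needs several equations.\<close>

lemma irreducible_closed_cover:
  assumes irr: "irreducible_closed Z"
    and A: "\<exists>d. homogeneous d A" and T: "\<And>B. B \<in> T \<Longrightarrow> \<exists>d. homogeneous d B"
    and cover: "\<And>L. L \<in> Z \<Longrightarrow> (\<forall>v\<in>L. eval_along (\<lambda>c. c) A v = 0) \<or> (\<forall>B\<in>T. \<forall>v\<in>L. eval_along (\<lambda>c. c) B v = 0)"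
  shows "vanishes_on Z A \<or> (\<forall>B\<in>T. vanishes_on Z B)"
proof -
  let ?Z1 = "{L \<in> Z. \<forall>B\<in>{A}. \<forall>v\<in>L. eval_along (\<lambda>c. c) B v = 0}"
  let ?Z2 = "{L \<in> Z. \<forall>B\<in>T. \<forall>v\<in>L. eval_along (\<lambda>c. c) B v = 0}"
  have Z: "zariski_closed Z" using irr unfolding irreducible_closed_def by blast
  have "zariski_closed ?Z1" "zariski_closed ?Z2"
    using A T by (intro zariski_closed_Int_locus[OF Z]; auto)+
  moreover have "Z = ?Z1 \<union> ?Z2" using cover by blast
  ultimately have "Z = ?Z1 \<or> Z = ?Z2" using irr unfolding irreducible_closed_def by blast
  then show ?thesis unfolding vanishes_on_def by blast
qed

locale curve_model = curve_chart n "to_ac a" "to_ac b" y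
  for n :: nat and a b :: "'k::field" and y :: "'k alg_closure poly fract alg_closure" +
  fixes C :: "('k alg_closure ^ 'm::finite) set set"
    and F :: "3 \<Rightarrow> ('m, 'k) mpol" and H :: "'m \<Rightarrow> (3, 'k) mpol"
  assumes irr: "irreducible_closed C"
    and F_map: "rational_map C (curve_G n a b) F" and H_map: "rational_map (curve_G n a b) C H"
    and HF: "rational_left_inverse C F H" and FH: "rational_left_inverse (curve_G n a b) H F"
begin

abbreviation G where "G \<equiv> curve_G n a b"
abbreviation g where "g \<equiv> form_G n (to_ac a) (to_ac b)"

definition Fa where "Fa i = Poly_Mapping.map to_ac (F i)"
definition Ha where "Ha i = Poly_Mapping.map to_ac (H i)"

lemma mpol_map_F: "mpol_map F v = (\<chi> i. evl (Fa i) v)"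
  by (simp add: mpol_map_def mpol_eval_eq Fa_def)

lemma mpol_map_H: "mpol_map H v = (\<chi> i. evl (Ha i) v)"
  by (simp add: mpol_map_def mpol_eval_eq Ha_def)

definition dF where "dF = (SOME d. \<forall>i. homogeneous d (F i))"
definition dH where "dH = (SOME d. \<forall>i. homogeneous d (H i))"

lemma hom_Fa: "homogeneous dF (Fa i)"
proof -
  have "\<exists>d. \<forall>i. homogeneous d (F i)" using F_map unfolding rational_map_def by blast
  then have "\<forall>i. homogeneous dF (F i)" unfolding dF_def by (rule someI_ex)
  then show ?thesis by (auto simp: Fa_def intro: homogeneous_map)
qed

lemma hom_Ha: "homogeneous dH (Ha i)"
proof -
  have "\<exists>d. \<forall>i. homogeneous d (H i)" using H_map unfolding rational_map_def by blast
  then have "\<forall>i. homogeneous dH (H i)" unfolding dH_def by (rule someI_ex)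
  then show ?thesis by (auto simp: Ha_def intro: homogeneous_map)
qed

lemma g_scale: "g (t *s v) = t ^ (2 * n) * g v"
  by (simp add: form_G_def power_mult_distrib power_mult power2_eq_square algebra_simps)

lemma G_iff: "L \<in> G \<longleftrightarrow> L \<in> proj_space \<and> (\<forall>v\<in>L. g v = 0)"
  by (auto simp: curve_G_def form_G_def)

lemma span_in_G: "g v = 0 \<Longrightarrow> v \<noteq> 0 \<Longrightarrow> vec.span {v} \<in> G"
  unfolding G_iff by (auto simp: proj_space_def span_line g_scale)

lemma ex_line_in_G: assumes "g v = 0" shows "\<exists>L\<in>G. v \<in> L"
proof (cases "v = 0")
  case True
  obtain L where "L \<in> G" using H_map unfolding rational_map_def by blast
  then have "L \<in> proj_space" by (simp add: G_iff)
  then have "0 \<in> L" by (rule zero_in_line)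
  then show ?thesis using True \<open>L \<in> G\<close> by blast
next
  case False
  then show ?thesis using span_in_G[OF assms] by (intro bexI[of _ "vec.span {v}"]) (auto intro: vec.span_base)
qed

lemma C_proj: "L \<in> C \<Longrightarrow> L \<in> proj_space"
  using irr unfolding irreducible_closed_def zariski_closed_def zero_locus_def by auto

lemma C_nonempty: "C \<noteq> {}"
  using irr unfolding irreducible_closed_def by blast

lemma at_scale: "homogeneous d A \<Longrightarrow> evl A (t *s v) = t ^ d * evl A v"
  unfolding scale_chi by (rule eval_along_scale)

lemma at_0_of_vanishes: "vanishes_on C A \<Longrightarrow> evl A 0 = 0"
  using C_nonempty C_proj zero_in_line unfolding vanishes_on_def by blast

definition c where "c = (\<chi> i. eval_along con (Ha i) (vector [x, y, 1]))"

lemma at_comp_H: "evl (mpol_comp A Ha) v = evl A (mpol_map H v)"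
  unfolding mpol_map_H by (rule comm_ring_hom.eval_along_comp[OF id_hom])

lemma at_comp_F: "evl (mpol_comp A Fa) v = evl A (mpol_map F v)"
  unfolding mpol_map_F by (rule comm_ring_hom.eval_along_comp[OF id_hom])

lemma con_comp_H: "eval_along con (mpol_comp A Ha) (vector [x, y, 1]) = eval_along con A c"
  unfolding c_def by (rule comm_ring_hom.eval_along_comp[OF con_hom])

lemma generic_D:
  assumes "homogeneous d P" "eval_along con P (vector [x, y, 1]) = 0" "g v = 0"
  shows "evl P v = 0"
  using generic_vanishD[of P d v] assms eval_along_scale[OF assms(1)] by blast

lemma vanishes_imp_generic:
  assumes A: "vanishes_on C A"
  shows "eval_along con A c = 0"
  unfolding con_comp_H[symmetric]
proof (rule generic_vanishI)
  fix v assume "g v = 0"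
  then obtain L where L: "L \<in> G" "v \<in> L" using ex_line_in_G by blast
  show "evl (mpol_comp A Ha) v = 0"
  \<comment> \<open>Where \<open>H\<close> is undefined the composite takes the value of
    \<open>A\<close> at the origin, which is 0 because every line of \<open>C\<close> contains the
    origin.\<close>
  proof (cases "mpol_map H v = 0")
    case True
    then show ?thesis by (simp add: at_comp_H at_0_of_vanishes[OF A])
  next
    case False
    then have "vec.span {mpol_map H v} \<in> C" using H_map L unfolding rational_map_def by blast
    then show ?thesis
      using A vec.span_base[of "mpol_map H v" "{mpol_map H v}"]
      unfolding at_comp_H vanishes_on_def by blast
  qed
qed

lemma c_nonzero: "c \<noteq> 0"
proof
  assume "c = 0"
  obtain L v where v: "L \<in> G" "v \<in> L" "mpol_map H v \<noteq> 0" using H_map unfolding rational_map_def by blast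
  then have "g v = 0" by (auto simp: G_iff)
  have "evl (Ha i) v = 0" for i
  proof (rule generic_D[OF hom_Ha])
    show "eval_along con (Ha i) (vector [x, y, 1]) = 0"
      using arg_cong[OF \<open>c = 0\<close>, of "\<lambda>u. u $ i"] by (simp add: c_def)
  qed fact
  then show False using v(3) by (simp add: mpol_map_H Finite_Cartesian_Product.vec_eq_iff)
qed

text \<open>Since \<open>F\<close> after \<open>H\<close> is the identity on \<open>G\<close>, the
  cross products of its values with the coordinates vanish at all points of the curve, hence at the
  generic one.\<close>

lemma F_c_proportional:
  "eval_along con (Fa i) c * (vector [x, y, 1] :: _ ^ 3) $ j = eval_along con (Fa j) c * (vector [x, y, 1] :: _ ^ 3) $ i"
proof -
  interpret atv: comm_ring_hom "\<lambda>A. evl A v" for v :: "'k alg_closure ^ 3"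
    by (rule comm_ring_hom.eval_along_comm_ring_hom[OF id_hom])
  interpret gen_at: comm_ring_hom "\<lambda>A. eval_along con A v" for v :: "_ ^ 3"
    by (rule comm_ring_hom.eval_along_comm_ring_hom[OF con_hom])
  define VV :: "3 \<Rightarrow> (3, 'k alg_closure) mpol" where "VV j = Poly_Mapping.single (Poly_Mapping.single j 1) 1" for j
  have VV: "evl (VV j) v = v $ j" "eval_along con (VV j) w = w $ j" for j v w
    using eval_along_single[of "\<lambda>c. c"] eval_along_single[of con]
    by (simp_all add: VV_def monomial_eval_single gen_def eval_along_single one_pCons[symmetric])
  obtain l where l: "c $ l \<noteq> 0" using c_nonzero by (auto simp: Finite_Cartesian_Product.vec_eq_iff)
  \<comment> \<open>The factor \<open>Ha l\<close> covers the points where \<open>H\<close> is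
    undefined: there \<open>F\<close> is evaluated at the origin, where it need not vanish if its
    degree is 0.\<close>
  define P where "P = Ha l * (mpol_comp (Fa i) Ha * VV j - mpol_comp (Fa j) Ha * VV i)"
  have "eval_along con P (vector [x, y, 1]) = 0"
  proof (rule generic_vanishI)
    fix v assume "g v = 0"
    then obtain L where L: "L \<in> G" "v \<in> L" using ex_line_in_G by blast
    have P: "evl P v = evl (Ha l) v * (evl (Fa i) (mpol_map H v) * v $ j - evl (Fa j) (mpol_map H v) * v $ i)"
      by (simp add: P_def atv.hom_mult atv.hom_minus at_comp_H VV)
    show "evl P v = 0"
    proof (cases "mpol_map H v = 0 \<or> mpol_map F (mpol_map H v) = 0")
      case True
      then show ?thesis unfolding P by (auto simp: mpol_map_H mpol_map_F Finite_Cartesian_Product.vec_eq_iff)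
    next
      case False
      then have "vec.span {mpol_map F (mpol_map H v)} = L" using FH L unfolding rational_left_inverse_def by blast
      then obtain t where t: "v = t *s mpol_map F (mpol_map H v)" using L(2) by (auto simp: span_line)
      have "v $ i = t * evl (Fa i) (mpol_map H v)" for i
        using arg_cong[OF t, of "\<lambda>u. u $ i"] by (simp add: mpol_map_F)
      then show ?thesis unfolding P by simp
    qed
  qed
  then have "c $ l * (eval_along con (Fa i) c * (vector [x, y, 1] :: _ ^ 3) $ j
      - eval_along con (Fa j) c * (vector [x, y, 1] :: _ ^ 3) $ i) = 0"
    by (simp add: P_def gen_at.hom_mult gen_at.hom_minus con_comp_H VV) (simp add: c_def)
  then show ?thesis using l by simp
qed

lemma F3_c_nonzero: "eval_along con (Fa 3) c \<noteq> 0"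
proof
  assume 0: "eval_along con (Fa 3) c = 0"
  have Fc: "eval_along con (Fa i) c = 0" for i
    using F_c_proportional[of i 3] 0 by (simp add: vector_3)
  obtain L v where v: "L \<in> G" "v \<in> L" "mpol_map H v \<noteq> 0" "mpol_map F (mpol_map H v) \<noteq> 0"
    using FH unfolding rational_left_inverse_def by blast
  then have "g v = 0" by (auto simp: G_iff)
  have "evl (mpol_comp (Fa i) Ha) v = 0" for i
    by (rule generic_D[OF homogeneous_comp[OF hom_Fa hom_Ha]]) (use \<open>g v = 0\<close> Fc in \<open>simp_all add: con_comp_H\<close>)
  then show False using v(4) by (simp add: at_comp_H mpol_map_F Finite_Cartesian_Product.vec_eq_iff)
qed

lemma xy_eq: "x = eval_along con (Fa 1) c / eval_along con (Fa 3) c"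
  "y = eval_along con (Fa 2) c / eval_along con (Fa 3) c"
  using F_c_proportional[of 1 3] F_c_proportional[of 2 3] F3_c_nonzero
  by (simp_all add: vector_3 field_simps)

text \<open>Where \<open>H\<close> after \<open>F\<close> is defined on \<open>C\<close> it is the
  identity, so \<open>A\<close> vanishes there by \<open>generic_D\<close>. The remaining points lie
  in the locus of \<open>T\<close>, which is proper, so irreducibility leaves only the locus of
  \<open>A\<close>.\<close>

lemma generic_imp_vanishes:
  assumes hA: "homogeneous d A" and A: "eval_along con A c = 0"
  shows "vanishes_on C A"
proof -
  interpret atv: comm_ring_hom "\<lambda>A. evl A v" for v :: "'k alg_closure ^ 'm"
    by (rule comm_ring_hom.eval_along_comm_ring_hom[OF id_hom])
  define T where "T = {Fa j * mpol_comp (Ha i) Fa | i j. True}"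
  have T: "evl (Fa j * mpol_comp (Ha i) Fa) v = evl (Fa j) v * evl (Ha i) (mpol_map F v)" for i j v
    by (simp add: atv.hom_mult at_comp_F)
  have "vanishes_on C A \<or> (\<forall>B\<in>T. vanishes_on C B)"
  proof (rule irreducible_closed_cover[OF irr])
    show "\<exists>d. homogeneous d B" if "B \<in> T" for B
      using that unfolding T_def by (blast intro: homogeneous_mult homogeneous_comp hom_Fa hom_Ha)
    fix L assume L: "L \<in> C"
    show "(\<forall>v\<in>L. evl A v = 0) \<or> (\<forall>B\<in>T. \<forall>v\<in>L. evl B v = 0)"
    proof (cases "\<exists>u\<in>L. mpol_map F u \<noteq> 0 \<and> mpol_map H (mpol_map F u) \<noteq> 0")
      case True
      then obtain u where u: "u \<in> L" "mpol_map F u \<noteq> 0" "mpol_map H (mpol_map F u) \<noteq> 0" by blast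
      have LL: "vec.span {mpol_map H (mpol_map F u)} = L" using HF L u unfolding rational_left_inverse_def by blast
      have "vec.span {mpol_map F u} \<in> G" using F_map L u unfolding rational_map_def by blast
      then have "g (mpol_map F u) = 0" by (auto simp: G_iff intro: vec.span_base)
      then have 0: "evl A (mpol_map H (mpol_map F u)) = 0"
        unfolding at_comp_H[symmetric]
        by (intro generic_D[OF homogeneous_comp[OF hA hom_Ha]]) (simp_all add: con_comp_H A)
      have "evl A v = 0" if "v \<in> L" for v
        using that 0 unfolding LL[symmetric] by (auto simp: span_line at_scale[OF hA])
      then show ?thesis by blast
    next
      case False
      then have "evl (Fa j) v * evl (Ha i) (mpol_map F v) = 0" if "v \<in> L" for i j v
        using that by (auto simp: mpol_map_F mpol_map_H Finite_Cartesian_Product.vec_eq_iff)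
      then show ?thesis unfolding T_def using T by auto
    qed
  qed (use hA in blast)
  moreover have "\<not> (\<forall>B\<in>T. vanishes_on C B)"
  proof
    assume all: "\<forall>B\<in>T. vanishes_on C B"
    obtain L v where v: "L \<in> C" "v \<in> L" "mpol_map F v \<noteq> 0" "mpol_map H (mpol_map F v) \<noteq> 0"
      using HF unfolding rational_left_inverse_def by blast
    obtain j where "evl (Fa j) v \<noteq> 0" using v(3) by (auto simp: mpol_map_F Finite_Cartesian_Product.vec_eq_iff)
    moreover obtain i where "evl (Ha i) (mpol_map F v) \<noteq> 0"
      using v(4) by (auto simp: mpol_map_H Finite_Cartesian_Product.vec_eq_iff)
    ultimately have "evl (Fa j * mpol_comp (Ha i) Fa) v \<noteq> 0" by (simp add: T)
    then show False using all v unfolding T_def vanishes_on_def by blast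
  qed
  ultimately show ?thesis by blast
qed

end

section \<open>Prime fields, duality of linear forms, derivatives of forms\<close>

lemma field_power_card:
  fixes x :: "'a::field"
  assumes "finite (UNIV :: 'a set)"
  shows "x ^ card (UNIV :: 'a set) = x"
proof (cases "x = 0")
  case True
  then show ?thesis using assms by (simp add: zero_power card_gt_0_iff)
next
  case False
  let ?U = "UNIV - {0 :: 'a}"
  have "bij_betw ((*) x) ?U ?U"
    by (rule bij_betw_byWitness[of _ "\<lambda>y. y / x"]) (use False in auto)
  then have "(\<Prod>y\<in>?U. x * y) = (\<Prod>y\<in>?U. y)" by (rule prod.reindex_bij_betw)
  moreover have "(\<Prod>y\<in>?U. x * y) = x ^ card ?U * (\<Prod>y\<in>?U. y)" by (simp add: prod.distrib)
  moreover have "(\<Prod>y\<in>?U. y) \<noteq> 0" using assms by simp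
  ultimately have "x ^ card ?U = 1" by simp
  moreover have "card (UNIV :: 'a set) = Suc (card ?U)"
    using card_Suc_Diff1[OF assms UNIV_I, of 0] by (rule sym)
  ultimately show ?thesis by (simp only: power_Suc mult_1_right)
qed

lemma CHAR_eq_CARD_prime:
  assumes "Factorial_Ring.prime (CARD('k::field))"
  shows "CHAR('k) = CARD('k)"
proof -
  have "CHAR('k) dvd CARD('k)" by (rule CHAR_dvd_CARD)
  moreover have "CHAR('k) \<noteq> 1" by simp
  ultimately show ?thesis using assms unfolding prime_nat_iff by blast
qed

text \<open>A linear functional that is 0 on \<open>\<Gamma>\<close> and not at a vector outside its
  span gives a \<open>v\<close> contradicting \<open>ann\<close>. This converts the dimension of the
  tangent space into a supply of gradients.\<close>

lemma double_annihilator: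
  fixes \<Gamma> :: "('a::field ^ 'n) set" and \<alpha> :: "'a ^ 'n"
  assumes ann: "\<And>v. (\<And>\<gamma>. \<gamma> \<in> \<Gamma> \<Longrightarrow> (\<Sum>j\<in>UNIV. \<gamma> $ j * v $ j) = 0) \<Longrightarrow> (\<Sum>j\<in>UNIV. \<alpha> $ j * v $ j) = 0"
  shows "\<alpha> \<in> vec.span \<Gamma>"
proof (rule ccontr)
  assume \<alpha>: "\<alpha> \<notin> vec.span \<Gamma>"
  obtain B where B: "B \<subseteq> \<Gamma>" "vec.independent B" "\<Gamma> \<subseteq> vec.span B"
    using vec.maximal_independent_subset[of \<Gamma>] by blast
  have "vec.span \<Gamma> = vec.span B"
    using B by (metis vec.span_mono vec.span_span subset_antisym)
  then have "\<alpha> \<notin> vec.span B" using \<alpha> by simp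
  then have ind: "vec.independent (insert \<alpha> B)" using B(2) by (simp add: vec.independent_insertI)
  obtain f where f: "Vector_Spaces.linear (*s) (*s) f" "\<And>u. u \<in> insert \<alpha> B \<Longrightarrow> f u = (if u = \<alpha> then \<alpha> else 0)"
    using vec.linear_independent_extend[OF ind, of "\<lambda>u. if u = \<alpha> then \<alpha> else 0"] by blast
  interpret f: Vector_Spaces.linear "(*s)" "(*s)" f by (rule f(1))
  have "\<alpha> \<notin> B" using \<open>\<alpha> \<notin> vec.span B\<close> vec.span_base by blast
  have f0: "f u = 0" if "u \<in> \<Gamma>" for u
  proof -
    have "u \<in> vec.span B" using B(3) that by blast
    moreover have "f b = 0" if "b \<in> B" for b using f(2)[of b] that \<open>\<alpha> \<notin> B\<close> by auto
    ultimately show ?thesis using f.eq_0_on_span[of B u] by blast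
  qed
  have "\<alpha> \<noteq> 0" using \<alpha> vec.span_zero by auto
  then obtain k where k: "\<alpha> $ k \<noteq> 0" by (auto simp: Finite_Cartesian_Product.vec_eq_iff)
  define v where "v = (\<chi> j. f (axis j 1) $ k)"
  have fv: "f u $ k = (\<Sum>j\<in>UNIV. u $ j * v $ j)" for u
  proof -
    have "f u = f (\<Sum>j\<in>UNIV. u $ j *s axis j 1)" by (simp add: basis_expansion)
    also have "\<dots> = (\<Sum>j\<in>UNIV. u $ j *s f (axis j 1))" by (simp add: f.sum f.scale)
    finally show ?thesis by (simp add: v_def)
  qed
  have "(\<Sum>j\<in>UNIV. \<alpha> $ j * v $ j) = 0"
    by (rule ann) (simp add: f0 flip: fv)
  moreover have "(\<Sum>j\<in>UNIV. \<alpha> $ j * v $ j) = \<alpha> $ k" using f(2)[of \<alpha>] by (simp flip: fv)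
  ultimately show False using k by simp
qed

lemma mpol_pderiv_eval_scale:
  assumes "homogeneous d A"
  shows "mpol_pderiv_eval j A (\<chi> i. t * x $ i) = t ^ (d - 1) * mpol_pderiv_eval j A x"
  unfolding mpol_pderiv_eval_def sum_distrib_left
proof (rule sum.cong[OF refl])
  fix m assume m: "m \<in> Poly_Mapping.keys A"
  show "lkp A m * of_nat (lkp m j) * (\<Prod>i\<in>UNIV. ((\<chi> i. t * x $ i) $ i) ^ (lkp m i - (if i = j then 1 else 0)))
    = t ^ (d - 1) * (lkp A m * of_nat (lkp m j) * (\<Prod>i\<in>UNIV. (x $ i) ^ (lkp m i - (if i = j then 1 else 0))))"
  proof (cases "lkp m j = 0")
    case False
    have "(\<Sum>i\<in>UNIV. lkp m i - (if i = j then 1 else 0)) + 1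
        = (\<Sum>i\<in>UNIV. lkp m i - (if i = j then 1 else 0)) + (\<Sum>i\<in>UNIV. if i = j then 1 else 0)"
      by simp
    also have "\<dots> = (\<Sum>i\<in>UNIV. lkp m i)"
      unfolding sum.distrib[symmetric] using False by (intro sum.cong) auto
    also have "\<dots> = d" using assms m by (auto simp: homogeneous_def)
    finally have "(\<Sum>i\<in>UNIV. lkp m i - (if i = j then 1 else 0)) = d - 1" by simp
    then have "(\<Prod>i\<in>UNIV. ((\<chi> i. t * x $ i) $ i) ^ (lkp m i - (if i = j then 1 else 0)))
        = t ^ (d - 1) * (\<Prod>i\<in>UNIV. (x $ i) ^ (lkp m i - (if i = j then 1 else 0)))"
      by (simp add: power_mult_distrib prod.distrib flip: power_sum)
    then show ?thesis by (simp only: mult_ac)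
  qed simp
qed

lemma euler_homogeneous:
  assumes "homogeneous d A"
  shows "(\<Sum>j\<in>UNIV. mpol_pderiv_eval j A x * x $ j) = of_nat d * evl A x"
proof -
  have mon: "of_nat (lkp m j) * (\<Prod>i\<in>UNIV. (x $ i) ^ (lkp m i - (if i = j then 1 else 0))) * x $ j
      = of_nat (lkp m j) * monomial_eval x m" for m j
  proof (cases "lkp m j = 0")
    case False
    have "(\<Prod>i\<in>UNIV. (x $ i) ^ (lkp m i - (if i = j then 1 else 0))) * x $ j
        = (\<Prod>i\<in>UNIV. (x $ i) ^ (lkp m i - (if i = j then 1 else 0))) * (\<Prod>i\<in>UNIV. if i = j then x $ i else 1)"
      by simp
    also have "\<dots> = monomial_eval x m"
      unfolding prod.distrib[symmetric] monomial_eval_def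
      using False by (intro prod.cong) (auto simp: power_eq_if mult.commute)
    finally show ?thesis by (simp add: mult.assoc)
  qed simp
  have "(\<Sum>j\<in>UNIV. mpol_pderiv_eval j A x * x $ j)
      = (\<Sum>j\<in>UNIV. \<Sum>m\<in>Poly_Mapping.keys A. lkp A m * (of_nat (lkp m j) * monomial_eval x m))"
    unfolding mpol_pderiv_eval_def sum_distrib_right
    by (intro sum.cong refl) (simp add: mon[symmetric] mult.assoc)
  also have "\<dots> = (\<Sum>m\<in>Poly_Mapping.keys A. \<Sum>j\<in>UNIV. lkp A m * (of_nat (lkp m j) * monomial_eval x m))"
    by (rule sum.swap)
  also have "\<dots> = (\<Sum>m\<in>Poly_Mapping.keys A. of_nat d * (lkp A m * monomial_eval x m))"
  proof (rule sum.cong[OF refl])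
    fix m assume "m \<in> Poly_Mapping.keys A"
    then have "d = (\<Sum>j\<in>UNIV. lkp m j)" using assms by (simp add: homogeneous_def)
    then have "of_nat d = (\<Sum>j\<in>UNIV. of_nat (lkp m j) :: 'b)" by simp
    then show "(\<Sum>j\<in>UNIV. lkp A m * (of_nat (lkp m j) * monomial_eval x m)) = of_nat d * (lkp A m * monomial_eval x m)"
      by (simp add: sum_distrib_right sum_distrib_left mult_ac)
  qed
  finally show ?thesis by (simp add: eval_along_def sum_distrib_left)
qed

section \<open>First-order Taylor expansion in a local ring\<close>

context local_alg
begin

text \<open>Congruences modulo the square of the ideal generated by functions \<open>z\<^sub>i\<close> vanishing at the point:
  \<open>f\<close> has value \<open>v\<close> and gradient \<open>d\<close> with respect to \<open>z\<close>.\<close>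

definition second_order :: "'w ^ 'n \<Rightarrow> 'w set" where
  "second_order z = {\<Sum>i\<in>UNIV. A i * z $ i | A. \<forall>i. A i \<in> R \<and> ev (A i) = 0}"

definition taylor :: "'w ^ 'n \<Rightarrow> 'w \<Rightarrow> 'c \<Rightarrow> ('n \<Rightarrow> 'c) \<Rightarrow> bool" where
  "taylor z f v d \<longleftrightarrow> f \<in> R \<and> f - \<iota> v - (\<Sum>i\<in>UNIV. \<iota> (d i) * z $ i) \<in> second_order z"

lemma second_order_add: "f \<in> second_order z \<Longrightarrow> g \<in> second_order z \<Longrightarrow> f + g \<in> second_order z"
proof -
  assume "f \<in> second_order z" "g \<in> second_order z"
  then obtain A B where "f = (\<Sum>i\<in>UNIV. A i * z $ i)" "g = (\<Sum>i\<in>UNIV. B i * z $ i)"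
    "\<forall>i. A i \<in> R \<and> ev (A i) = 0" "\<forall>i. B i \<in> R \<and> ev (B i) = 0"
    unfolding second_order_def by blast
  then show ?thesis unfolding second_order_def
    by (intro CollectI exI[of _ "\<lambda>i. A i + B i"]) (auto simp: distrib_right sum.distrib add_in ev_add)
qed

lemma second_order_mult: "r \<in> R \<Longrightarrow> f \<in> second_order z \<Longrightarrow> r * f \<in> second_order z"
proof -
  assume r: "r \<in> R" and "f \<in> second_order z"
  then obtain A where "f = (\<Sum>i\<in>UNIV. A i * z $ i)" "\<forall>i. A i \<in> R \<and> ev (A i) = 0"
    unfolding second_order_def by blast
  then show ?thesis unfolding second_order_def
    by (intro CollectI exI[of _ "\<lambda>i. r * A i"]) (auto simp: sum_distrib_left mult.assoc mult_in ev_mult r)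
qed

lemma second_order_0: "0 \<in> second_order z"
  unfolding second_order_def by (intro CollectI exI[of _ "\<lambda>_. 0"]) auto

lemma second_order_minus: "f \<in> second_order z \<Longrightarrow> - f \<in> second_order z"
  using second_order_mult[of "- 1" f z] minus_in[OF one_in] by simp

lemma second_order_linear_mult:
  assumes "r \<in> R" "ev r = 0"
  shows "(\<Sum>i\<in>UNIV. \<iota> (d i) * z $ i) * r \<in> second_order z"
  unfolding second_order_def
  by (intro CollectI exI[of _ "\<lambda>i. \<iota> (d i) * r"])
    (use assms in \<open>auto simp: sum_distrib_left sum_distrib_right mult_ac mult_in ev_mult\<close>)

lemma taylor_const: "taylor z (\<iota> v) v (\<lambda>_. 0)"
  by (simp add: taylor_def second_order_0)

lemma taylor_add: "taylor z f v d \<Longrightarrow> taylor z g v' d' \<Longrightarrow> taylor z (f + g) (v + v') (\<lambda>i. d i + d' i)"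
proof -
  assume f: "taylor z f v d" and g: "taylor z g v' d'"
  have "f + g - \<iota> (v + v') - (\<Sum>i\<in>UNIV. \<iota> (d i + d' i) * z $ i)
      = (f - \<iota> v - (\<Sum>i\<in>UNIV. \<iota> (d i) * z $ i)) + (g - \<iota> v' - (\<Sum>i\<in>UNIV. \<iota> (d' i) * z $ i))"
    by (simp add: con.hom_add distrib_right sum.distrib)
  moreover have "f + g \<in> R" using f g by (simp add: taylor_def add_in)
  ultimately show ?thesis
    using f g unfolding taylor_def by (simp only: second_order_add)
qed

lemma taylor_sum:
  "(\<And>s. s \<in> S \<Longrightarrow> taylor z (f s) (v s) (d s)) \<Longrightarrow> taylor z (sum f S) (sum v S) (\<lambda>i. \<Sum>s\<in>S. d s i)"
proof (induction S rule: infinite_finite_induct)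
  case (insert s S)
  then show ?case by (auto intro: taylor_add)
qed (use taylor_const[of z 0] in auto)

lemma taylor_mult:
  fixes z :: "'w ^ 'n"
  assumes f: "taylor z f v d" and g: "taylor z g v' d'" and z: "\<And>i. z $ i \<in> R" "\<And>i. ev (z $ i) = 0"
  shows "taylor z (f * g) (v * v') (\<lambda>i. v * d' i + v' * d i)"
proof -
  define D D' where "D = (\<Sum>i\<in>UNIV. \<iota> (d i) * z $ i)" and "D' = (\<Sum>i\<in>UNIV. \<iota> (d' i) * z $ i)"
  define m m' where "m = f - \<iota> v - D" and "m' = g - \<iota> v' - D'"
  have m: "m \<in> second_order z" "m' \<in> second_order z" "f \<in> R" "g \<in> R"
    using f g unfolding taylor_def m_def m'_def D_def D'_def by auto
  have D: "D \<in> R" "D' \<in> R" "ev D' = 0"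
    unfolding D_def D'_def by (auto intro!: sum_in mult_in z simp: ev_sum ev_mult mult_in z)
  have "(\<Sum>i\<in>UNIV. \<iota> (v * d' i + v' * d i) * z $ i) = \<iota> v * D' + \<iota> v' * D"
    unfolding D_def D'_def
    by (simp add: con.hom_add con.hom_mult distrib_right sum.distrib sum_distrib_left mult.assoc)
  moreover have "f * g - \<iota> (v * v') - (\<iota> v * D' + \<iota> v' * D) = g * m + ((\<iota> v + D) * m' + D * D')"
    by (simp add: m_def m'_def con.hom_mult algebra_simps)
  moreover have "D * D' \<in> second_order z"
    unfolding D_def by (rule second_order_linear_mult) (use D in auto)
  ultimately show ?thesis
    unfolding taylor_def using m D
    by (auto intro!: mult_in second_order_add second_order_mult add_in)
qed

lemma taylor_power:
  fixes z :: "'w ^ 'n"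
  assumes f: "taylor z f v d" and z: "\<And>i. z $ i \<in> R" "\<And>i. ev (z $ i) = 0"
  shows "taylor z (f ^ m) (v ^ m) (\<lambda>i. of_nat m * v ^ (m - 1) * d i)"
proof (induction m)
  case 0
  show ?case using taylor_const[of z 1] by simp
next
  case (Suc m)
  have "v * (of_nat m * v ^ (m - 1) * d i) + v ^ m * d i = of_nat (Suc m) * v ^ (Suc m - 1) * d i" for i
    by (cases m) (simp_all add: algebra_simps)
  then show ?case using taylor_mult[OF f Suc z] by simp
qed

lemma taylor_prod:
  fixes z :: "'w ^ 'n"
  assumes "finite S" "\<And>s. s \<in> S \<Longrightarrow> taylor z (f s) (v s) (d s)" and z: "\<And>i. z $ i \<in> R" "\<And>i. ev (z $ i) = 0"
  shows "taylor z (prod f S) (prod v S) (\<lambda>i. \<Sum>s\<in>S. d s i * prod v (S - {s}))"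
  using assms(1,2)
proof (induction S rule: finite_induct)
  case empty
  show ?case using taylor_const[of z 1] by simp
next
  case (insert s S)
  have eq: "v s * (\<Sum>s'\<in>S. d s' i * prod v (S - {s'})) + prod v S * d s i
      = (\<Sum>s'\<in>insert s S. d s' i * prod v (insert s S - {s'}))" for i
  proof -
    have "prod v (insert s S - {s'}) = v s * prod v (S - {s'})" if "s' \<in> S" for s'
    proof -
      have "insert s S - {s'} = insert s (S - {s'})" using that insert.hyps by auto
      then show ?thesis using insert.hyps by simp
    qed
    then have "(\<Sum>s'\<in>S. d s' i * prod v (insert s S - {s'})) = v s * (\<Sum>s'\<in>S. d s' i * prod v (S - {s'}))"
      by (simp add: sum_distrib_left mult_ac)
    moreover have "insert s S - {s} = S" using insert.hyps by auto
    ultimately show ?thesis using insert.hyps by (simp add: mult.commute add.commute)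
  qed
  have "taylor z (f s * prod f S) (v s * prod v S)
      (\<lambda>i. v s * (\<Sum>s'\<in>S. d s' i * prod v (S - {s'})) + prod v S * d s i)"
    by (rule taylor_mult[OF _ _ z]) (use insert in auto)
  then show ?case unfolding eq using insert.hyps by simp
qed

text \<open>The partial derivatives are formal, so the gradient is assembled monomial by monomial
  from the sum, product and power rules.\<close>

lemma taylor_eval_along:
  fixes z w :: "'w ^ 'n" and u :: "'c ^ 'n"
  assumes z: "\<And>i. z $ i \<in> R" "\<And>i. ev (z $ i) = 0" and w: "\<And>i. w $ i = \<iota> (u $ i) + z $ i"
  shows "taylor z (eval_along \<iota> P w) (evl P u) (\<lambda>j. mpol_pderiv_eval j P u)"
proof -
  have var: "taylor z (w $ i) (u $ i) (\<lambda>j. if j = i then 1 else 0)" for i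
  proof -
    have "(\<Sum>j\<in>UNIV. \<iota> (if j = i then 1 else 0) * z $ j) = (\<Sum>j\<in>UNIV. if j = i then z $ j else 0)"
      by (intro sum.cong) auto
    then show ?thesis using z by (simp add: taylor_def w second_order_0 add_in)
  qed
  have "taylor z (eval_along \<iota> P w) (\<Sum>m\<in>Poly_Mapping.keys P. lkp P m * monomial_eval u m)
    (\<lambda>j. \<Sum>m\<in>Poly_Mapping.keys P. lkp P m * of_nat (lkp m j) * (\<Prod>i\<in>UNIV. (u $ i) ^ (lkp m i - (if i = j then 1 else 0))))"
    unfolding eval_along_def
  proof (rule taylor_sum)
    fix m
    have "taylor z (monomial_eval w m) (monomial_eval u m)
        (\<lambda>j. \<Sum>s\<in>UNIV. (of_nat (lkp m s) * (u $ s) ^ (lkp m s - 1) * (if j = s then 1 else 0)) * (\<Prod>i\<in>UNIV - {s}. (u $ i) ^ lkp m i))"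
      unfolding monomial_eval_def by (intro taylor_prod taylor_power var z) auto
    also have "(\<lambda>j. \<Sum>s\<in>UNIV. (of_nat (lkp m s) * (u $ s) ^ (lkp m s - 1) * (if j = s then 1 else 0)) * (\<Prod>i\<in>UNIV - {s}. (u $ i) ^ lkp m i))
        = (\<lambda>j. of_nat (lkp m j) * (\<Prod>i\<in>UNIV. (u $ i) ^ (lkp m i - (if i = j then 1 else 0))))"
    proof
      fix j
      have "(\<Sum>s\<in>UNIV. (of_nat (lkp m s) * (u $ s) ^ (lkp m s - 1) * (if j = s then 1 else 0)) * (\<Prod>i\<in>UNIV - {s}. (u $ i) ^ lkp m i))
          = (\<Sum>s\<in>UNIV. if s = j then of_nat (lkp m j) * (u $ j) ^ (lkp m j - 1) * (\<Prod>i\<in>UNIV - {j}. (u $ i) ^ lkp m i) else 0)"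
        by (intro sum.cong) auto
      also have "\<dots> = of_nat (lkp m j) * ((u $ j) ^ (lkp m j - 1) * (\<Prod>i\<in>UNIV - {j}. (u $ i) ^ lkp m i))"
        by (simp add: mult.assoc)
      also have "(u $ j) ^ (lkp m j - 1) * (\<Prod>i\<in>UNIV - {j}. (u $ i) ^ lkp m i)
          = (\<Prod>i\<in>UNIV. (u $ i) ^ (lkp m i - (if i = j then 1 else 0)))"
        by (subst (2) prod.remove[of _ j]) (auto intro!: arg_cong2[where f = "(*)"] prod.cong)
      finally show "(\<Sum>s\<in>UNIV. (of_nat (lkp m s) * (u $ s) ^ (lkp m s - 1) * (if j = s then 1 else 0)) * (\<Prod>i\<in>UNIV - {s}. (u $ i) ^ lkp m i))
          = of_nat (lkp m j) * (\<Prod>i\<in>UNIV. (u $ i) ^ (lkp m i - (if i = j then 1 else 0)))" .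
    qed
    finally have "taylor z (monomial_eval w m) (monomial_eval u m)
        (\<lambda>j. of_nat (lkp m j) * (\<Prod>i\<in>UNIV. (u $ i) ^ (lkp m i - (if i = j then 1 else 0))))" .
    from taylor_mult[OF taylor_const this z, of "lkp P m"]
    show "taylor z (\<iota> (lkp P m) * monomial_eval w m) (lkp P m * monomial_eval u m)
        (\<lambda>j. lkp P m * of_nat (lkp m j) * (\<Prod>i\<in>UNIV. (u $ i) ^ (lkp m i - (if i = j then 1 else 0))))"
      by (simp add: mult.assoc)
  qed
  then show ?thesis by (simp add: eval_along_def mpol_pderiv_eval_def)
qed

end

section \<open>The field of rational functions on the curve\<close>

context superelliptic
begin

definition rat_funs :: "'a poly fract alg_closure set" where
  "rat_funs = {u / v | u v. v \<noteq> 0 \<and> u \<in> range (eval2 gen y) \<and> v \<in> range (eval2 gen y)}"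

lemma range_bipoly: "u \<in> range (eval2 gen y) \<Longrightarrow> \<exists>e. u \<in> bipoly e"
proof -
  assume "u \<in> range (eval2 gen y)"
  then obtain R where R: "u = eval2 gen y R" by blast
  define e where "e = degree R + (\<Sum>j\<le>degree R. degree (coeff R j))"
  have "degree (coeff R j) \<le> e" for j
  proof (cases "j \<le> degree R")
    case True
    then have "degree (coeff R j) \<le> (\<Sum>j\<le>degree R. degree (coeff R j))"
      by (intro member_le_sum) auto
    then show ?thesis by (simp add: e_def)
  qed (simp add: coeff_eq_0)
  then show ?thesis unfolding bipoly_def R e_def by (intro exI[of _ e] CollectI exI[of _ R]) (auto simp: e_def)
qed

lemma rat_funs_dependent:
  assumes "f \<in> rat_funs" "g \<in> rat_funs"
  obtains D \<psi> where "\<exists>i\<le>D. \<exists>j\<le>D. \<psi> i j \<noteq> 0"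
    "(\<Sum>i\<le>D. \<Sum>j\<le>D. con (\<psi> i j) * (f ^ i * g ^ j)) = 0"
proof -
  obtain u1 u2 where u: "f = u1 / u2" "u2 \<noteq> 0" "u1 \<in> range (eval2 gen y)" "u2 \<in> range (eval2 gen y)"
    using assms(1) by (auto simp: rat_funs_def)
  obtain w1 w2 where w: "g = w1 / w2" "w2 \<noteq> 0" "w1 \<in> range (eval2 gen y)" "w2 \<in> range (eval2 gen y)"
    using assms(2) by (auto simp: rat_funs_def)
  obtain e1 e2 e3 e4 where e: "u1 \<in> bipoly e1" "u2 \<in> bipoly e2" "w1 \<in> bipoly e3" "w2 \<in> bipoly e4"
    using range_bipoly u(3,4) w(3,4) by meson
  define e where "e = e1 + e2 + e3 + e4"
  have mem: "u1 \<in> bipoly e" "u2 \<in> bipoly e" "w1 \<in> bipoly e" "w2 \<in> bipoly e"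
    using e bipoly_mono[of e1 e] bipoly_mono[of e2 e] bipoly_mono[of e3 e] bipoly_mono[of e4 e]
    by (auto simp: e_def)
  obtain D \<psi> where *: "\<exists>i\<le>D. \<exists>j\<le>D. \<psi> i j \<noteq> 0"
    "(\<Sum>i\<le>D. \<Sum>j\<le>D. con (\<psi> i j) * ((u1 / u2) ^ i * (w1 / w2) ^ j)) = 0"
    by (rule algebraically_dependent[OF mem u(2) w(2)])
  show thesis by (rule that[OF *(1)]) (use *(2) in \<open>simp only: u(1) w(1)\<close>)
qed

lemma rat_funsI2: "v \<noteq> 0 \<Longrightarrow> u \<in> range (eval2 gen y) \<Longrightarrow> v \<in> range (eval2 gen y) \<Longrightarrow> u / v \<in> rat_funs"
  unfolding rat_funs_def by blast

lemma one_in_range: "1 \<in> range (eval2 gen y)"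
proof -
  interpret gen: comm_ring_hom "gen :: 'a poly \<Rightarrow> _" by (rule gen_hom)
  interpret ev: comm_ring_hom "eval2 gen y" by (rule gen.eval2_comm_ring_hom)
  show ?thesis using ev.hom_one by (metis rangeI)
qed

lemma rat_funs_mult: "f \<in> rat_funs \<Longrightarrow> g \<in> rat_funs \<Longrightarrow> f * g \<in> rat_funs"
proof -
  interpret gen: comm_ring_hom "gen :: 'a poly \<Rightarrow> _" by (rule gen_hom)
  interpret ev: comm_ring_hom "eval2 gen y" by (rule gen.eval2_comm_ring_hom)
  assume "f \<in> rat_funs" "g \<in> rat_funs"
  then obtain P Q P' Q' where "f = eval2 gen y P / eval2 gen y Q" "g = eval2 gen y P' / eval2 gen y Q'"
    "eval2 gen y Q \<noteq> 0" "eval2 gen y Q' \<noteq> 0" unfolding rat_funs_def by auto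
  then have "f * g = eval2 gen y (P * P') / eval2 gen y (Q * Q')" "eval2 gen y (Q * Q') \<noteq> 0"
    by (simp_all add: ev.hom_mult)
  then show ?thesis using rat_funsI2 by simp
qed

lemma rat_funsI: "u \<in> range (eval2 gen y) \<Longrightarrow> u \<in> rat_funs"
  using rat_funsI2[of 1 u] one_in_range by simp

lemma rat_funs_inverse: "f \<in> rat_funs \<Longrightarrow> inverse f \<in> rat_funs"
proof -
  assume "f \<in> rat_funs"
  then obtain u v where uv: "f = u / v" "v \<noteq> 0" "u \<in> range (eval2 gen y)" "v \<in> range (eval2 gen y)"
    unfolding rat_funs_def by blast
  show ?thesis
  proof (cases "u = 0")
    case True
    then show ?thesis using rat_funsI[OF uv(3)] by (simp add: uv)
  next
    case False
    have "inverse f = v / u" by (simp add: uv(1))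
    then show ?thesis using rat_funsI2[OF False uv(4,3)] by (simp only:)
  qed
qed

end

section \<open>The local ring at a rational point\<close>

text \<open>A rational point is represented by the vector \<open>l\<close> normalised at the
  coordinate \<open>i0\<close>. At a nonsingular point of a curve the tangent space of the affine
  cone has dimension 2, one more than the curve.\<close>

locale curve_point = curve_model n a b y C F H
  for n :: nat and a b :: "'k::field" and y :: "'k alg_closure poly fract alg_closure"
    and C :: "('k alg_closure ^ 'm::finite) set set" and F H +
  fixes p :: nat and i0 :: 'm and l :: "'k alg_closure ^ 'm"
  assumes p: "Factorial_Ring.prime p" "CARD('k) = p"
    and closed_base: "zariski_closed_over_base C"
    and l: "vec.span {l} \<in> C" "l $ i0 = 1" "\<And>i. l $ i \<in> range to_ac"
    and tangent: "vec.dim (cone_tangent_space C (vec.span {l})) = 2"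
begin

abbreviation frob where "frob \<equiv> (\<lambda>z :: 'k alg_closure. z ^ p)"

lemma finite_k: "finite (UNIV :: 'k set)"
  by (rule card_ge_0_finite) (simp only: p(2) prime_gt_0_nat[OF p(1)])

lemma CHAR_k: "CHAR('k) = p"
  using CHAR_eq_CARD_prime[where ?'k = 'k] p by simp

lemma frob_hom: "comm_ring_hom frob"
proof
  have ch: "CHAR('k alg_closure) = p" using CHAR_k by simp
  have pr: "Factorial_Ring.prime CHAR('k alg_closure)" unfolding ch by (rule p(1))
  show "(u + v) ^ p = u ^ p + v ^ p" for u v :: "'k alg_closure"
    by (rule freshmans_dream[OF pr ch[symmetric]])
  have "0 < p" by (rule prime_gt_0_nat[OF p(1)])
  then show "(0 :: 'k alg_closure) ^ p = 0" by (rule zero_power)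
  show "(1 :: 'k alg_closure) ^ p = 1" by (rule power_one)
  show "(u * v) ^ p = u ^ p * v ^ p" for u v :: "'k alg_closure" by (rule power_mult_distrib)
qed

lemma frob_to_ac: "frob (to_ac u) = to_ac u"
proof -
  have "u ^ p = u" using field_power_card[OF finite_k, of u] unfolding p(2) .
  then show ?thesis by (simp only: to_ac_power[symmetric])
qed

text \<open>\<open>X^p - X\<close> has at most \<open>p\<close> roots, and the \<open>p\<close>
  elements of the base field are among them.\<close>

lemma frob_fixed: assumes "z ^ p = z" shows "z \<in> range (to_ac :: 'k \<Rightarrow> _)"
proof -
  define q :: "'k alg_closure poly" where "q = monom 1 p - monom 1 1"
  have p1: "1 < p" using p(1) prime_gt_1_nat by blast
  have "coeff q p = 1" using p1 by (simp add: q_def)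
  then have "q \<noteq> 0" by auto
  have "degree q \<le> p" unfolding q_def using p1
    by (intro degree_diff_le order.trans[OF degree_monom_le]) auto
  have "finite {z. poly q z = 0}" by (rule poly_roots_finite[OF \<open>q \<noteq> 0\<close>])
  moreover have "range (to_ac :: 'k \<Rightarrow> _) \<subseteq> {z. poly q z = 0}"
    using frob_to_ac by (auto simp: q_def poly_monom)
  moreover have "card {z. poly q z = 0} \<le> card (range (to_ac :: 'k \<Rightarrow> _))"
    using card_poly_roots_bound[OF \<open>q \<noteq> 0\<close>] \<open>degree q \<le> p\<close> p(2) card_image[OF inj_to_ac[where ?'a = 'k]]
    by simp
  ultimately have "range (to_ac :: 'k \<Rightarrow> _) = {z. poly q z = 0}" by (rule card_seteq)
  moreover have "poly q z = 0" using assms by (simp add: q_def poly_monom)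
  ultimately show ?thesis by blast
qed

lemma frob_l: "frob (l $ i) = l $ i"
  using l(3)[of i] frob_to_ac by auto

text \<open>As \<open>C\<close> is cut out over the base field, the vector \<open>w\<close> of
  \<open>p\<close>-th roots of the coordinates of \<open>v\<close> represents a point of
  \<open>C\<close> if it is nonzero, and the twisted polynomial at \<open>v\<close> is the
  \<open>p\<close>-th power of \<open>A\<close> at \<open>w\<close>.\<close>

lemma vanishes_frob:
  assumes "vanishes_on C A"
  shows "vanishes_on C (Poly_Mapping.map frob A)"
  unfolding vanishes_on_def
proof (intro ballI)
  interpret fr: comm_ring_hom frob by (rule frob_hom)
  fix L v assume L: "L \<in> C" "v \<in> L"
  obtain S :: "('m, 'k) mpol set" where S: "\<And>B. B \<in> S \<Longrightarrow> \<exists>d. homogeneous d B"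
    "C = zero_locus (Poly_Mapping.map to_ac ` S)"
    using closed_base unfolding zariski_closed_over_base_def by blast
  have "\<forall>i. \<exists>z. z ^ p = v $ i" using nth_root_exists[of p] prime_gt_0_nat[OF p(1)] by blast
  then obtain r where r: "\<And>i. r i ^ p = v $ i" by metis
  define w where "w = (\<chi> i. r i)"
  have w: "(\<chi> i. frob (w $ i)) = v" by (simp add: w_def r Finite_Cartesian_Product.vec_eq_iff)
  have "evl A w = 0"
  proof (cases "w = 0")
    case True
    then show ?thesis using at_0_of_vanishes[OF assms] by simp
  next
    case False
    have "vec.span {w} \<in> C"
      unfolding S(2) zero_locus_def
    proof (intro CollectI conjI ballI)
      show "vec.span {w} \<in> proj_space" using False unfolding proj_space_def by blast
      fix B u assume B: "B \<in> Poly_Mapping.map to_ac ` S" and u: "u \<in> vec.span {w}"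
      obtain B0 where B0: "B0 \<in> S" "B = Poly_Mapping.map to_ac B0" using B by blast
      obtain t where t: "u = t *s w" using u by (auto simp: span_line)
      obtain d where d: "homogeneous d B0" using S(1)[OF B0(1)] by blast
      have "frob (evl B w) = eval_along (\<lambda>c. frob (to_ac c)) B0 v"
        unfolding B0(2) by (simp add: eval_along_map fr.hom_eval_along w)
      also have "\<dots> = evl B v"
        unfolding B0(2) frob_to_ac by (simp add: eval_along_map)
      also have "\<dots> = 0" using L B unfolding S(2) zero_locus_def mpol_eval_eq by blast
      finally have "evl B w = 0" using prime_gt_0_nat[OF p(1)] by simp
      then show "mpol_eval B u = 0"
        unfolding mpol_eval_eq t B0(2) using at_scale[OF homogeneous_map[where f = to_ac, OF to_ac_0 d]] by simp
    qed
    then show ?thesis using assms vec.span_base[of w "{w}"] unfolding vanishes_on_def by blast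
  qed
  moreover have "frob (evl A w) = evl (Poly_Mapping.map frob A) v"
    using prime_gt_0_nat[OF p(1)] by (simp add: fr.hom_eval_along w eval_along_map)
  ultimately show "evl (Poly_Mapping.map frob A) v = 0"
    using prime_gt_0_nat[OF p(1)] by (metis zero_power)
qed

lemma c_i0: "c $ i0 \<noteq> 0"
proof
  define A :: "('m, 'k alg_closure) mpol" where "A = Poly_Mapping.single (Poly_Mapping.single i0 1) 1"
  have gen1: "con (1 :: 'k alg_closure) = 1" by (simp add: gen_def flip: one_pCons)
  assume "c $ i0 = 0"
  then have "eval_along con A c = 0"
    by (simp add: A_def eval_along_single monomial_eval_single gen1)
  moreover have "homogeneous 1 A"
    unfolding A_def
    by (rule homogeneous_single) (simp add: lookup_single when_def)
  ultimately have "vanishes_on C A" by (intro generic_imp_vanishes)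
  then have "evl A l = 0" using l(1) vec.span_base[of l "{l}"] unfolding vanishes_on_def by blast
  then show False using l(2) by (simp add: A_def eval_along_single monomial_eval_single)
qed

definition w where "w = (\<chi> i. c $ i / c $ i0)"

lemma w_i0: "w $ i0 = 1" using c_i0 by (simp add: w_def)

lemma c_eq: "c = (\<chi> i. c $ i0 * w $ i)"
  using c_i0 by (simp add: w_def Finite_Cartesian_Product.vec_eq_iff)

abbreviation evw where "evw P \<equiv> eval_along con P w"

lemma c_scale: "homogeneous d A \<Longrightarrow> eval_along h A c = c $ i0 ^ d * eval_along h A w"
proof -
  assume "homogeneous d A"
  have "eval_along h A c = eval_along h A (\<chi> i. c $ i0 * w $ i)" by (rule arg_cong[OF c_eq])
  also have "\<dots> = c $ i0 ^ d * eval_along h A w" by (rule eval_along_scale) fact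
  finally show ?thesis .
qed

lemma c_homogenize:
  fixes P :: "('m, 'k alg_closure) mpol"
  assumes "comm_ring_hom h"
  shows "eval_along h (homogenize i0 P) c
    = c $ i0 ^ Max ((\<lambda>m. \<Sum>j\<in>UNIV. lkp m j) ` Poly_Mapping.keys P) * eval_along h P w"
  by (rule trans[OF c_scale[OF homogeneous_homogenize]])
    (simp only: comm_ring_hom.eval_along_homogenize[OF assms w_i0])

text \<open>A relation between the affine coordinates \<open>w\<close> of the generic point
  homogenizes to a form vanishing on \<open>C\<close>; this can be specialised to \<open>l\<close>,
  or twisted by Frobenius and read again at the generic point.\<close>

lemma relation_at_point:
  assumes "evw P = 0"
  shows "evl P l = 0" "eval_along (\<lambda>z. con (frob z)) P w = 0"
proof -
  define A where "A = homogenize i0 P"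
  have "eval_along con A c = 0"
    unfolding A_def c_homogenize[OF con_hom] assms by simp
  then have A: "vanishes_on C A" unfolding A_def by (rule generic_imp_vanishes[OF homogeneous_homogenize])
  then have "evl A l = 0" using l(1) vec.span_base[of l "{l}"] unfolding vanishes_on_def by blast
  then show "evl P l = 0"
    unfolding A_def by (simp only: comm_ring_hom.eval_along_homogenize[OF id_hom l(2)])
  have hom: "comm_ring_hom (\<lambda>z. con (frob z))"
  proof -
    interpret fr: comm_ring_hom frob by (rule frob_hom)
    interpret con: comm_ring_hom "con :: 'k alg_closure \<Rightarrow> _" by (rule con_hom)
    show ?thesis
      by unfold_locales (simp_all only: fr.hom_add fr.hom_mult fr.hom_zero fr.hom_one
          con.hom_add con.hom_mult con.hom_zero con.hom_one)
  qed
  have "eval_along con (Poly_Mapping.map frob A) c = 0"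
    by (rule vanishes_imp_generic[OF vanishes_frob[OF A]])
  then have "eval_along (\<lambda>z. con (frob z)) A c = 0"
    using prime_gt_0_nat[OF p(1)] by (subst (asm) eval_along_map) (auto simp: gen_def)
  then show "eval_along (\<lambda>z. con (frob z)) P w = 0"
    unfolding A_def c_homogenize[OF hom] using c_i0 by simp
qed

definition R where "R = {evw P / evw Q | P Q. evl Q l \<noteq> 0}"

text \<open>The choice is immaterial by \<open>ev_quotient\<close>: equal fractions give a relation
  that specialises to \<open>l\<close>.\<close>

definition ev where "ev f = (SOME v. \<exists>P Q. evl Q l \<noteq> 0 \<and> f = evw P / evw Q \<and> v = evl P l / evl Q l)"

sublocale evw: comm_ring_hom "\<lambda>P. eval_along (\<lambda>z :: 'k alg_closure. con z) P w"
  by (rule comm_ring_hom.eval_along_comm_ring_hom[OF con_hom])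

sublocale evl: comm_ring_hom "\<lambda>P. eval_along (\<lambda>z :: 'k alg_closure. z) P l"
  by (rule comm_ring_hom.eval_along_comm_ring_hom[OF id_hom])

lemma evw_nonzero: "evl Q l \<noteq> 0 \<Longrightarrow> evw Q \<noteq> 0"
  using relation_at_point(1) by blast

lemma ev_quotient:
  assumes "evl Q l \<noteq> 0"
  shows "ev (evw P / evw Q) = evl P l / evl Q l"
  unfolding ev_def
proof (rule some_equality)
  show "\<exists>P' Q'. evl Q' l \<noteq> 0 \<and> evw P / evw Q = evw P' / evw Q' \<and> evl P l / evl Q l = evl P' l / evl Q' l"
    using assms by blast
  fix v assume "\<exists>P' Q'. evl Q' l \<noteq> 0 \<and> evw P / evw Q = evw P' / evw Q' \<and> v = evl P' l / evl Q' l"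
  then obtain P' Q' where P': "evl Q' l \<noteq> 0" "evw P / evw Q = evw P' / evw Q'" "v = evl P' l / evl Q' l"
    by blast
  have "evw P * evw Q' = evw P' * evw Q"
    using P'(2) evw_nonzero[OF assms] evw_nonzero[OF P'(1)] by (simp add: frac_eq_eq)
  then have "evw (P * Q' - P' * Q) = 0" by (simp add: evw.hom_minus evw.hom_mult)
  then have "evl P l * evl Q' l = evl P' l * evl Q l"
    using relation_at_point(1)[of "P * Q' - P' * Q"] by (simp add: evl.hom_minus evl.hom_mult)
  then show "v = evl P l / evl Q l" unfolding P'(3) using assms P'(1) by (simp add: frac_eq_eq)
qed

lemma RI: "evl Q l \<noteq> 0 \<Longrightarrow> evw P / evw Q \<in> R"
  unfolding R_def by blast

lemma local_alg_R: "local_alg R ev con"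
proof (rule local_alg.intro)
  have const: "evw (Poly_Mapping.single 0 z) = con z" "evl (Poly_Mapping.single 0 z) l = z" for z
    by (simp_all add: eval_along_single gen_def)
  have poly: "evw P = evw P / evw 1" "evl (1 :: ('m, 'k alg_closure) mpol) l \<noteq> 0" for P
    by (simp_all add: evw.hom_one evl.hom_one)
  show "con z \<in> R" for z
    using RI[OF poly(2), of "Poly_Mapping.single 0 z"] poly(1) const by metis
  show "ev (con z) = z" for z
    using ev_quotient[OF poly(2), of "Poly_Mapping.single 0 z"] by (simp add: const evw.hom_one evl.hom_one)
  show "f + g \<in> R" "ev (f + g) = ev f + ev g" "f * g \<in> R" "ev (f * g) = ev f * ev g"
    if fg: "f \<in> R" "g \<in> R" for f g
  proof -
    obtain P Q where f: "f = evw P / evw Q" "evl Q l \<noteq> 0" using fg(1) unfolding R_def by blast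
    obtain P' Q' where g: "g = evw P' / evw Q'" "evl Q' l \<noteq> 0" using fg(2) unfolding R_def by blast
    note nz = evw_nonzero[OF f(2)] evw_nonzero[OF g(2)]
    have QQ: "evl (Q * Q') l \<noteq> 0" using f g by (simp add: evl.hom_mult)
    have add: "f + g = evw (P * Q' + P' * Q) / evw (Q * Q')"
      using nz by (simp add: f g evw.hom_add evw.hom_mult add_frac_eq)
    have mult: "f * g = evw (P * P') / evw (Q * Q')"
      by (simp add: f g evw.hom_mult)
    show "f + g \<in> R" unfolding add by (rule RI[OF QQ])
    show "f * g \<in> R" unfolding mult by (rule RI[OF QQ])
    show "ev (f + g) = ev f + ev g"
      unfolding add ev_quotient[OF QQ] unfolding f(1) g(1) ev_quotient[OF f(2)] ev_quotient[OF g(2)]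
      using f(2) g(2) by (simp add: evl.hom_add evl.hom_mult add_frac_eq)
    show "ev (f * g) = ev f * ev g"
      unfolding mult ev_quotient[OF QQ] unfolding f(1) g(1) ev_quotient[OF f(2)] ev_quotient[OF g(2)]
      by (simp add: evl.hom_mult)
  qed
  show "inverse f \<in> R" if f: "f \<in> R" "ev f \<noteq> 0" for f
  proof -
    obtain P Q where PQ: "f = evw P / evw Q" "evl Q l \<noteq> 0" using f(1) unfolding R_def by blast
    then have "evl P l \<noteq> 0" using f(2) ev_quotient[OF PQ(2)] by auto
    then show ?thesis using RI[of P Q] by (simp add: PQ)
  qed
qed (rule con_hom)

sublocale loc: local_alg R ev "\<lambda>z. gen [:z:]" by (rule local_alg_R)

lemma w_in: "w $ i \<in> R" "ev (w $ i) = l $ i"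
proof -
  define V :: "('m, 'k alg_closure) mpol" where "V = Poly_Mapping.single (Poly_Mapping.single i 1) 1"
  have gen1: "con (1 :: 'k alg_closure) = 1" by (simp add: gen_def flip: one_pCons)
  have V: "evw V = w $ i" "evl V l = l $ i"
    by (simp_all add: V_def eval_along_single monomial_eval_single gen1)
  have one: "evl (1 :: ('m, 'k alg_closure) mpol) l \<noteq> 0" by (simp add: evl.hom_one)
  show "w $ i \<in> R" using RI[OF one, of V] by (simp add: V evw.hom_one)
  show "ev (w $ i) = l $ i" using ev_quotient[OF one, of V] by (simp add: V evw.hom_one evl.hom_one)
qed

lemma evw_in: "evw P \<in> R" "ev (evw P) = evl P l"
  using RI[of 1 P] ev_quotient[of 1 P] by (simp_all add: evw.hom_one evl.hom_one)

lemma F3_w_nonzero: "evw (Fa 3) \<noteq> 0"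
  using F3_c_nonzero unfolding c_scale[OF hom_Fa] by auto

lemma xy_w: "x = evw (Fa 1) / evw (Fa 3)" "y = evw (Fa 2) / evw (Fa 3)"
proof -
  have "eval_along con (Fa i) c = c $ i0 ^ dF * evw (Fa i)" for i
    by (rule c_scale[OF hom_Fa])
  then show "x = evw (Fa 1) / evw (Fa 3)" "y = evw (Fa 2) / evw (Fa 3)"
    using xy_eq c_i0 by simp_all
qed

lemma R_subset_rat_funs: "R \<subseteq> rat_funs"
proof
  have evw: "evw P \<in> rat_funs" for P
  proof -
    have ev_form: "eval_along con Q (vector [x, y, 1]) \<in> rat_funs" for Q :: "(3, 'k alg_closure) mpol"
      by (rule rat_funsI, rule range_eqI, rule eval_affine_lift(2)[symmetric])
    have "c $ i0 \<in> rat_funs" using ev_form[of "Ha i0"] by (simp add: c_def)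
    then have "inverse (c $ i0 ^ e) \<in> rat_funs" for e
    proof (induction e)
      case 0
      show ?case using rat_funsI[OF one_in_range] by simp
    next
      case (Suc e)
      then show ?case by (simp add: rat_funs_mult rat_funs_inverse)
    qed
    moreover have "eval_along con (homogenize i0 P) c \<in> rat_funs"
      unfolding con_comp_H[symmetric] by (rule ev_form)
    ultimately have "inverse (c $ i0 ^ e) * eval_along con (homogenize i0 P) c \<in> rat_funs" for e
      by (rule rat_funs_mult)
    then show ?thesis using c_i0 unfolding c_homogenize[OF con_hom]
      by (metis (no_types, lifting) left_inverse mult.assoc mult_1 power_not_zero)
  qed
  fix f assume "f \<in> R"
  then obtain P Q where "f = evw P / evw Q" unfolding R_def by blast
  then show "f \<in> rat_funs" unfolding divide_inverse by (simp add: rat_funs_mult rat_funs_inverse evw)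
qed

text \<open>The dimension of the curve enters here, through the algebraic dependence of
  \<open>f\<close> and \<open>g'\<close>.\<close>

lemma arch:
  assumes "g' \<in> R" "ev g' = 0" "f \<in> R" "f \<noteq> 0"
  shows "\<exists>e. \<forall>h\<in>R. f \<noteq> g' ^ e * h"
proof -
  obtain D \<psi> where "\<exists>i\<le>D. \<exists>j\<le>D. \<psi> i j \<noteq> 0"
    "(\<Sum>i\<le>D. \<Sum>j\<le>D. con (\<psi> i j) * (f ^ i * g' ^ j)) = 0"
    using rat_funs_dependent[of f g'] assms R_subset_rat_funs by blast
  then show ?thesis using loc.not_infinitely_divisible[OF assms(3,4,1,2)] by blast
qed

definition z where "z = (\<chi> i. w $ i - con (l $ i))"

lemma z_in: "z $ i \<in> R" "ev (z $ i) = 0"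
  using loc.diff_in[OF w_in(1) loc.\<iota>_in] loc.ev_diff[OF w_in(1) loc.\<iota>_in] w_in(2) by (simp_all add: z_def)

lemma taylor_w: "loc.taylor z (evw P) (evl P l) (\<lambda>j. mpol_pderiv_eval j P l)"
  by (rule loc.taylor_eval_along[OF z_in]) (simp add: z_def)

text \<open>A form vanishing on \<open>C\<close> vanishes at \<open>w\<close> and at
  \<open>l\<close>, so its Taylor expansion leaves only the linear term, which is therefore of
  second order.\<close>

lemma gradient_second_order:
  assumes A: "A \<in> vanishing_ideal C" and v: "v \<in> vec.span {l}"
  shows "(\<Sum>i\<in>UNIV. con (mpol_pderiv_eval i A v) * z $ i) \<in> loc.second_order z"
proof -
  obtain d where d: "homogeneous d A" and van: "vanishes_on C A"
    using A unfolding vanishing_ideal_def vanishes_on_def mpol_eval_eq by blast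
  obtain t where t: "v = t *s l" using v by (auto simp: span_line)
  have "eval_along con A c = 0" by (rule vanishes_imp_generic[OF van])
  then have "evw A = 0" using c_i0 unfolding c_scale[OF d] by simp
  moreover have "evl A l = 0" by (rule relation_at_point(1)) fact
  ultimately have "- (\<Sum>i\<in>UNIV. con (mpol_pderiv_eval i A l) * z $ i) \<in> loc.second_order z"
    using taylor_w[of A] unfolding loc.taylor_def by (simp add: gen_def)
  then have base: "(\<Sum>i\<in>UNIV. con (mpol_pderiv_eval i A l) * z $ i) \<in> loc.second_order z"
    using loc.second_order_minus by fastforce
  have "(\<Sum>i\<in>UNIV. con (mpol_pderiv_eval i A v) * z $ i)
      = con (t ^ (d - 1)) * (\<Sum>i\<in>UNIV. con (mpol_pderiv_eval i A l) * z $ i)"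
    unfolding t scale_chi mpol_pderiv_eval_scale[OF d] sum_distrib_left
    by (intro sum.cong refl) (simp only: loc.con.hom_mult mult.assoc)
  then show ?thesis using loc.second_order_mult[OF loc.\<iota>_in base] by simp
qed

lemma l_tangent: "l \<in> cone_tangent_space C (vec.span {l})"
  unfolding cone_tangent_space_def
proof (intro CollectI ballI)
  fix A v assume A: "A \<in> vanishing_ideal C" and v: "v \<in> vec.span {l}"
  obtain d where d: "homogeneous d A" and van: "vanishes_on C A"
    using A unfolding vanishing_ideal_def vanishes_on_def mpol_eval_eq by blast
  obtain t where t: "v = t *s l" using v by (auto simp: span_line)
  have "evl A l = 0" using van l(1) vec.span_base[of l "{l}"] unfolding vanishes_on_def by blast
  then have 0: "(\<Sum>j\<in>UNIV. mpol_pderiv_eval j A l * l $ j) = 0" by (simp add: euler_homogeneous[OF d])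
  have "(\<Sum>j\<in>UNIV. mpol_pderiv_eval j A v * l $ j) = t ^ (d - 1) * (\<Sum>j\<in>UNIV. mpol_pderiv_eval j A l * l $ j)"
    unfolding t scale_chi mpol_pderiv_eval_scale[OF d] sum_distrib_left by (simp only: mult.assoc)
  then show "(\<Sum>j\<in>UNIV. mpol_pderiv_eval j A v * l $ j) = 0" unfolding 0 by simp
qed

text \<open>The tangent space of the cone is spanned by \<open>l\<close> and one more vector
  \<open>t0\<close>. By duality a linear form killing both is a combination of gradients, so its
  value on \<open>z\<close> is of second order. Hence all \<open>z $ i\<close> are multiples of one
  \<open>z $ i1\<close> modulo second order, Nakayama's lemma makes this exact, and Taylor expansion
  extends it to all of the maximal ideal.\<close>

lemma uniformizer: "\<exists>\<tau>\<in>R. ev \<tau> = 0 \<and> (\<forall>f\<in>R. ev f = 0 \<longrightarrow> (\<exists>h\<in>R. f = \<tau> * h))"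
proof -
  define T where "T = cone_tangent_space C (vec.span {l})"
  have l0: "l \<noteq> 0" using l(2) by auto
  have "vec.independent {l}" using l0 by (simp add: vec.independent_insert)
  then obtain B where B: "{l} \<subseteq> B" "B \<subseteq> T" "vec.independent B" "T \<subseteq> vec.span B"
    using vec.maximal_independent_subset_extend[of "{l}" T] l_tangent unfolding T_def by blast
  have "card B = 2" using vec.basis_card_eq_dim[OF B(2) B(4) B(3)] tangent unfolding T_def by simp
  then obtain t0 where t0: "B = {l, t0}" "t0 \<noteq> l"
    using B(1) by (metis (no_types, opaque_lifting) card_2_iff doubleton_eq_iff insert_subset insertE singletonD)
  \<comment> \<open>Subtracting a multiple of \<open>l\<close> makes the coordinate
    \<open>i0\<close> vanish; \<open>t\<close> below is \<open>t1\<close> scaled to have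
    \<open>t i1 = 1\<close>.\<close>
  define t1 where "t1 = t0 - (t0 $ i0) *s l"
  have "t1 \<noteq> 0"
  proof
    assume "t1 = 0"
    then have "t0 = (t0 $ i0) *s l" by (simp add: t1_def)
    then have "t0 \<in> vec.span {l}" by (auto simp: span_line)
    moreover have "t0 \<notin> vec.span (B - {t0})" using B(3) t0 unfolding vec.dependent_def by blast
    ultimately show False using t0 by (simp add: insert_Diff_if)
  qed
  then obtain i1 where i1: "t1 $ i1 \<noteq> 0" by (auto simp: Finite_Cartesian_Product.vec_eq_iff)
  define t where "t i = t1 $ i / t1 $ i1" for i
  have t_i0: "t i0 = 0" using l(2) by (simp add: t_def t1_def)
  have t_i1: "t i1 = 1" using i1 by (simp add: t_def)
  define \<Gamma> where "\<Gamma> = {(\<chi> j. mpol_pderiv_eval j A v) | A v. A \<in> vanishing_ideal C \<and> v \<in> vec.span {l}}"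
  define N where "N = {\<alpha> :: 'k alg_closure ^ 'm. (\<Sum>i\<in>UNIV. con (\<alpha> $ i) * z $ i) \<in> loc.second_order z}"
  have "vec.subspace N"
    unfolding vec.subspace_def N_def
  proof (intro conjI allI ballI CollectI)
    show "(\<Sum>i\<in>UNIV. con ((0 :: 'k alg_closure ^ 'm) $ i) * z $ i) \<in> loc.second_order z"
      by (simp add: gen_def loc.second_order_0)
    show "(\<Sum>i\<in>UNIV. con ((u + v) $ i) * z $ i) \<in> loc.second_order z"
      if "u \<in> {\<alpha>. (\<Sum>i\<in>UNIV. con (\<alpha> $ i) * z $ i) \<in> loc.second_order z}"
        "v \<in> {\<alpha>. (\<Sum>i\<in>UNIV. con (\<alpha> $ i) * z $ i) \<in> loc.second_order z}" for u v
    proof -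
      have "(\<Sum>i\<in>UNIV. con ((u + v) $ i) * z $ i)
          = (\<Sum>i\<in>UNIV. con (u $ i) * z $ i) + (\<Sum>i\<in>UNIV. con (v $ i) * z $ i)"
        by (simp only: vector_add_component loc.con.hom_add distrib_right sum.distrib)
      then show ?thesis using that loc.second_order_add by simp
    qed
    show "(\<Sum>i\<in>UNIV. con ((s *s v) $ i) * z $ i) \<in> loc.second_order z"
      if "v \<in> {\<alpha>. (\<Sum>i\<in>UNIV. con (\<alpha> $ i) * z $ i) \<in> loc.second_order z}" for s v
    proof -
      have "(\<Sum>i\<in>UNIV. con ((s *s v) $ i) * z $ i) = con s * (\<Sum>i\<in>UNIV. con (v $ i) * z $ i)"
        by (simp only: vector_smult_component loc.con.hom_mult sum_distrib_left mult.assoc)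
      then show ?thesis using that loc.second_order_mult[OF loc.\<iota>_in] by simp
    qed
  qed
  moreover have "\<Gamma> \<subseteq> N" unfolding \<Gamma>_def N_def using gradient_second_order by auto
  ultimately have spanN: "vec.span \<Gamma> \<subseteq> N" by (intro vec.span_minimal)
  have z_i0: "z $ i0 = 0" using w_i0 l(2) by (simp add: z_def gen_def flip: one_pCons)
  have rel: "z $ i - con (t i) * z $ i1 \<in> loc.second_order z" for i
  proof -
    \<comment> \<open>\<open>\<alpha>\<close> is the linear form
      \<open>v_i - t_i v_i1 - \<beta> v_i0\<close>, with \<open>\<beta>\<close> chosen so that it
      kills \<open>l\<close>; it then kills \<open>t0\<close> as well. On \<open>z\<close> the last
      term disappears because \<open>z $ i0 = 0\<close>.\<close>
    define \<beta> where "\<beta> = l $ i - t i * l $ i1"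
    define \<alpha> :: "'k alg_closure ^ 'm" where
      "\<alpha> = (\<chi> j. (if j = i then 1 else 0) - (if j = i1 then t i else 0) - (if j = i0 then \<beta> else 0))"
    have \<alpha>_sum: "(\<Sum>j\<in>UNIV. \<alpha> $ j * v $ j) = v $ i - t i * v $ i1 - \<beta> * v $ i0" for v
    proof -
      have "(\<Sum>j\<in>UNIV. \<alpha> $ j * v $ j) = (\<Sum>j\<in>UNIV. (if j = i then v $ j else 0)
          - (if j = i1 then t i * v $ j else 0) - (if j = i0 then \<beta> * v $ j else 0))"
        by (intro sum.cong refl) (auto simp: \<alpha>_def algebra_simps)
      then show ?thesis by (simp add: sum_subtractf)
    qed
    have \<alpha>_l: "(\<Sum>j\<in>UNIV. \<alpha> $ j * l $ j) = 0" unfolding \<alpha>_sum l(2) by (simp add: \<beta>_def)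
    have t0_eq: "t0 $ j = t1 $ i1 * t j + t0 $ i0 * l $ j" for j
      using i1 by (simp add: t_def t1_def)
    have \<alpha>_t0: "(\<Sum>j\<in>UNIV. \<alpha> $ j * t0 $ j) = 0"
    proof -
      have "t0 $ i - t i * t0 $ i1 - \<beta> * t0 $ i0
          = (t1 $ i1 * t i + t0 $ i0 * l $ i) - t i * (t1 $ i1 * t i1 + t0 $ i0 * l $ i1) - \<beta> * t0 $ i0"
        using t0_eq[of i] t0_eq[of i1] by presburger
      also have "\<dots> = 0" by (simp add: t_i1 \<beta>_def algebra_simps)
      finally show ?thesis unfolding \<alpha>_sum .
    qed
    have "\<alpha> \<in> vec.span \<Gamma>"
    proof (rule double_annihilator)
      fix v assume v: "\<And>\<gamma>. \<gamma> \<in> \<Gamma> \<Longrightarrow> (\<Sum>j\<in>UNIV. \<gamma> $ j * v $ j) = 0"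
      have "v \<in> T" unfolding T_def cone_tangent_space_def
      proof (intro CollectI ballI)
        fix A u assume "A \<in> vanishing_ideal C" "u \<in> vec.span {l}"
        then have "(\<chi> j. mpol_pderiv_eval j A u) \<in> \<Gamma>" unfolding \<Gamma>_def by blast
        from v[OF this] show "(\<Sum>j\<in>UNIV. mpol_pderiv_eval j A u * v $ j) = 0" by simp
      qed
      then have "v \<in> vec.span {l, t0}" using B(4) t0(1) by blast
      then obtain s1 s2 where "v = s1 *s l + s2 *s t0"
        by (auto simp: vec.span_insert vec.span_singleton) (metis add.commute diff_add_cancel)
      then have "(\<Sum>j\<in>UNIV. \<alpha> $ j * v $ j)
          = s1 * (\<Sum>j\<in>UNIV. \<alpha> $ j * l $ j) + s2 * (\<Sum>j\<in>UNIV. \<alpha> $ j * t0 $ j)"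
        by (simp add: sum_distrib_left sum.distrib distrib_left mult_ac)
      then show "(\<Sum>j\<in>UNIV. \<alpha> $ j * v $ j) = 0" unfolding \<alpha>_l \<alpha>_t0 by simp
    qed
    then have "(\<Sum>j\<in>UNIV. con (\<alpha> $ j) * z $ j) \<in> loc.second_order z" using spanN unfolding N_def by blast
    also have "(\<Sum>j\<in>UNIV. con (\<alpha> $ j) * z $ j) = (\<Sum>j\<in>UNIV. (if j = i then z $ j else 0)
          - (if j = i1 then con (t i) * z $ j else 0) - (if j = i0 then con \<beta> * z $ j else 0))"
      by (intro sum.cong refl)
        (auto simp: \<alpha>_def loc.con.hom_minus left_diff_distrib loc.con.hom_one loc.con.hom_zero)
    also have "\<dots> = z $ i - con (t i) * z $ i1" by (simp add: sum_subtractf z_i0)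
    finally show ?thesis .
  qed
  have z_div: "\<exists>h\<in>R. z $ i = z $ i1 * h" for i
  proof (rule loc.nakayama[where t = "\<chi> i. con (t i)"])
    show "\<exists>A. (\<forall>j. A j \<in> R \<and> ev (A j) = 0) \<and> z $ i - (\<chi> i. con (t i)) $ i * z $ i1 = (\<Sum>j\<in>UNIV. A j * z $ j)" for i
      using rel[of i] unfolding loc.second_order_def by auto
  qed (simp_all add: z_in)
  have "\<exists>h\<in>R. f = z $ i1 * h" if f: "f \<in> R" "ev f = 0" for f
  proof -
    obtain P Q where PQ: "f = evw P / evw Q" "evl Q l \<noteq> 0" using f(1) unfolding R_def by blast
    have "evl P l = 0" using f(2) PQ(2) unfolding PQ(1) ev_quotient[OF PQ(2)] by simp
    then have "evw P - (\<Sum>i\<in>UNIV. con (mpol_pderiv_eval i P l) * z $ i) \<in> loc.second_order z"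
      using taylor_w[of P] unfolding loc.taylor_def by (simp add: gen_def)
    then obtain A where A: "\<And>j. A j \<in> R"
      "evw P - (\<Sum>i\<in>UNIV. con (mpol_pderiv_eval i P l) * z $ i) = (\<Sum>j\<in>UNIV. A j * z $ j)"
      unfolding loc.second_order_def by auto
    have "evw P = (\<Sum>i\<in>UNIV. (con (mpol_pderiv_eval i P l) + A i) * z $ i)"
      using A(2) by (simp add: distrib_right sum.distrib diff_eq_eq add.commute)
    also obtain h where h: "\<And>i. h i \<in> R" "\<And>i. z $ i = z $ i1 * h i" using z_div by metis
    have "(con (mpol_pderiv_eval i P l) + A i) * z $ i = z $ i1 * ((con (mpol_pderiv_eval i P l) + A i) * h i)" for i
      by (subst h(2)) (simp only: mult_ac)
    then have "(\<Sum>i\<in>UNIV. (con (mpol_pderiv_eval i P l) + A i) * z $ i)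
        = z $ i1 * (\<Sum>i\<in>UNIV. (con (mpol_pderiv_eval i P l) + A i) * h i)"
      by (simp only: sum_distrib_left)
    finally have f_eq: "f = z $ i1 * ((\<Sum>i\<in>UNIV. (con (mpol_pderiv_eval i P l) + A i) * h i) * inverse (evw Q))"
      unfolding PQ(1) by (simp only: divide_inverse mult.assoc)
    have inv: "inverse (evw Q) \<in> R"
      using loc.inverse_in[OF evw_in(1)] PQ(2) by (simp add: evw_in)
    show ?thesis
      by (rule bexI, rule f_eq, intro loc.mult_in loc.sum_in loc.add_in loc.\<iota>_in A(1) h(1) inv)
  qed
  then show ?thesis using z_in by blast
qed

lemma R_valuation:
  assumes "f \<in> R" "g' \<in> R" "f \<noteq> 0" "g' \<noteq> 0"
  shows "f / g' \<in> R \<or> g' / f \<in> R"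
proof -
  obtain \<tau> where \<tau>: "\<tau> \<in> R" "ev \<tau> = 0" "\<And>f. f \<in> R \<Longrightarrow> ev f = 0 \<Longrightarrow> \<exists>h\<in>R. f = \<tau> * h"
    using uniformizer by blast
  show ?thesis by (rule loc.valuation_ring[OF \<tau> arch[OF \<tau>(1,2)] assms])
qed

text \<open>Applying Frobenius to the coefficients of a representation \<open>P / Q\<close> regular
  at \<open>l\<close> gives another representation of \<open>f\<close>, because \<open>U\<close> and
  \<open>V\<close> are fixed, and its value is the \<open>p\<close>-th power of the value of
  \<open>f\<close>.\<close>

lemma rational_value:
  assumes f: "f \<in> R" "f * evw V = evw U" "evw V \<noteq> 0"
    and UV: "\<And>m. frob (lkp U m) = lkp U m" "\<And>m. frob (lkp V m) = lkp V m"
  shows "ev f \<in> range (to_ac :: 'k \<Rightarrow> _)"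
proof (rule frob_fixed)
  obtain P Q where PQ: "f = evw P / evw Q" "evl Q l \<noteq> 0" using f(1) unfolding R_def by blast
  note Q0 = evw_nonzero[OF PQ(2)]
  let ?tw = "\<lambda>P. eval_along (\<lambda>z. con (frob z)) P w"
  interpret tw: comm_ring_hom ?tw
  proof -
    interpret fr: comm_ring_hom frob by (rule frob_hom)
    have "comm_ring_hom (\<lambda>z. con (frob z))"
      by unfold_locales (simp_all only: fr.hom_add fr.hom_mult fr.hom_zero fr.hom_one
          loc.con.hom_add loc.con.hom_mult loc.con.hom_zero loc.con.hom_one)
    then show "comm_ring_hom ?tw" by (rule comm_ring_hom.eval_along_comm_ring_hom)
  qed
  have frob0: "(0 :: 'k alg_closure) ^ p = 0" using prime_gt_0_nat[OF p(1)] by simp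
  have con0: "con (0 :: 'k alg_closure) = 0" by (simp add: gen_def)
  have tw_UV: "?tw U = evw U" "?tw V = evw V" unfolding eval_along_def UV by simp_all
  have tw_map: "?tw B = evw (Poly_Mapping.map frob B)" for B
    by (rule eval_along_map[where f = frob and h = con, OF frob0 con0, symmetric])
  have "evw P * evw V = evw U * evw Q" using f(2) Q0 unfolding PQ(1) by (simp add: field_simps)
  then have "evw (P * V - U * Q) = 0" by (simp add: evw.hom_minus evw.hom_mult)
  then have "?tw (P * V - U * Q) = 0" by (rule relation_at_point(2))
  then have "?tw P * evw V = evw U * ?tw Q" by (simp add: tw.hom_minus tw.hom_mult tw_UV)
  also have "\<dots> = (f * ?tw Q) * evw V" unfolding f(2)[symmetric] by (simp only: mult_ac)
  finally have eq: "?tw P = f * ?tw Q" using f(3) by simp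
  have at_l: "evl (Poly_Mapping.map frob B) l = frob (evl B l)" for B
  proof -
    interpret fr: comm_ring_hom frob by (rule frob_hom)
    have "(\<chi> i. frob (l $ i)) = l" by (simp add: frob_l Finite_Cartesian_Product.vec_eq_iff)
    then show ?thesis using eval_along_map[of frob "\<lambda>c. c", OF frob0] by (simp add: fr.hom_eval_along)
  qed
  have Qf: "evl (Poly_Mapping.map frob Q) l \<noteq> 0" unfolding at_l using PQ(2) by simp
  then have "f = evw (Poly_Mapping.map frob P) / evw (Poly_Mapping.map frob Q)"
    using eq evw_nonzero[OF Qf] unfolding tw_map by simp
  then have "ev f = frob (evl P l) / frob (evl Q l)"
    using ev_quotient[OF Qf, of "Poly_Mapping.map frob P"] unfolding at_l by simp
  also have "\<dots> = frob (ev f)" unfolding PQ(1) ev_quotient[OF PQ(2)] by (simp add: power_divide)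
  finally show "ev f ^ p = ev f" ..
qed

lemma lkp_Fa: "frob (lkp (Fa i) m) = lkp (Fa i) m"
  using prime_gt_0_nat[OF p(1)] frob_to_ac
  by (auto simp: Fa_def Poly_Mapping.map.rep_eq when_def)

end

section \<open>The closure of the curve in the product of two lines\<close>

text \<open>For \<open>u\<close> a generic point of an affine plane curve and \<open>q\<close> a
  point on it, this is the local ring at \<open>q\<close>.\<close>

definition point_ring :: "'a::alg_closed_field poly fract alg_closure ^ 2 \<Rightarrow> 'a ^ 2 \<Rightarrow> 'a poly fract alg_closure set" where
  "point_ring u q = {eval_along (\<lambda>z. gen [:z:]) P u / eval_along (\<lambda>z. gen [:z:]) Q u | P Q. evl Q q \<noteq> 0}"

context local_alg
begin

text \<open>The equation is that of a nonsingular curve of bidegree \<open>(n, n)\<close>, in any of its four affine charts.\<close>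

lemma coordinate_divides:
  assumes \<xi>: "\<xi> \<in> R" "\<eta> \<in> R" and n: "of_nat n \<noteq> (0::'c)" "0 < n"
    and eq: "\<iota> \<alpha> * (\<xi> ^ n * \<eta> ^ n) + \<iota> \<beta> * \<xi> ^ n + \<iota> \<gamma> * \<eta> ^ n + \<iota> \<delta> = 0"
    and nz: "\<beta> \<noteq> 0" "\<gamma> \<noteq> 0" "\<delta> \<noteq> 0" "\<alpha> * \<delta> \<noteq> \<beta> * \<gamma>"
  shows "(\<exists>h\<in>R. \<xi> - \<iota> (ev \<xi>) = (\<eta> - \<iota> (ev \<eta>)) * h) \<or> (\<exists>h\<in>R. \<eta> - \<iota> (ev \<eta>) = (\<xi> - \<iota> (ev \<xi>)) * h)"
proof -
  define u v where "u = ev \<xi>" and "v = ev \<eta>"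
  obtain n' where n': "n = Suc n'" using n(2) by (cases n) auto
  define S where "S \<zeta> = (\<Sum>i<n. \<zeta> ^ i * \<iota> (ev \<zeta>) ^ (n' - i))" for \<zeta>
  have S: "S \<zeta> \<in> R" "ev (S \<zeta>) = of_nat n * ev \<zeta> ^ n'" "\<zeta> ^ n - \<iota> (ev \<zeta>) ^ n = (\<zeta> - \<iota> (ev \<zeta>)) * S \<zeta>"
    if "\<zeta> \<in> R" for \<zeta>
  proof -
    show "S \<zeta> \<in> R" unfolding S_def using that by (intro sum_in mult_in power_in) auto
    have "ev (S \<zeta>) = (\<Sum>i<n. ev \<zeta> ^ i * ev \<zeta> ^ (n' - i))"
      unfolding S_def using that by (subst ev_sum) (auto simp: ev_mult ev_power mult_in power_in)
    also have "\<dots> = (\<Sum>i<n. ev \<zeta> ^ n')"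
      by (intro sum.cong refl) (simp add: n' flip: power_add)
    finally show "ev (S \<zeta>) = of_nat n * ev \<zeta> ^ n'" by simp
    show "\<zeta> ^ n - \<iota> (ev \<zeta>) ^ n = (\<zeta> - \<iota> (ev \<zeta>)) * S \<zeta>"
      unfolding S_def n' by (rule diff_power_eq_sum)
  qed
  have eq0: "\<alpha> * (u ^ n * v ^ n) + \<beta> * u ^ n + \<gamma> * v ^ n + \<delta> = 0"
  proof -
    have "ev (\<iota> \<alpha> * (\<xi> ^ n * \<eta> ^ n) + \<iota> \<beta> * \<xi> ^ n + \<iota> \<gamma> * \<eta> ^ n + \<iota> \<delta>) = 0" unfolding eq by simp
    then show ?thesis
      using \<xi> by (simp add: ev_add ev_mult ev_power add_in mult_in power_in u_def v_def)
  qed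
  have "(\<xi> ^ n - \<iota> u ^ n) * (\<iota> \<alpha> * \<eta> ^ n + \<iota> \<beta>) + (\<eta> ^ n - \<iota> v ^ n) * (\<iota> \<alpha> * \<iota> u ^ n + \<iota> \<gamma>)
      = (\<iota> \<alpha> * (\<xi> ^ n * \<eta> ^ n) + \<iota> \<beta> * \<xi> ^ n + \<iota> \<gamma> * \<eta> ^ n + \<iota> \<delta>)
        - (\<iota> \<alpha> * (\<iota> u ^ n * \<iota> v ^ n) + \<iota> \<beta> * \<iota> u ^ n + \<iota> \<gamma> * \<iota> v ^ n + \<iota> \<delta>)"
    by (simp add: algebra_simps)
  also have "\<iota> \<alpha> * (\<iota> u ^ n * \<iota> v ^ n) + \<iota> \<beta> * \<iota> u ^ n + \<iota> \<gamma> * \<iota> v ^ n + \<iota> \<delta>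
      = \<iota> (\<alpha> * (u ^ n * v ^ n) + \<beta> * u ^ n + \<gamma> * v ^ n + \<delta>)"
    by (simp only: con.hom_add con.hom_mult con.hom_power)
  finally have diff: "(\<xi> - \<iota> u) * (S \<xi> * (\<iota> \<alpha> * \<eta> ^ n + \<iota> \<beta>)) + (\<eta> - \<iota> v) * (S \<eta> * (\<iota> \<alpha> * \<iota> u ^ n + \<iota> \<gamma>)) = 0"
    unfolding eq eq0 using S(3)[OF \<xi>(1)] S(3)[OF \<xi>(2)] by (simp add: u_def v_def mult.assoc)
  \<comment> \<open>The values of \<open>f\<close> and \<open>g\<close> are the partial derivatives
    of the equation at the point. They cannot both vanish, as the point would be singular, and the
    one that is a unit can be divided out.\<close>
  define f g where "f = S \<xi> * (\<iota> \<alpha> * \<eta> ^ n + \<iota> \<beta>)" and "g = S \<eta> * (\<iota> \<alpha> * \<iota> u ^ n + \<iota> \<gamma>)"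
  have fg: "f \<in> R" "g \<in> R"
    unfolding f_def g_def by (intro mult_in add_in power_in S(1) \<iota>_in \<xi>)+
  have ev_fg: "ev f = of_nat n * u ^ n' * (\<alpha> * v ^ n + \<beta>)" "ev g = of_nat n * v ^ n' * (\<alpha> * u ^ n + \<gamma>)"
    unfolding f_def g_def using \<xi> S by (simp_all add: ev_mult ev_add ev_power mult_in add_in power_in u_def v_def)
  have "(\<xi> - \<iota> u) * f + (\<eta> - \<iota> v) * g = 0" using diff by (simp only: f_def g_def)
  then have eq_fg: "(\<xi> - \<iota> u) * f = - ((\<eta> - \<iota> v) * g)" by (simp only: eq_neg_iff_add_eq_0)
  have "ev f \<noteq> 0 \<or> ev g \<noteq> 0"
  proof (rule ccontr)
    assume "\<not> (ev f \<noteq> 0 \<or> ev g \<noteq> 0)"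
    then have u0: "u = 0 \<or> \<alpha> * v ^ n + \<beta> = 0" and v0: "v = 0 \<or> \<alpha> * u ^ n + \<gamma> = 0"
      unfolding ev_fg using n(1) by (simp_all, blast+)
    consider "u = 0" | "v = 0" | "\<alpha> * v ^ n + \<beta> = 0" "\<alpha> * u ^ n + \<gamma> = 0" using u0 v0 by blast
    then show False
    proof cases
      case 1
      then have "v = 0" using v0 nz(2) n(2) by (simp add: zero_power)
      then show False using 1 eq0 nz(3) n(2) by (simp add: zero_power)
    next
      case 2
      then have "u = 0" using u0 nz(1) n(2) by (simp add: zero_power)
      then show False using 2 eq0 nz(3) n(2) by (simp add: zero_power)
    next
      case 3
      have "\<alpha> * (\<alpha> * (u ^ n * v ^ n) + \<beta> * u ^ n + \<gamma> * v ^ n + \<delta>)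
          = (\<alpha> * u ^ n + \<gamma>) * (\<alpha> * v ^ n + \<beta>) + (\<alpha> * \<delta> - \<beta> * \<gamma>)" by (simp add: algebra_simps)
      then show False using 3 eq0 nz(4) by simp
    qed
  qed
  moreover have "\<exists>h\<in>R. r = t * h" if "r * f' = - (t * g')" "f' \<in> R" "g' \<in> R" "ev f' \<noteq> 0" for r t f' g'
  proof
    have "f' \<noteq> 0" using that(4) by auto
    then have "r = r * f' * inverse f'" by simp
    also have "\<dots> = t * (- g' * inverse f')" unfolding that(1) by simp
    finally show "r = t * (- g' * inverse f')" .
    show "- g' * inverse f' \<in> R" using that by (intro mult_in minus_in inverse_in)
  qed
  moreover have "(\<eta> - \<iota> v) * g = - ((\<xi> - \<iota> u) * f)" unfolding eq_fg by simp
  ultimately show ?thesis using fg eq_fg unfolding u_def v_def by blast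
qed

end

text \<open>\<open>None\<close> is the point at infinity of the projective line. The pair
  \<open>(None, None)\<close> is absent because the curve does not pass through it when
  \<open>a \<noteq> 0\<close>.\<close>

definition proj_points :: "nat \<Rightarrow> 'k::field \<Rightarrow> 'k \<Rightarrow> ('k option \<times> 'k option) set" where
  "proj_points n a b = {(Some u, Some v) | u v. a * u ^ n * v ^ n - u ^ n - v ^ n + b = 0}
     \<union> {(None, Some v) | v. a * v ^ n = 1} \<union> {(Some u, None) | u. a * u ^ n = 1}"

context curve_point
begin

lemma x_nonzero: "x \<noteq> 0" by simp

lemma y_nonzero: "y \<noteq> 0"
  using y B0 n_pos by (metis gen_eq_0_iff mult_zero_right zero_power)

lemma evw_F_nonzero: "evw (Fa 1) \<noteq> 0" "evw (Fa 2) \<noteq> 0"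
  using xy_w x_nonzero y_nonzero by auto

lemma regular_or_pole:
  assumes "f = evw U / evw V" "evw U \<noteq> 0" "evw V \<noteq> 0" "f \<notin> R"
  shows "inverse f \<in> R" "ev (inverse f) = 0"
proof -
  have "evw U / evw V \<in> R \<or> evw V / evw U \<in> R"
    by (rule R_valuation) (use assms in \<open>auto simp: evw_in\<close>)
  then show inv: "inverse f \<in> R" using assms by simp
  show "ev (inverse f) = 0"
    using loc.inverse_in[OF inv] assms(4) by auto
qed

definition local_coord where "local_coord f = (if f \<in> R then f else inverse f)"

lemma local_coord:
  assumes "f = x \<or> f = y"
  shows "local_coord f \<in> R" "f \<notin> R \<Longrightarrow> ev (local_coord f) = 0" "ev (local_coord f) \<in> range (to_ac :: 'k \<Rightarrow> _)"
proof -
  obtain U V where UV: "f = evw U / evw V" "evw U \<noteq> 0" "evw V \<noteq> 0"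
    "\<And>m. frob (lkp U m) = lkp U m" "\<And>m. frob (lkp V m) = lkp V m"
    using assms xy_w evw_F_nonzero F3_w_nonzero lkp_Fa by blast
  have pole: "inverse f \<in> R" "ev (inverse f) = 0" if "f \<notin> R"
    using regular_or_pole[OF UV(1-3) that] by simp_all
  show "local_coord f \<in> R" using pole by (auto simp: local_coord_def)
  show *: "f \<notin> R \<Longrightarrow> ev (local_coord f) = 0" using pole by (simp add: local_coord_def)
  show "ev (local_coord f) \<in> range (to_ac :: 'k \<Rightarrow> _)"
  proof (cases "f \<in> R")
    case True
    have "f * evw V = evw U" using UV by simp
    then show ?thesis using rational_value[OF True _ UV(3,4,5)] True by (simp add: local_coord_def)
  next
    case False
    then show ?thesis using * by (metis rangeI to_ac_0)
  qed
qed

text \<open>Multiplying by inverse \<open>n\<close>-th powers of \<open>x\<close> and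
  \<open>y\<close> only permutes the coefficients \<open>a, -1, -1, b\<close>, and the
  nonsingularity condition becomes \<open>a b \<noteq> 1\<close> in every chart.\<close>

lemma chart_equation:
  obtains \<alpha> \<beta> \<gamma> \<delta> where
    "con \<alpha> * (local_coord x ^ n * local_coord y ^ n) + con \<beta> * local_coord x ^ n + con \<gamma> * local_coord y ^ n + con \<delta> = 0"
    "\<beta> \<noteq> 0" "\<gamma> \<noteq> 0" "\<delta> \<noteq> 0" "\<alpha> * \<delta> \<noteq> \<beta> * \<gamma>"
proof -
  define A where "A = to_ac a"
  define B where "B = to_ac b"
  have nz: "A \<noteq> 0" "B \<noteq> 0" "A * B \<noteq> 1" "B * A \<noteq> 1" using ab_nonzero ab1 by (simp_all add: A_def B_def mult.commute)
  have eq: "con A * (x ^ n * y ^ n) - x ^ n - y ^ n + con B = 0"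
    using generic_point_on_curve by (simp add: A_def B_def mult.assoc)
  define s t where "s = inverse x" and "t = inverse y"
  have st: "x ^ n * s ^ n = 1" "y ^ n * t ^ n = 1"
    using x_nonzero y_nonzero by (simp_all add: s_def t_def flip: power_mult_distrib)
  have con1: "con (- 1) = - 1" by (simp only: loc.con.hom_uminus loc.con.hom_one)
  have e1: "con A * (x ^ n * y ^ n) + con (- 1) * x ^ n + con (- 1) * y ^ n + con B = 0"
    using eq unfolding con1 by simp
  have e2: "con (- 1) * (s ^ n * y ^ n) + con B * s ^ n + con A * y ^ n + con (- 1) = 0"
  proof -
    have "s ^ n * (con A * (x ^ n * y ^ n) - x ^ n - y ^ n + con B)
        = con A * ((x ^ n * s ^ n) * y ^ n) - x ^ n * s ^ n - s ^ n * y ^ n + con B * s ^ n" by (simp add: algebra_simps)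
    then show ?thesis unfolding eq st con1 by (simp add: algebra_simps)
  qed
  have e3: "con (- 1) * (x ^ n * t ^ n) + con A * x ^ n + con B * t ^ n + con (- 1) = 0"
  proof -
    have "t ^ n * (con A * (x ^ n * y ^ n) - x ^ n - y ^ n + con B)
        = con A * (x ^ n * (y ^ n * t ^ n)) - x ^ n * t ^ n - y ^ n * t ^ n + con B * t ^ n" by (simp add: algebra_simps)
    then show ?thesis unfolding eq st con1 by (simp add: algebra_simps)
  qed
  have e4: "con B * (s ^ n * t ^ n) + con (- 1) * s ^ n + con (- 1) * t ^ n + con A = 0"
  proof -
    have "s ^ n * t ^ n * (con A * (x ^ n * y ^ n) - x ^ n - y ^ n + con B)
        = con A * ((x ^ n * s ^ n) * (y ^ n * t ^ n)) - (x ^ n * s ^ n) * t ^ n - s ^ n * (y ^ n * t ^ n) + con B * (s ^ n * t ^ n)"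
      by (simp add: algebra_simps)
    then show ?thesis unfolding eq st con1 by (simp add: algebra_simps)
  qed
  have lc: "local_coord x = (if x \<in> R then x else s)" "local_coord y = (if y \<in> R then y else t)"
    by (simp_all add: local_coord_def s_def t_def)
  show thesis
  proof (cases "x \<in> R"; cases "y \<in> R")
    assume "x \<in> R" "y \<in> R"
    then show thesis using that[of A "- 1" "- 1" B] e1 nz by (simp add: lc)
  next
    assume "x \<in> R" "y \<notin> R"
    then show thesis using that[of "- 1" A B "- 1"] e3 nz by (simp add: lc)
  next
    assume "x \<notin> R" "y \<in> R"
    then show thesis using that[of "- 1" B A "- 1"] e2 nz by (simp add: lc)
  next
    assume "x \<notin> R" "y \<notin> R"
    then show thesis using that[of B "- 1" "- 1" A] e4 nz by (simp add: lc)
  qed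
qed

definition u where "u = (vector [local_coord x, local_coord y] :: 'k alg_closure poly fract alg_closure ^ 2)"
definition q where "q = (vector [ev (local_coord x), ev (local_coord y)] :: 'k alg_closure ^ 2)"

abbreviation evu where "evu P \<equiv> eval_along (\<lambda>z :: 'k alg_closure. gen [:z:]) P u"

lemma u_in: "u $ i \<in> R" "ev (u $ i) = q $ i"
  using exhaust_2[of i] local_coord by (auto simp: u_def q_def vector_2)

lemma evu_in: "evu P \<in> R" "ev (evu P) = evl P q"
  using loc.eval_along_in[of u P] loc.ev_eval_along[of u P] u_in by simp_all

sublocale evu: comm_ring_hom "\<lambda>P. eval_along (\<lambda>z :: 'k alg_closure. gen [:z:]) P u"
  by (rule comm_ring_hom.eval_along_comm_ring_hom[OF con_hom])

sublocale evq: comm_ring_hom "\<lambda>P. eval_along (\<lambda>z :: 'k alg_closure. z) P q"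
  by (rule comm_ring_hom.eval_along_comm_ring_hom[OF id_hom])

lemma evu_nonzero: "evl Q q \<noteq> 0 \<Longrightarrow> evu Q \<noteq> 0"
  using evu_in(2)[of Q] by auto

lemma point_ring_subset: "point_ring u q \<subseteq> R"
  unfolding point_ring_def using evu_in by (auto intro!: loc.divide_in)

lemma ev_point_ring: "evl Q q \<noteq> 0 \<Longrightarrow> ev (evu P / evu Q) = evl P q / evl Q q"
  by (simp add: loc.ev_divide evu_in)

lemma point_ringI: "evl Q q \<noteq> 0 \<Longrightarrow> evu P / evu Q \<in> point_ring u q"
  unfolding point_ring_def by blast

lemma evu_in_point_ring: "evu P \<in> point_ring u q"
  using point_ringI[of 1 P] by (simp add: evu.hom_one evq.hom_one)

lemma local_alg_point_ring: "local_alg (point_ring u q) ev con"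
proof (rule local_alg.intro)
  have const: "evu (Poly_Mapping.single 0 z) = con z" for z
    by (simp add: eval_along_single gen_def)
  show "con z \<in> point_ring u q" for z using evu_in_point_ring[of "Poly_Mapping.single 0 z"] by (simp add: const)
  show "ev (con z) = z" for z by simp
  show "f + g' \<in> point_ring u q" "f * g' \<in> point_ring u q" "ev (f + g') = ev f + ev g'" "ev (f * g') = ev f * ev g'"
    if fg: "f \<in> point_ring u q" "g' \<in> point_ring u q" for f g'
  proof -
    obtain P Q where f: "f = evu P / evu Q" "evl Q q \<noteq> 0" using fg(1) unfolding point_ring_def by blast
    obtain P' Q' where g: "g' = evu P' / evu Q'" "evl Q' q \<noteq> 0" using fg(2) unfolding point_ring_def by blast
    note nz = evu_nonzero[OF f(2)] evu_nonzero[OF g(2)]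
    have QQ: "evl (Q * Q') q \<noteq> 0" using f g by (simp add: evq.hom_mult)
    have add: "f + g' = evu (P * Q' + P' * Q) / evu (Q * Q')"
      using nz by (simp add: f g evu.hom_add evu.hom_mult add_frac_eq)
    have mult: "f * g' = evu (P * P') / evu (Q * Q')" by (simp add: f g evu.hom_mult)
    show "f + g' \<in> point_ring u q" unfolding add by (rule point_ringI[OF QQ])
    show "f * g' \<in> point_ring u q" unfolding mult by (rule point_ringI[OF QQ])
    have "f \<in> R" "g' \<in> R" using fg point_ring_subset by blast+
    then show "ev (f + g') = ev f + ev g'" "ev (f * g') = ev f * ev g'"
      by (rule loc.ev_add, rule loc.ev_mult)
  qed
  show "inverse f \<in> point_ring u q" if f: "f \<in> point_ring u q" "ev f \<noteq> 0" for f
  proof -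
    obtain P Q where PQ: "f = evu P / evu Q" "evl Q q \<noteq> 0" using f(1) unfolding point_ring_def by blast
    then have "evl P q \<noteq> 0" using f(2) ev_point_ring[OF PQ(2)] by auto
    then show ?thesis using point_ringI[of P Q] by (simp add: PQ)
  qed
qed (rule con_hom)

sublocale pr: local_alg "point_ring u q" ev "\<lambda>z. gen [:z:]" by (rule local_alg_point_ring)

lemma u_in_point_ring: "u $ i \<in> point_ring u q"
proof -
  define V :: "(2, 'k alg_closure) mpol" where "V = Poly_Mapping.single (Poly_Mapping.single i 1) 1"
  have "con (1 :: 'k alg_closure) = 1" by (simp add: gen_def flip: one_pCons)
  then have "evu V = u $ i" by (simp add: V_def eval_along_single monomial_eval_single)
  then show ?thesis using evu_in_point_ring[of V] by simp
qed

text \<open>Here \<open>coordinate_divides\<close> takes the place of the tangent space and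
  Nakayama's lemma: one of the two local coordinates divides the other, and Taylor expansion does
  the rest.\<close>

lemma point_ring_uniformizer:
  "\<exists>\<tau>\<in>point_ring u q. ev \<tau> = 0 \<and> (\<forall>f\<in>point_ring u q. ev f = 0 \<longrightarrow> (\<exists>h\<in>point_ring u q. f = \<tau> * h))"
proof -
  define z2 :: "'k alg_closure poly fract alg_closure ^ 2" where "z2 = (\<chi> i. u $ i - con (q $ i))"
  have z2: "z2 $ i \<in> point_ring u q" "ev (z2 $ i) = 0" for i
    using pr.diff_in[OF u_in_point_ring pr.\<iota>_in] pr.ev_diff[OF u_in_point_ring pr.\<iota>_in] u_in(2)
    by (simp_all add: z2_def)
  obtain \<alpha> \<beta> \<gamma> \<delta> where ch: "con \<alpha> * (local_coord x ^ n * local_coord y ^ n) + con \<beta> * local_coord x ^ n + con \<gamma> * local_coord y ^ n + con \<delta> = 0"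
    "\<beta> \<noteq> 0" "\<gamma> \<noteq> 0" "\<delta> \<noteq> 0" "\<alpha> * \<delta> \<noteq> \<beta> * \<gamma>" by (rule chart_equation)
  have lc: "local_coord x = u $ 1" "local_coord y = u $ 2" by (simp_all add: u_def vector_2)
  have "(\<exists>h\<in>point_ring u q. z2 $ 1 = z2 $ 2 * h) \<or> (\<exists>h\<in>point_ring u q. z2 $ 2 = z2 $ 1 * h)"
    using pr.coordinate_divides[OF u_in_point_ring u_in_point_ring n n_pos ch(1)[unfolded lc] ch(2-5)]
    by (simp add: z2_def u_in(2))
  then have "\<exists>j. \<forall>i. \<exists>h\<in>point_ring u q. z2 $ i = z2 $ j * h"
  proof
    assume *: "\<exists>h\<in>point_ring u q. z2 $ 1 = z2 $ 2 * h"
    have "\<exists>h\<in>point_ring u q. z2 $ 2 = z2 $ 2 * h" by (rule bexI[OF _ pr.one_in]) simp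
    with * show ?thesis unfolding forall_2 by blast
  next
    assume *: "\<exists>h\<in>point_ring u q. z2 $ 2 = z2 $ 1 * h"
    have "\<exists>h\<in>point_ring u q. z2 $ 1 = z2 $ 1 * h" by (rule bexI[OF _ pr.one_in]) simp
    with * show ?thesis unfolding forall_2 by blast
  qed
  then obtain j where j: "\<forall>i. \<exists>h\<in>point_ring u q. z2 $ i = z2 $ j * h" by blast
  then obtain h where h: "\<And>i. h i \<in> point_ring u q" "\<And>i. z2 $ i = z2 $ j * h i" by metis
  have "\<exists>h\<in>point_ring u q. f = z2 $ j * h" if f: "f \<in> point_ring u q" "ev f = 0" for f
  proof -
    obtain P Q where PQ: "f = evu P / evu Q" "evl Q q \<noteq> 0" using f(1) unfolding point_ring_def by blast
    have "evl P q = 0" using f(2) PQ(2) unfolding PQ(1) ev_point_ring[OF PQ(2)] by simp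
    moreover have "pr.taylor z2 (evu P) (evl P q) (\<lambda>j. mpol_pderiv_eval j P q)"
      by (rule pr.taylor_eval_along[OF z2]) (simp add: z2_def)
    ultimately have "evu P - (\<Sum>i\<in>UNIV. con (mpol_pderiv_eval i P q) * z2 $ i) \<in> pr.second_order z2"
      unfolding pr.taylor_def by (simp add: gen_def)
    then obtain A where A: "\<And>j. A j \<in> point_ring u q"
      "evu P - (\<Sum>i\<in>UNIV. con (mpol_pderiv_eval i P q) * z2 $ i) = (\<Sum>j\<in>UNIV. A j * z2 $ j)"
      unfolding pr.second_order_def by auto
    have "evu P = (\<Sum>i\<in>UNIV. (con (mpol_pderiv_eval i P q) + A i) * z2 $ i)"
      using A(2) by (simp add: distrib_right sum.distrib diff_eq_eq add.commute)
    also have "(con (mpol_pderiv_eval i P q) + A i) * z2 $ i = z2 $ j * ((con (mpol_pderiv_eval i P q) + A i) * h i)" for i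
      by (subst h(2)) (simp only: mult_ac)
    then have "(\<Sum>i\<in>UNIV. (con (mpol_pderiv_eval i P q) + A i) * z2 $ i)
        = z2 $ j * (\<Sum>i\<in>UNIV. (con (mpol_pderiv_eval i P q) + A i) * h i)"
      by (simp only: sum_distrib_left)
    finally have f_eq: "f = z2 $ j * ((\<Sum>i\<in>UNIV. (con (mpol_pderiv_eval i P q) + A i) * h i) * inverse (evu Q))"
      unfolding PQ(1) by (simp only: divide_inverse mult.assoc)
    have inv: "inverse (evu Q) \<in> point_ring u q"
      using pr.inverse_in[OF evu_in_point_ring] PQ(2) by (simp add: evu_in)
    show ?thesis
      by (rule bexI, rule f_eq, intro pr.mult_in pr.sum_in pr.add_in pr.\<iota>_in A(1) h(1) inv)
  qed
  then show ?thesis using z2 by blast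
qed

text \<open>Through \<open>H\<close> the coordinates of the generic point \<open>c\<close> are
  polynomials in \<open>x\<close> and \<open>y\<close>, and these are local coordinates or inverses
  of such.\<close>

lemma R_subset_fractions: "R \<subseteq> pr.fractions"
proof
  have u_eq: "local_coord x = u $ 1" "local_coord y = u $ 2" by (simp_all add: u_def vector_2)
  have lcf: "local_coord x \<in> pr.fractions" "local_coord y \<in> pr.fractions"
    unfolding u_eq by (rule pr.fractionsI[OF u_in_point_ring])+
  have xyf: "x \<in> pr.fractions" "y \<in> pr.fractions"
    using lcf pr.fractions_inverse[OF lcf(1)] pr.fractions_inverse[OF lcf(2)]
    by (auto simp: local_coord_def split: if_splits)
  have one: "1 \<in> pr.fractions" by (rule pr.fractionsI[OF pr.one_in])
  have "(vector [x, y, 1] :: _ ^ 3) $ i \<in> pr.fractions" for i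
    using exhaust_3[of i] xyf one by (auto simp: vector_3)
  then have "c $ i \<in> pr.fractions" for i
    unfolding c_def by (simp add: pr.fractions_eval_along)
  then have "w $ i \<in> pr.fractions" for i
    by (simp add: w_def divide_inverse pr.fractions_mult pr.fractions_inverse)
  then have evw: "evw P \<in> pr.fractions" for P by (rule pr.fractions_eval_along)
  fix f assume "f \<in> R"
  then obtain P Q where "f = evw P / evw Q" unfolding R_def by blast
  then show "f \<in> pr.fractions" by (simp add: divide_inverse pr.fractions_mult pr.fractions_inverse evw)
qed

theorem R_eq_point_ring: "R = point_ring u q"
proof (rule local_alg_eq_dominated[OF local_alg_R local_alg_point_ring point_ring_subset refl])
  obtain \<tau> where \<tau>: "\<tau> \<in> point_ring u q" "ev \<tau> = 0"
    "\<And>f. f \<in> point_ring u q \<Longrightarrow> ev f = 0 \<Longrightarrow> \<exists>h\<in>point_ring u q. f = \<tau> * h"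
    using point_ring_uniformizer by blast
  have ar: "\<exists>e. \<forall>h\<in>point_ring u q. f \<noteq> \<tau> ^ e * h" if "f \<in> point_ring u q" "f \<noteq> 0" for f
    using arch[of \<tau> f] \<tau> that point_ring_subset by blast
  fix f assume f: "f \<in> R" "f \<noteq> 0"
  then obtain s t where st: "f = s / t" "s \<in> point_ring u q" "t \<in> point_ring u q" "t \<noteq> 0"
    using R_subset_fractions unfolding pr.fractions_def by blast
  then have "s \<noteq> 0" using f by auto
  have "s / t \<in> point_ring u q \<or> t / s \<in> point_ring u q"
    by (rule pr.valuation_ring[OF \<tau> ar st(2,3) \<open>s \<noteq> 0\<close> st(4)])
  then show "f \<in> point_ring u q \<or> inverse f \<in> point_ring u q" unfolding st(1) by simp
qed

definition coord where "coord f = (if f \<in> R then Some (of_ac (ev f) :: 'k) else None)"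

lemma to_ac_coord: "f = x \<or> f = y \<Longrightarrow> f \<in> R \<Longrightarrow> to_ac (of_ac (ev f) :: 'k) = ev f"
  using local_coord(3)[of f] by (intro to_ac_of_ac) (simp add: local_coord_def)

text \<open>The equation, multiplied by powers of the inverses of the coordinates that have a pole,
  is evaluated at the point. Poles of both coordinates are excluded because they would force
  \<open>a = 0\<close>.\<close>

lemma coords_in: "(coord x, coord y) \<in> proj_points n a b"
proof -
  have eq: "con (to_ac a) * x ^ n * y ^ n - x ^ n - y ^ n + con (to_ac b) = 0" by (rule generic_point_on_curve)
  show ?thesis
  proof (cases "x \<in> R"; cases "y \<in> R")
    assume xy: "x \<in> R" "y \<in> R"
    define u0 v0 where "u0 = (of_ac (ev x) :: 'k)" and "v0 = (of_ac (ev y) :: 'k)"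
    have uv: "ev x = to_ac u0" "ev y = to_ac v0" using to_ac_coord xy by (simp_all add: u0_def v0_def)
    have "ev (con (to_ac a) * x ^ n * y ^ n - x ^ n - y ^ n + con (to_ac b)) = 0" unfolding eq by simp
    then have "to_ac a * ev x ^ n * ev y ^ n - ev x ^ n - ev y ^ n + to_ac b = 0"
      using xy by (simp add: loc.ev_add loc.ev_diff loc.ev_mult loc.ev_power loc.add_in loc.diff_in loc.mult_in loc.power_in)
    then have "to_ac (a * u0 ^ n * v0 ^ n - u0 ^ n - v0 ^ n + b) = 0" by (simp add: uv)
    then have "a * u0 ^ n * v0 ^ n - u0 ^ n - v0 ^ n + b = 0" by (simp only: to_ac_eq_0_iff)
    then show ?thesis using xy by (auto simp: coord_def proj_points_def u0_def v0_def)
  next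
    assume xy: "x \<in> R" "y \<notin> R"
    define u0 where "u0 = (of_ac (ev x) :: 'k)"
    have uv: "ev x = to_ac u0" using to_ac_coord xy by (simp_all add: u0_def)
    define t where "t = inverse y"
    have t: "t \<in> R" "ev t = 0" "y ^ n * t ^ n = 1"
      using local_coord[of y] xy y_nonzero by (simp_all add: local_coord_def t_def flip: power_mult_distrib)
    have "t ^ n * (con (to_ac a) * x ^ n * y ^ n - x ^ n - y ^ n + con (to_ac b))
        = con (to_ac a) * x ^ n * (y ^ n * t ^ n) - x ^ n * t ^ n - y ^ n * t ^ n + con (to_ac b) * t ^ n"
      by (simp add: algebra_simps)
    then have "con (to_ac a) * x ^ n - x ^ n * t ^ n - 1 + con (to_ac b) * t ^ n = 0"
      unfolding eq t(3) by simp
    then have "ev (con (to_ac a) * x ^ n - x ^ n * t ^ n - 1 + con (to_ac b) * t ^ n) = 0" by simp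
    then have "to_ac a * ev x ^ n = 1"
      using xy t n_pos by (simp add: loc.ev_add loc.ev_diff loc.ev_mult loc.ev_power loc.add_in loc.diff_in loc.mult_in loc.power_in zero_power)
    then have "to_ac (a * u0 ^ n) = to_ac 1" by (simp add: uv)
    then have "a * u0 ^ n = 1" by (simp only: to_ac_eq_iff)
    then show ?thesis using xy by (auto simp: coord_def proj_points_def u0_def)
  next
    assume xy: "x \<notin> R" "y \<in> R"
    define v0 where "v0 = (of_ac (ev y) :: 'k)"
    have uv: "ev y = to_ac v0" using to_ac_coord xy by (simp_all add: v0_def)
    define s where "s = inverse x"
    have s: "s \<in> R" "ev s = 0" "x ^ n * s ^ n = 1"
      using local_coord[of x] xy x_nonzero by (simp_all add: local_coord_def s_def flip: power_mult_distrib)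
    have "s ^ n * (con (to_ac a) * x ^ n * y ^ n - x ^ n - y ^ n + con (to_ac b))
        = con (to_ac a) * (x ^ n * s ^ n) * y ^ n - x ^ n * s ^ n - y ^ n * s ^ n + con (to_ac b) * s ^ n"
      by (simp add: algebra_simps)
    then have "con (to_ac a) * y ^ n - 1 - y ^ n * s ^ n + con (to_ac b) * s ^ n = 0"
      unfolding eq s(3) by simp
    then have "ev (con (to_ac a) * y ^ n - 1 - y ^ n * s ^ n + con (to_ac b) * s ^ n) = 0" by simp
    then have "to_ac a * ev y ^ n = 1"
      using xy s n_pos by (simp add: loc.ev_add loc.ev_diff loc.ev_mult loc.ev_power loc.add_in loc.diff_in loc.mult_in loc.power_in zero_power)
    then have "to_ac (a * v0 ^ n) = to_ac 1" by (simp add: uv)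
    then have "a * v0 ^ n = 1" by (simp only: to_ac_eq_iff)
    then show ?thesis using xy by (auto simp: coord_def proj_points_def v0_def)
  next
    assume xy: "x \<notin> R" "y \<notin> R"
    define s t where "s = inverse x" and "t = inverse y"
    have s: "s \<in> R" "ev s = 0" "x ^ n * s ^ n = 1"
      using local_coord[of x] xy x_nonzero by (simp_all add: local_coord_def s_def flip: power_mult_distrib)
    have t: "t \<in> R" "ev t = 0" "y ^ n * t ^ n = 1"
      using local_coord[of y] xy y_nonzero by (simp_all add: local_coord_def t_def flip: power_mult_distrib)
    have "s ^ n * t ^ n * (con (to_ac a) * x ^ n * y ^ n - x ^ n - y ^ n + con (to_ac b))
        = con (to_ac a) * (x ^ n * s ^ n) * (y ^ n * t ^ n) - (x ^ n * s ^ n) * t ^ n - (y ^ n * t ^ n) * s ^ n + con (to_ac b) * (s ^ n * t ^ n)"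
      by (simp add: algebra_simps)
    then have "con (to_ac a) - t ^ n - s ^ n + con (to_ac b) * (s ^ n * t ^ n) = 0"
      unfolding eq s(3) t(3) by simp
    then have "ev (con (to_ac a) - t ^ n - s ^ n + con (to_ac b) * (s ^ n * t ^ n)) = 0" by simp
    then have "to_ac a = 0"
      using s t n_pos by (simp add: loc.ev_add loc.ev_diff loc.ev_mult loc.ev_power loc.add_in loc.diff_in loc.mult_in loc.power_in zero_power)
    then show ?thesis using ab_nonzero by simp
  qed
qed

lemma u_q_of_coords:
  "u $ 1 = (if coord x = None then inverse x else x)" "u $ 2 = (if coord y = None then inverse y else y)"
  "q $ 1 = (case coord x of None \<Rightarrow> 0 | Some v \<Rightarrow> to_ac v)" "q $ 2 = (case coord y of None \<Rightarrow> 0 | Some v \<Rightarrow> to_ac v)"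
  using local_coord(2)[of x] local_coord(2)[of y] to_ac_coord
  by (auto simp: u_def q_def vector_2 coord_def local_coord_def)

end

section \<open>The coordinates in the product of two lines determine the point\<close>

definition chart_point :: "'k::field alg_closure poly fract alg_closure \<Rightarrow> 'k option \<times> 'k option
    \<Rightarrow> 'k alg_closure poly fract alg_closure ^ 2" where
  "chart_point y cs = vector [if fst cs = None then inverse (gen [:0, 1:]) else gen [:0, 1:],
     if snd cs = None then inverse y else y]"

definition chart_center :: "'k::field option \<times> 'k option \<Rightarrow> 'k alg_closure ^ 2" where
  "chart_center cs = vector [case fst cs of None \<Rightarrow> 0 | Some v \<Rightarrow> to_ac v,
     case snd cs of None \<Rightarrow> 0 | Some v \<Rightarrow> to_ac v]"

text \<open>Membership in the local ring and the value there, phrased through \<open>y\<close> and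
  the coordinates alone, without \<open>C\<close> or \<open>l\<close>, so that two points with equal
  coordinates can be compared.\<close>

definition chart_value :: "'k::field alg_closure poly fract alg_closure \<Rightarrow> 'k option \<times> 'k option
    \<Rightarrow> 'k alg_closure poly fract alg_closure \<Rightarrow> 'k alg_closure \<Rightarrow> bool" where
  "chart_value y cs f v \<longleftrightarrow> (\<exists>S T. evl T (chart_center cs) \<noteq> 0 \<and>
     f = eval_along (\<lambda>z. gen [:z:]) S (chart_point y cs) / eval_along (\<lambda>z. gen [:z:]) T (chart_point y cs) \<and>
     v = evl S (chart_center cs) / evl T (chart_center cs))"

context curve_point
begin

definition coords where "coords = (coord x, coord y)"

lemma coords_in_proj_points: "coords \<in> proj_points n a b"
  unfolding coords_def by (rule coords_in)

lemma chart_coords: "chart_point y coords = u" "chart_center coords = q"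
  unfolding Finite_Cartesian_Product.vec_eq_iff forall_2 u_q_of_coords chart_point_def chart_center_def
    coords_def vector_2 fst_conv snd_conv by blast+

lemma chart_value_iff: "chart_value y coords f v \<longleftrightarrow> f \<in> R \<and> ev f = v"
proof
  assume "chart_value y coords f v"
  then obtain S T where "evl T q \<noteq> 0" "f = evu S / evu T" "v = evl S q / evl T q"
    unfolding chart_value_def chart_coords by blast
  then show "f \<in> R \<and> ev f = v" unfolding R_eq_point_ring using point_ringI ev_point_ring by blast
next
  assume f: "f \<in> R \<and> ev f = v"
  then have "f \<in> point_ring u q" unfolding R_eq_point_ring by blast
  then obtain S T where ST: "evl T q \<noteq> 0" "f = evu S / evu T" unfolding point_ring_def by blast
  have "v = evl S q / evl T q" using f unfolding ST(2) ev_point_ring[OF ST(1)] by (rule conjunct2[THEN sym])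
  then show "chart_value y coords f v" unfolding chart_value_def chart_coords using ST by blast
qed

lemma chart_value_c: "chart_value y coords (c $ h / c $ i0) (l $ h)"
  using w_in[of h] unfolding chart_value_iff w_def by simp

text \<open>\<open>l\<close> and \<open>m\<close> may be normalised at different coordinates. All
  ratios in question lie in one local ring, and evaluating
  \<open>c_h / c_i0 = (c_j / c_i0) (c_h / c_j)\<close> gives \<open>l = l_j m\<close>.\<close>

lemma span_eqI:
  assumes j: "c $ j \<noteq> 0" and m: "\<And>h. chart_value y coords (c $ h / c $ j) (m $ h)"
  shows "vec.span {l} = vec.span {m}"
proof -
  note m' = m[unfolded chart_value_iff]
  have "l $ h = l $ j * m $ h" for h
  proof -
    have "w $ h = w $ j * (c $ h / c $ j)" using j unfolding w_def by simp
    then have "ev (w $ h) = ev (w $ j) * ev (c $ h / c $ j)"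
      using loc.ev_mult[OF w_in(1) conjunct1[OF m'], of j h] by simp
    then show ?thesis using conjunct2[OF m'] unfolding w_in(2) by simp
  qed
  then have lm: "l = l $ j *s m" unfolding Finite_Cartesian_Product.vec_eq_iff vector_smult_component by blast
  have "l \<noteq> 0" using l(2) by auto
  have "vec.span {t *s m} = vec.span {m}" if "t *s m \<noteq> 0" for t
    by (rule proj_space_line[symmetric]) (use that in \<open>auto simp: proj_space_def span_line\<close>)
  from this[of "l $ j"] show ?thesis using \<open>l \<noteq> 0\<close> lm by argo
qed

end

lemma coords_inj:
  assumes "curve_point n a b y C F H p i l" "curve_point n a b y C F H p j m"
    and eq: "curve_point.coords y H i l = curve_point.coords y H j m"
  shows "vec.span {l} = vec.span {m}"
  using curve_point.chart_value_c[OF assms(2)] unfolding eq[symmetric]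
  by (rule curve_point.span_eqI[OF assms(1) curve_point.c_i0[OF assms(2)]])

section \<open>Counting\<close>

lemma card_rational_points_le_proj_points:
  fixes a b :: "'k::field" and C :: "('k alg_closure ^ 'm) set set"
  assumes p: "Factorial_Ring.prime p" "CARD('k) = p" and n: "0 < n" "n < p"
    and ab: "a * b \<noteq> 0" "a * b \<noteq> 1" and C: "is_nonsingular_model C (curve_G n a b)"
  shows "card (rational_points C) \<le> card (proj_points n a b)"
proof -
  have fin: "finite (UNIV :: 'k set)"
    by (rule card_ge_0_finite) (simp only: p(2) prime_gt_0_nat[OF p(1)])
  have char: "CHAR('k alg_closure) = p" using CHAR_eq_CARD_prime[where ?'k = 'k] p by simp
  have n0: "of_nat n \<noteq> (0 :: 'k alg_closure)"
    unfolding of_nat_eq_0_iff_char_dvd char using n by (auto dest: dvd_imp_le)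
  obtain y :: "'k alg_closure poly fract alg_closure"
    where y0: "y ^ n = gen (monom 1 n - [:to_ac b:]) / gen (monom (to_ac a) n - 1)"
    using ex_nth_root_gen[OF n(1)] by blast
  have "coeff (monom (to_ac a) n - 1) n \<noteq> 0" using ab n by (auto simp: coeff_1)
  then have "monom (to_ac a) n - 1 \<noteq> 0" by (metis coeff_0)
  then have y: "gen (monom (to_ac a) n - 1) * y ^ n = gen (monom 1 n - [:to_ac b:])" by (simp add: y0)
  obtain F H where FH: "rational_map C (curve_G n a b) F" "rational_map (curve_G n a b) C H"
      "rational_left_inverse C F H" "rational_left_inverse (curve_G n a b) H F"
    using C unfolding is_nonsingular_model_def birational_over_base_def by blast
  have curve: "zariski_closed_over_base C" "irreducible_closed C" "zariski_dim C = 1" "nonsingular C"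
    using C unfolding is_nonsingular_model_def projective_curve_def by blast+
  have "\<exists>i l. curve_point n a b y C F H p i l \<and> L = vec.span {l}" if L: "L \<in> rational_points C" for L
  proof -
    obtain v :: "'k ^ 'm" where v: "L \<in> C" "v \<noteq> 0" "L = vec.span {\<chi> i. to_ac (v $ i)}"
      using L unfolding rational_points_def by blast
    obtain i where i: "v $ i \<noteq> 0" using v(2) by (auto simp: Finite_Cartesian_Product.vec_eq_iff)
    \<comment> \<open>Dividing by a nonzero coordinate of a representative over the base field keeps
      all coordinates in the base field.\<close>
    define l where "l = (\<chi> j. to_ac (v $ j / v $ i))"
    have "l = inverse (to_ac (v $ i)) *s (\<chi> i. to_ac (v $ i))"
      by (simp add: l_def Finite_Cartesian_Product.vec_eq_iff to_ac_divide field_simps)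
    then have "l \<in> L" unfolding v(3) by (auto simp: span_line)
    moreover have "L \<in> proj_space"
    proof -
      have "to_ac (v $ i) \<noteq> 0" using i by simp
      then have "(\<chi> i. to_ac (v $ i)) \<noteq> 0" by (auto simp: Finite_Cartesian_Product.vec_eq_iff)
      then show ?thesis unfolding v(3) proj_space_def by blast
    qed
    moreover have li: "l $ i = 1" using i by (simp add: l_def)
    ultimately have Ll: "L = vec.span {l}" by (intro proj_space_line) auto
    have "enat (vec.dim (cone_tangent_space C L)) = 1 + 1"
      using curve(3,4) v(1) unfolding nonsingular_def by simp
    then have dim: "vec.dim (cone_tangent_space C L) = 2"
      by (simp add: one_add_one numeral_eq_enat)
    have "curve_point n a b y C F H p i l"
    proof (intro curve_point.intro curve_model.intro curve_chart.intro curve_model_axioms.intro curve_point_axioms.intro)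
      have "to_ac (a * b) \<noteq> 0" "to_ac (a * b) \<noteq> to_ac 1"
        using ab unfolding to_ac_eq_iff to_ac_eq_0_iff .
      then show "to_ac a * to_ac b \<noteq> 0" "to_ac a * to_ac b \<noteq> 1" unfolding to_ac_mult to_ac_1 .
      show "vec.span {l} \<in> C" using v(1) Ll by simp
      show "vec.dim (cone_tangent_space C (vec.span {l})) = 2" using dim Ll by simp
      show "l $ j \<in> range to_ac" for j
        unfolding l_def Finite_Cartesian_Product.vec_lambda_beta by (rule rangeI)
    qed (rule n0 y curve(1,2) FH p li)+
    then show ?thesis using Ll by blast
  qed
  then have "\<forall>L\<in>rational_points C. \<exists>i l. curve_point n a b y C F H p i l \<and> L = vec.span {l}" by blast
  then obtain i l where il': "\<forall>L\<in>rational_points C. curve_point n a b y C F H p (i L) (l L) \<and> L = vec.span {l L}"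
    unfolding bchoice_iff by blast
  note il = il'[rule_format, THEN conjunct1] il'[rule_format, THEN conjunct2]
  define f where "f L = curve_point.coords y H (i L) (l L)" for L
  have "inj_on f (rational_points C)"
  proof (rule inj_onI)
    fix L M assume LM: "L \<in> rational_points C" "M \<in> rational_points C" "f L = f M"
    show "L = M"
      using coords_inj[OF il(1)[OF LM(1)] il(1)[OF LM(2)] LM(3)[unfolded f_def]]
      unfolding il(2)[OF LM(1), symmetric] il(2)[OF LM(2), symmetric] .
  qed
  moreover have "f ` rational_points C \<subseteq> proj_points n a b"
  proof
    fix z assume "z \<in> f ` rational_points C"
    then obtain L where L: "L \<in> rational_points C" "z = f L" by blast
    show "z \<in> proj_points n a b"
      unfolding L(2) f_def by (rule curve_point.coords_in_proj_points[OF il(1)[OF L(1)]])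
  qed
  moreover have "finite (proj_points n a b)"
    by (rule finite_subset[OF subset_UNIV]) (simp add: finite_prod fin)
  ultimately show ?thesis by (rule card_inj_on_le)
qed

lemma card_power_eq_le:
  fixes c :: "'a::field"
  assumes "0 < n"
  shows "card {v. v ^ n = c} \<le> n"
proof -
  have "coeff (monom 1 n - [:c:]) n = 1" using assms by (simp add: coeff_pCons split: nat.split)
  then have nz: "monom 1 n - [:c:] \<noteq> 0" by (metis coeff_0 zero_neq_one)
  have "{v. v ^ n = c} = {v. poly (monom 1 n - [:c:]) v = 0}" by (simp add: poly_monom)
  also have "card \<dots> \<le> degree (monom 1 n - [:c:])" by (rule poly_roots_degree[OF nz])
  also have "\<dots> \<le> n" by (intro degree_diff_le) (auto simp: degree_monom_le)
  finally show ?thesis .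
qed

text \<open>Points with \<open>X\<close> and \<open>Y\<close> finite and nonzero have
  \<open>X^n\<close> in \<open>A\<close>, with at most \<open>n\<close> values of each coordinate
  over it. The others have one coordinate 0 or infinite and the \<open>n\<close>-th power of the
  other equal to \<open>b\<close> or \<open>1 / a\<close>, which must be a \<open>k\<close>-th root
  of unity; the factor 2 is the choice of the coordinate.\<close>

lemma card_proj_points_le:
  fixes a b :: "'k::field"
  assumes card: "CARD('k) = n * k + 1" and n: "0 < n" and ab: "a * b \<noteq> 0" "a * b \<noteq> 1"
  defines "A \<equiv> {u :: 'k. u \<noteq> 0 \<and> u \<noteq> b \<and> a * u \<noteq> 1 \<and> u ^ k = 1 \<and> (u - b) ^ k = (a * u - 1) ^ k}"
    and "B \<equiv> {u \<in> {b, 1 / a}. u ^ k = 1}"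
  shows "card (proj_points n a b) \<le> n ^ 2 * card A + 2 * n * card B"
proof -
  have fin: "finite S" for S :: "'k set"
  proof -
    have "finite (UNIV :: 'k set)" by (rule card_ge_0_finite) (simp only: card)
    then show ?thesis by (rule finite_subset[OF subset_UNIV])
  qed
  have a0: "a \<noteq> 0" "b \<noteq> 0" using ab(1) by auto
  have k1: "(u ^ n) ^ k = 1" if "u \<noteq> 0" for u :: 'k
  proof -
    have "u * u ^ (n * k) = u" using field_power_card[OF fin, of u] unfolding card by simp
    then show ?thesis using that by (simp add: power_mult)
  qed
  define r where "r c = {v :: 'k. v ^ n = c}" for c
  have r_card: "card (r c) \<le> n" for c unfolding r_def by (rule card_power_eq_le[OF n])
  have r_card': "card (r c) \<le> (if c ^ k = 1 then n else 0)" if "c \<noteq> 0" for c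
  proof (cases "c ^ k = 1")
    case False
    have "r c = {}"
    proof (rule ccontr)
      assume "r c \<noteq> {}"
      then obtain v where v: "v ^ n = c" by (auto simp: r_def)
      have "v \<noteq> 0" using v that n by (auto simp: zero_power)
      then show False using k1 v False by blast
    qed
    then show ?thesis by simp
  qed (simp add: r_card)
  define D where "D = (\<Union>c\<in>A. r c \<times> r ((c - b) / (a * c - 1)))"
  define E where "E = D \<union> ({0} \<times> r b \<union> r b \<times> {0})"
  have "(u, v) \<in> E" if eq: "a * u ^ n * v ^ n - u ^ n - v ^ n + b = 0" for u v
  proof (cases "u = 0 \<or> v = 0")
    case True
    then show ?thesis using eq n by (auto simp: E_def r_def zero_power)
  next
    case False
    define c d where "c = u ^ n" and "d = v ^ n"
    have cd: "c \<noteq> 0" "d \<noteq> 0" "c ^ k = 1" "d ^ k = 1" using False k1 by (simp_all add: c_def d_def)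
    have eq': "d * (a * c - 1) = c - b" using eq by (simp add: c_def d_def algebra_simps)
    have ac: "a * c \<noteq> 1"
    proof
      assume ac: "a * c = 1"
      then have "c = b" using eq' by simp
      then show False using ac ab(2) by simp
    qed
    then have "c \<noteq> b" using eq' cd(2) by auto
    moreover have "(c - b) ^ k = (a * c - 1) ^ k" using cd(4) by (simp add: eq'[symmetric] power_mult_distrib)
    ultimately have "c \<in> A" using cd ac by (simp add: A_def)
    moreover have "d = (c - b) / (a * c - 1)" using ac eq' by (simp add: eq_divide_eq)
    ultimately show ?thesis unfolding E_def D_def r_def c_def[symmetric] using c_def d_def by auto
  qed
  then have sub: "proj_points n a b
      \<subseteq> map_prod Some Some ` E \<union> (Pair None ` Some ` r (1 / a) \<union> (\<lambda>z. (z, None)) ` Some ` r (1 / a))"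
    using a0 by (auto simp: proj_points_def r_def eq_divide_eq mult.commute)
  have finE: "finite E" unfolding E_def D_def using fin by (intro finite_UnI finite_UN_I finite_cartesian_product)
  have "card D \<le> (\<Sum>c\<in>A. card (r c \<times> r ((c - b) / (a * c - 1))))"
    unfolding D_def by (rule card_UN_le[OF fin])
  also have "\<dots> \<le> (\<Sum>c\<in>A. n * n)"
    by (intro sum_mono) (simp add: card_cartesian_product mult_mono r_card)
  finally have D: "card D \<le> n ^ 2 * card A" by (simp add: power2_eq_square mult.commute)
  have "card E \<le> card D + (card ({0::'k} \<times> r b) + card (r b \<times> {0::'k}))"
    unfolding E_def by (rule order_trans[OF card_Un_le add_left_mono[OF card_Un_le]])
  then have E: "card E \<le> card D + 2 * card (r b)" by (simp add: card_cartesian_product)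
  have "card (proj_points n a b) \<le> card (map_prod Some Some ` E)
      + (card (Pair (None :: 'k option) ` Some ` r (1 / a)) + card ((\<lambda>z. (z, None :: 'k option)) ` Some ` r (1 / a)))"
  proof (rule order_trans[OF card_mono[OF _ sub] order_trans[OF card_Un_le add_left_mono[OF card_Un_le]]])
    show "finite (map_prod Some Some ` E \<union> (Pair None ` Some ` r (1 / a) \<union> (\<lambda>z. (z, None)) ` Some ` r (1 / a)))"
      by (intro finite_UnI finite_imageI finE fin)
  qed
  also have "\<dots> \<le> card E + (card (r (1 / a)) + card (r (1 / a)))"
    by (intro add_mono card_image_le[OF finE] order_trans[OF card_image_le card_image_le] finite_imageI fin)
  finally have "card (proj_points n a b) \<le> n ^ 2 * card A + 2 * (card (r b) + card (r (1 / a)))"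
    using D E by simp
  also have "card (r b) + card (r (1 / a)) \<le> n * card B"
  proof -
    have ne: "b \<noteq> 1 / a" using ab(2) a0 by (auto simp: field_simps)
    have "card (r b) + card (r (1 / a)) = (\<Sum>c\<in>{b, 1 / a}. card (r c))" using ne by simp
    also have "\<dots> \<le> (\<Sum>c\<in>{b, 1 / a}. if c ^ k = 1 then n else 0)"
      using a0 by (intro sum_mono r_card') auto
    also have "\<dots> = (\<Sum>c\<in>B. n)" unfolding B_def by (rule sum.inter_filter[symmetric]) simp
    finally show ?thesis by (simp add: mult.commute)
  qed
  finally show ?thesis by simp
qed

theorem theorem3p5:
  fixes p n k :: nat
    and a b :: "'k::field"
    and C :: "('k alg_closure ^ 'm) set set"
  assumes "Factorial_Ring.prime p"
    and "CARD('k) = p"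
    and "n \<ge> 3" and "n dvd p - 1" and "n \<noteq> p - 1"
    and "k = (p - 1) div n"
    and "a * b \<notin> {0, 1}"
    and "is_nonsingular_model C (curve_G n a b)"
    and "real p - 1 \<le> real n * ((real n + 3) * (real n + 4) * (3 * real n - 1) / 12 - 3)"
  shows "real (card (rational_points C)) \<le>
           (real n)\<^sup>2 * (3 * (2 powr (1/2) * real k) powr (2/3)
                       - 103/19 * (2 powr (1/2) * real k) powr (1/3) + 13/3)"
proof -
  have n: "3 \<le> n" "0 < n" using assms(3) by simp_all
  have "1 < p" by (rule prime_gt_1_nat[OF assms(1)])
  moreover have "p - 1 = n * k" using assms(4,6) by simp
  ultimately have p: "p = n * k + 1" by simp
  have "k \<noteq> 0" using \<open>1 < p\<close> p by (cases k) auto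
  moreover have "k \<noteq> 1" using p assms(5) by auto
  ultimately have k: "2 \<le> k" by linarith
  have ab: "a * b \<noteq> 0" "a * b \<noteq> 1" using assms(7) by auto
  have "n * 1 \<le> n * k" using k by (intro mult_le_mono) auto
  then have np: "n < p" unfolding p by linarith
  define A where "A = {u :: 'k. u \<noteq> 0 \<and> u \<noteq> b \<and> a * u \<noteq> 1 \<and> u ^ k = 1 \<and> (u - b) ^ k = (a * u - 1) ^ k}"
  define B where "B = {u \<in> {b, 1 / a}. u ^ k = 1}"
  have char: "CHAR('k) = p" using CHAR_eq_CARD_prime[where ?'k = 'k] assms(1,2) by simp
  have fin: "finite S" for S :: "'k set"
  proof -
    have "finite (UNIV :: 'k set)" by (rule card_ge_0_finite) (simp only: assms(2) p)
    then show ?thesis by (rule finite_subset[OF subset_UNIV])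
  qed
  have "card B \<le> card {b, 1 / a}" unfolding B_def by (intro card_mono) auto
  then have B2: "card B \<le> 2" using card_insert_le_m1[of 2 "{1 / a}" b] by simp
  \<comment> \<open>Both sets consist of \<open>k\<close>-th roots of unity, so disjointness bounds
    their joint size by \<open>k\<close>.\<close>
  have "A \<inter> B = {}" using ab(1) by (auto simp: A_def B_def)
  then have "card A + card B = card (A \<union> B)" using fin by (simp add: card_Un_disjoint)
  also have "\<dots> \<le> card {u :: 'k. u ^ k = 1}" by (rule card_mono[OF fin]) (auto simp: A_def B_def)
  also have "\<dots> \<le> k" by (rule card_power_eq_le) (use k in simp)
  finally have AB: "card A + card B \<le> k" .
  have M: "real (card A) \<le> real s ^ 2 - 2 * real s + (2 * real k + 2) / (real s + 1)"
    if s: "2 \<le> s" "s \<le> k" "s \<le> n" for s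
  proof -
    obtain t where t: "s = Suc t" using s(1) by (cases s) auto
    \<comment> \<open>The condition of \<open>card_pairs_in_subgroup\<close> on the characteristic
      follows from \<open>(k + 1) (s - 1) < k s \<le> k n < p\<close>.\<close>
    have "(k + 1) * t = k * t + t" by simp
    also have "\<dots> < k * t + k" using s(2) t by simp
    also have "\<dots> = k * s" by (simp add: t)
    also have "\<dots> \<le> k * n" using s(3) by simp
    finally have char_s: "(k + 1) * (s - 1) < CHAR('k)" unfolding char p t by (simp add: mult.commute)
    have "int (card A) * (int s ^ 2 - 1) + 2 * int s ^ 2 * (int s - 1)
       \<le> (int s ^ 2 - 1) * (int s ^ 2 - 2) + (int s - 1) * (2 * int k + 4)"
      by (rule card_pairs_in_subgroup[OF fin _ ab s(1,2) char_s]) (simp add: A_def)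
    then have "real_of_int (int (card A) * (int s ^ 2 - 1) + 2 * int s ^ 2 * (int s - 1))
       \<le> real_of_int ((int s ^ 2 - 1) * (int s ^ 2 - 2) + (int s - 1) * (2 * int k + 4))"
      by (rule of_int_le_iff[THEN iffD2])
    then have main: "real (card A) * (real s ^ 2 - 1) + 2 * real s ^ 2 * (real s - 1)
       \<le> (real s ^ 2 - 1) * (real s ^ 2 - 2) + (real s - 1) * (2 * real k + 4)"
      by simp
    define m S K where "m = real (card A)" and "S = real s" and "K = real k"
    have S: "0 < S - 1" "0 < S + 1" using s(1) by (simp_all add: S_def)
    \<comment> \<open>All terms of \<open>main\<close> contain the factor
      \<open>S - 1\<close>.\<close>
    have "(S - 1) * (m * (S + 1)) \<le> (S - 1) * ((S ^ 2 - 2 * S) * (S + 1) + (2 * K + 2))"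
      using main unfolding m_def[symmetric] S_def[symmetric] K_def[symmetric]
      by (simp add: algebra_simps power2_eq_square)
    then have "m * (S + 1) \<le> (S ^ 2 - 2 * S) * (S + 1) + (2 * K + 2)"
      using S(1) by (simp only: mult_le_cancel_left_pos)
    also have "2 * K + 2 = (2 * K + 2) / (S + 1) * (S + 1)" using S(2) by simp
    also have "(S ^ 2 - 2 * S) * (S + 1) + \<dots> = (S ^ 2 - 2 * S + (2 * K + 2) / (S + 1)) * (S + 1)"
      by (rule distrib_right[symmetric])
    finally have "m \<le> S ^ 2 - 2 * S + (2 * K + 2) / (S + 1)"
      using S(2) by (simp only: mult_le_cancel_right_pos)
    then show ?thesis unfolding m_def S_def K_def .
  qed
  define z where "z = sqrt 2 * real k"
  define x where "x = z powr (1 / 3)"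
  have z0: "0 < z" using k by (simp add: z_def)
  have x0: "0 < x" using z0 by (simp add: x_def)
  have "x ^ 3 = x powr (real 3)" by (rule powr_realpow[OF x0, symmetric])
  also have "\<dots> = z" using z0 by (simp add: x_def powr_powr)
  finally have x3: "x ^ 3 = z" .
  have "z powr (2 / 3) = x powr (real 2)" using z0 by (simp add: x_def powr_powr)
  also have "\<dots> = x ^ 2" by (rule powr_realpow[OF x0])
  finally have x2: "z powr (2 / 3) = x ^ 2" .
  have "real n * real k \<le> real n * ((real n + 3) * (real n + 4) * (3 * real n - 1) / 12 - 3)"
    using assms(9) unfolding p by simp
  then have k_le: "real k \<le> (real n + 3) * (real n + 4) * (3 * real n - 1) / 12 - 3"
    using n(2) by (simp only: mult_le_cancel_left_pos of_nat_0_less_iff)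
  have bound: "real (card A) + 2 * real (card B) / real n \<le> target x"
    by (rule count_le_target[OF assms(1) p n(1) k k_le AB B2 M x0 x3[unfolded z_def]])
  have "card (rational_points C) \<le> card (proj_points n a b)"
    by (rule card_rational_points_le_proj_points[OF assms(1,2) n(2) np ab assms(8)])
  also have "\<dots> \<le> n ^ 2 * card A + 2 * n * card B"
    unfolding A_def B_def by (rule card_proj_points_le[OF assms(2)[unfolded p] n(2) ab])
  finally have "real (card (rational_points C)) \<le> real (n ^ 2 * card A + 2 * n * card B)"
    by (rule of_nat_mono)
  also have "\<dots> = real n ^ 2 * (real (card A) + 2 * real (card B) / real n)"
    using n(2) by (simp add: distrib_left power2_eq_square)
  also have "\<dots> \<le> real n ^ 2 * target x"
    by (rule mult_left_mono[OF bound]) simp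
  finally show ?thesis
    unfolding target_def powr_half_sqrt[OF zero_le_numeral] z_def[symmetric] x_def[symmetric] x2 .
qed

end
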